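(* Let $F:(M,g,J)\to(N,g')$ be a conformal anti-invariant submersion with dilation $\lambda$ from a Kähler manifold $(M,g,J)$ to a Riemannian manifold $(N,g')$. Then the following assertions are equivalent: (i) $(\ker F_* )^\perp$ defines a totally geodesic foliation on $M$; (ii) for all $X,Y\in\Gamma((\ker F_* )^\perp)$ and $V\in\Gamma(\ker F_* )$, $$\frac{1}{\lambda^2}g'(\nabla^F_{X}F_*CY,F_*JV)=-g(A_XBY,JV)+g(\mathcal H\operatorname{grad}\ln\lambda,CY)\,g(X,JV)-g(\mathcal H\operatorname{grad}\ln\lambda,JV)\,g(X,CY).$$
   Context: A Kähler manifold $(M,g,J)$ is a Riemannian manifold with a $(1,1)$-tensor field $J$ such that $J^2=-I$, $g(JX,JY)=g(X,Y)$ and $\nabla J=0$, where $\nabla$ is the Levi-Civita connection of $g$. A smooth submersion $F:(M,g)\to(N,g')$ is horizontally conformal with dilation $\lambda:M\to(0,\infty)$ if $g'(F_*X,F_*Y)=\lambda^2g(X,Y)$ for all $X,Y\in\Gamma((\ker F_* )^\perp)$. It is a conformal anti-invariant submersion if moreover $J(\ker F_* )\subseteq(\ker F_* )^\perp$. Sections of $\ker F_*$ are vertical, sections of $(\ker F_* )^\perp$ are horizontal; $\mathcal V,\mathcal H$ are the orthogonal projections onto the vertical and horizontal distributions. Let $\mu$ be the orthogonal complement of $J(\ker F_* )$ in $(\ker F_* )^\perp$ (it is $J$-invariant). For horizontal $X$ write $JX=BX+CX$ with $BX\in\Gamma(\ker F_* )$ and $CX\in\Gamma(\mu)$. O'Neill's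 tensor $A$ is $A_EG=\mathcal V\nabla_{\mathcal HE}\mathcal HG+\mathcal H\nabla_{\mathcal HE}\mathcal VG$ for vector fields $E,G$ on $M$. $\nabla^F$ denotes the pullback to $F^{-1}TN$ of the Levi-Civita connection of $N$ (the derivative $\nabla^F_XF_*CY$ is also written $\nabla_{F_*X}F_*CY$). A distribution $D$ defines a totally geodesic foliation if $\nabla_XY\in\Gamma(D)$ for all $X,Y\in\Gamma(D)$. *)

theory Defs
  imports "HOL-Analysis.Analysis" "HOL-Library.Function_Algebras"
begin

section \<open>Pointwise real vector space structure on functions\<close>

instantiation "fun" :: (type, scaleR) scaleR
begin

definition scaleR_fun_def: "c *\<^sub>R f = (\<lambda>x. c *\<^sub>R f x)"

instance ..

end

instance "fun" :: (type, real_vector) real_vector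
  by standard (simp_all add: fun_eq_iff scaleR_fun_def scaleR_add_right scaleR_add_left)

section \<open>Smooth manifolds\<close>

text \<open>Both predicates are meant for open sets only.\<close>

primrec Ck_on :: "nat \<Rightarrow> 'e::real_normed_vector set \<Rightarrow> ('e \<Rightarrow> 'f::real_normed_vector) \<Rightarrow> bool" where
  "Ck_on 0 S f \<longleftrightarrow> continuous_on S f"
| "Ck_on (Suc k) S f \<longleftrightarrow>
     (\<forall>x\<in>S. f differentiable (at x)) \<and> (\<forall>v. Ck_on k S (\<lambda>x. frechet_derivative f (at x) v))"

definition smooth_on :: "'e::real_normed_vector set \<Rightarrow> ('e \<Rightarrow> 'f::real_normed_vector) \<Rightarrow> bool" where
  "smooth_on S f \<longleftrightarrow> (\<forall>k. Ck_on k S f)"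

text \<open>Tangent vectors at a point are derivations of the algebra of smooth functions. As
  Isabelle functions are total, they are normalised to vanish on non-smooth functions.\<close>

type_synonym 'a tangent = "('a \<Rightarrow> real) \<Rightarrow> real"
type_synonym 'a field = "'a \<Rightarrow> 'a tangent"

text \<open>The underlying set of a manifold is the whole type \<open>'a\<close>, the model space is the Euclidean
  space \<open>'e\<close>, and a chart is a pair of its domain and the coordinate map.\<close>

record ('a, 'e) manifold =
  atlas :: "('a set \<times> ('a \<Rightarrow> 'e)) set"
  metric :: "'a \<Rightarrow> 'a tangent \<Rightarrow> 'a tangent \<Rightarrow> real"

definition smooth_manifold ::
  "('a::{t2_space,second_countable_topology}, 'e::euclidean_space) manifold \<Rightarrow> bool" where
  "smooth_manifold M \<longleftrightarrow>
     (\<forall>(U, \<phi>)\<in>atlas M. open U \<and> open (\<phi> ` U) \<and> (\<exists>\<psi>. homeomorphism U (\<phi> ` U) \<phi> \<psi>)) \<and>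
     (\<Union>(U, \<phi>)\<in>atlas M. U) = UNIV \<and>
     (\<forall>(U, \<phi>)\<in>atlas M. \<forall>(U', \<phi>')\<in>atlas M. smooth_on (\<phi> ` (U \<inter> U')) (\<phi>' \<circ> inv_into U \<phi>))"

definition smooth_functions ::
  "('a::{t2_space,second_countable_topology}, 'e::euclidean_space) manifold \<Rightarrow> ('a \<Rightarrow> real) set" where
  "smooth_functions M = {f. \<forall>(U, \<phi>)\<in>atlas M. smooth_on (\<phi> ` U) (f \<circ> inv_into U \<phi>)}"

definition smooth_map ::
  "('a::{t2_space,second_countable_topology}, 'e::euclidean_space) manifold \<Rightarrow>
   ('b::{t2_space,second_countable_topology}, 'f::euclidean_space) manifold \<Rightarrow> ('a \<Rightarrow> 'b) \<Rightarrow> bool" where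
  "smooth_map M N F \<longleftrightarrow> continuous_on UNIV F \<and>
     (\<forall>(U, \<phi>)\<in>atlas M. \<forall>(W, \<psi>)\<in>atlas N. smooth_on (\<phi> ` (U \<inter> F -` W)) (\<psi> \<circ> F \<circ> inv_into U \<phi>))"

definition tangent_space ::
  "('a::{t2_space,second_countable_topology}, 'e::euclidean_space) manifold \<Rightarrow> 'a \<Rightarrow> 'a tangent set" where
  "tangent_space M p = {v.
     (\<forall>f\<in>smooth_functions M. \<forall>h\<in>smooth_functions M.
        v (f + h) = v f + v h \<and> v (f * h) = v f * h p + f p * v h) \<and>
     (\<forall>f\<in>smooth_functions M. \<forall>c. v (c *\<^sub>R f) = c * v f) \<and>
     (\<forall>f. f \<notin> smooth_functions M \<longrightarrow> v f = 0)}"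

definition vector_fields ::
  "('a::{t2_space,second_countable_topology}, 'e::euclidean_space) manifold \<Rightarrow> 'a field set" where
  "vector_fields M = {X. (\<forall>p. X p \<in> tangent_space M p) \<and>
     (\<forall>f\<in>smooth_functions M. (\<lambda>p. X p f) \<in> smooth_functions M)}"

definition lie_bracket ::
  "('a::{t2_space,second_countable_topology}, 'e::euclidean_space) manifold \<Rightarrow>
   'a field \<Rightarrow> 'a field \<Rightarrow> 'a field" where
  "lie_bracket M X Y = (\<lambda>p f. if f \<in> smooth_functions M
     then X p (\<lambda>q. Y q f) - Y p (\<lambda>q. X q f) else 0)"

definition differential ::
  "('a::{t2_space,second_countable_topology}, 'e::euclidean_space) manifold \<Rightarrow>
   ('b::{t2_space,second_countable_topology}, 'f::euclidean_space) manifold \<Rightarrow> ('a \<Rightarrow> 'b) \<Rightarrow>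
   'a \<Rightarrow> 'a tangent \<Rightarrow> 'b tangent" where
  "differential M N F p v = (\<lambda>h. if h \<in> smooth_functions N then v (h \<circ> F) else 0)"

text \<open>Smooth sections of the pullback bundle \<open>F\<^sup>-\<^sup>1TN\<close>.\<close>

definition fields_along ::
  "('a::{t2_space,second_countable_topology}, 'e::euclidean_space) manifold \<Rightarrow>
   ('b::{t2_space,second_countable_topology}, 'f::euclidean_space) manifold \<Rightarrow> ('a \<Rightarrow> 'b) \<Rightarrow>
   ('a \<Rightarrow> 'b tangent) set" where
  "fields_along M N F = {s. (\<forall>p. s p \<in> tangent_space N (F p)) \<and>
     (\<forall>h\<in>smooth_functions N. (\<lambda>p. s p h) \<in> smooth_functions M)}"

text \<open>Smooth sections of a distribution, which is given by its fibres.\<close>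

definition sections ::
  "('a::{t2_space,second_countable_topology}, 'e::euclidean_space) manifold \<Rightarrow>
   ('a \<Rightarrow> 'a tangent set) \<Rightarrow> 'a field set" where
  "sections M D = {X \<in> vector_fields M. \<forall>p. X p \<in> D p}"

section \<open>Riemannian metrics and connections\<close>

definition riemannian_manifold ::
  "('a::{t2_space,second_countable_topology}, 'e::euclidean_space) manifold \<Rightarrow> bool" where
  "riemannian_manifold M \<longleftrightarrow> smooth_manifold M \<and>
     (\<forall>p. \<forall>u\<in>tangent_space M p. \<forall>v\<in>tangent_space M p.
        metric M p u v = metric M p v u \<and>
        (u \<noteq> 0 \<longrightarrow> metric M p u u > 0) \<and>
        (\<forall>w\<in>tangent_space M p. metric M p (u + v) w = metric M p u w + metric M p v w) \<and>
        (\<forall>c. metric M p (c *\<^sub>R u) v = c * metric M p u v)) \<and>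
     (\<forall>X\<in>vector_fields M. \<forall>Y\<in>vector_fields M. (\<lambda>p. metric M p (X p) (Y p)) \<in> smooth_functions M)"

text \<open>A connection on a vector bundle over \<open>M\<close> with module of smooth sections \<open>S\<close>. Real
  homogeneity in the second argument is the Leibniz rule for constant functions.\<close>

definition connection ::
  "('a::{t2_space,second_countable_topology}, 'e::euclidean_space) manifold \<Rightarrow>
   ('a \<Rightarrow> 'v::real_vector) set \<Rightarrow> ('a field \<Rightarrow> ('a \<Rightarrow> 'v) \<Rightarrow> ('a \<Rightarrow> 'v)) \<Rightarrow> bool" where
  "connection M S D \<longleftrightarrow>
     (\<forall>X\<in>vector_fields M. \<forall>s\<in>S. D X s \<in> S) \<and>
     (\<forall>X\<in>vector_fields M. \<forall>Y\<in>vector_fields M. \<forall>s\<in>S. D (X + Y) s = D X s + D Y s) \<and>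
     (\<forall>f\<in>smooth_functions M. \<forall>X\<in>vector_fields M. \<forall>s\<in>S.
        D (\<lambda>p. f p *\<^sub>R X p) s = (\<lambda>p. f p *\<^sub>R D X s p)) \<and>
     (\<forall>X\<in>vector_fields M. \<forall>s\<in>S. \<forall>t\<in>S. D X (s + t) = D X s + D X t) \<and>
     (\<forall>f\<in>smooth_functions M. \<forall>X\<in>vector_fields M. \<forall>s\<in>S.
        D X (\<lambda>p. f p *\<^sub>R s p) = (\<lambda>p. X p f *\<^sub>R s p + f p *\<^sub>R D X s p))"

definition levi_civita ::
  "('a::{t2_space,second_countable_topology}, 'e::euclidean_space) manifold \<Rightarrow>
   ('a field \<Rightarrow> 'a field \<Rightarrow> 'a field) \<Rightarrow> bool" where
  "levi_civita M nabla \<longleftrightarrow> connection M (vector_fields M) nabla \<and>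
     (\<forall>X\<in>vector_fields M. \<forall>Y\<in>vector_fields M. nabla X Y - nabla Y X = lie_bracket M X Y) \<and>
     (\<forall>X\<in>vector_fields M. \<forall>Y\<in>vector_fields M. \<forall>Z\<in>vector_fields M. \<forall>p.
        X p (\<lambda>q. metric M q (Y q) (Z q)) =
        metric M p (nabla X Y p) (Z p) + metric M p (Y p) (nabla X Z p))"

text \<open>The pullback of a connection \<open>nabla\<close> of \<open>N\<close> is the connection on \<open>F\<^sup>-\<^sup>1TN\<close> which maps
  \<open>X\<close> and \<open>Z \<circ> F\<close> to the derivative of \<open>Z\<close> in the direction \<open>F\<^sub>*X\<close>. As \<open>nabla\<close> takes vector fields
  as arguments, its value in the direction of a single tangent vector is that for any vector
  field \<open>W\<close> extending the tangent vector.\<close>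

definition pullback_connection ::
  "('a::{t2_space,second_countable_topology}, 'e::euclidean_space) manifold \<Rightarrow>
   ('b::{t2_space,second_countable_topology}, 'f::euclidean_space) manifold \<Rightarrow> ('a \<Rightarrow> 'b) \<Rightarrow>
   ('b field \<Rightarrow> 'b field \<Rightarrow> 'b field) \<Rightarrow>
   ('a field \<Rightarrow> ('a \<Rightarrow> 'b tangent) \<Rightarrow> ('a \<Rightarrow> 'b tangent)) \<Rightarrow> bool" where
  "pullback_connection M N F nabla D \<longleftrightarrow> connection M (fields_along M N F) D \<and>
     (\<forall>X\<in>vector_fields M. \<forall>Z\<in>vector_fields N. \<forall>W\<in>vector_fields N. \<forall>p.
        W (F p) = differential M N F p (X p) \<longrightarrow> D X (Z \<circ> F) p = nabla W Z (F p))"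

definition grad ::
  "('a::{t2_space,second_countable_topology}, 'e::euclidean_space) manifold \<Rightarrow>
   ('a \<Rightarrow> real) \<Rightarrow> 'a field" where
  "grad M f = (\<lambda>p. THE w. w \<in> tangent_space M p \<and> (\<forall>v\<in>tangent_space M p. metric M p w v = v f))"

definition orth_proj ::
  "('a::{t2_space,second_countable_topology}, 'e::euclidean_space) manifold \<Rightarrow>
   ('a \<Rightarrow> 'a tangent set) \<Rightarrow> 'a field \<Rightarrow> 'a field" where
  "orth_proj M D X = (\<lambda>p. THE w. w \<in> D p \<and> (\<forall>u\<in>D p. metric M p (X p - w) u = 0))"

definition totally_geodesic_foliation ::
  "('a::{t2_space,second_countable_topology}, 'e::euclidean_space) manifold \<Rightarrow>
   ('a field \<Rightarrow> 'a field \<Rightarrow> 'a field) \<Rightarrow> ('a \<Rightarrow> 'a tangent set) \<Rightarrow> bool" where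
  "totally_geodesic_foliation M nabla D \<longleftrightarrow>
     (\<forall>X\<in>sections M D. \<forall>Y\<in>sections M D. nabla X Y \<in> sections M D)"

definition tensor_field_1_1 ::
  "('a::{t2_space,second_countable_topology}, 'e::euclidean_space) manifold \<Rightarrow>
   ('a \<Rightarrow> 'a tangent \<Rightarrow> 'a tangent) \<Rightarrow> bool" where
  "tensor_field_1_1 M J \<longleftrightarrow>
     (\<forall>p. \<forall>u\<in>tangent_space M p. J p u \<in> tangent_space M p \<and>
        (\<forall>v\<in>tangent_space M p. J p (u + v) = J p u + J p v) \<and>
        (\<forall>c. J p (c *\<^sub>R u) = c *\<^sub>R J p u)) \<and>
     (\<forall>X\<in>vector_fields M. (\<lambda>p. J p (X p)) \<in> vector_fields M)"

text \<open>The argument \<open>nabla\<close> is the Levi-Civita connection of the metric of \<open>M\<close>.\<close>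

definition kaehler_manifold ::
  "('a::{t2_space,second_countable_topology}, 'e::euclidean_space) manifold \<Rightarrow>
   ('a \<Rightarrow> 'a tangent \<Rightarrow> 'a tangent) \<Rightarrow> ('a field \<Rightarrow> 'a field \<Rightarrow> 'a field) \<Rightarrow> bool" where
  "kaehler_manifold M J nabla \<longleftrightarrow>
     riemannian_manifold M \<and> tensor_field_1_1 M J \<and> levi_civita M nabla \<and>
     (\<forall>p. \<forall>u\<in>tangent_space M p. J p (J p u) = - u) \<and>
     (\<forall>p. \<forall>u\<in>tangent_space M p. \<forall>v\<in>tangent_space M p.
        metric M p (J p u) (J p v) = metric M p u v) \<and>
     (\<forall>X\<in>vector_fields M. \<forall>Y\<in>vector_fields M. \<forall>p.
        nabla X (\<lambda>q. J q (Y q)) p - J p (nabla X Y p) = 0)"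

section \<open>Conformal anti-invariant submersions\<close>

definition vertical ::
  "('a::{t2_space,second_countable_topology}, 'e::euclidean_space) manifold \<Rightarrow>
   ('b::{t2_space,second_countable_topology}, 'f::euclidean_space) manifold \<Rightarrow> ('a \<Rightarrow> 'b) \<Rightarrow>
   'a \<Rightarrow> 'a tangent set" where
  "vertical M N F p = {v \<in> tangent_space M p. differential M N F p v = 0}"

definition horizontal ::
  "('a::{t2_space,second_countable_topology}, 'e::euclidean_space) manifold \<Rightarrow>
   ('b::{t2_space,second_countable_topology}, 'f::euclidean_space) manifold \<Rightarrow> ('a \<Rightarrow> 'b) \<Rightarrow>
   'a \<Rightarrow> 'a tangent set" where
  "horizontal M N F p = {w \<in> tangent_space M p. \<forall>v\<in>vertical M N F p. metric M p w v = 0}"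

definition submersion ::
  "('a::{t2_space,second_countable_topology}, 'e::euclidean_space) manifold \<Rightarrow>
   ('b::{t2_space,second_countable_topology}, 'f::euclidean_space) manifold \<Rightarrow> ('a \<Rightarrow> 'b) \<Rightarrow> bool" where
  "submersion M N F \<longleftrightarrow> smooth_map M N F \<and>
     (\<forall>p. differential M N F p ` tangent_space M p = tangent_space N (F p))"

definition horizontally_conformal ::
  "('a::{t2_space,second_countable_topology}, 'e::euclidean_space) manifold \<Rightarrow>
   ('b::{t2_space,second_countable_topology}, 'f::euclidean_space) manifold \<Rightarrow> ('a \<Rightarrow> 'b) \<Rightarrow>
   ('a \<Rightarrow> real) \<Rightarrow> bool" where
  "horizontally_conformal M N F dil \<longleftrightarrow>
     dil \<in> smooth_functions M \<and> (\<forall>p. dil p > 0) \<and>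
     (\<forall>X\<in>sections M (horizontal M N F). \<forall>Y\<in>sections M (horizontal M N F). \<forall>p.
        metric N (F p) (differential M N F p (X p)) (differential M N F p (Y p)) =
        (dil p)\<^sup>2 * metric M p (X p) (Y p))"

definition conformal_anti_invariant_submersion ::
  "('a::{t2_space,second_countable_topology}, 'e::euclidean_space) manifold \<Rightarrow>
   ('b::{t2_space,second_countable_topology}, 'f::euclidean_space) manifold \<Rightarrow> ('a \<Rightarrow> 'b) \<Rightarrow>
   ('a \<Rightarrow> 'a tangent \<Rightarrow> 'a tangent) \<Rightarrow> ('a \<Rightarrow> real) \<Rightarrow> bool" where
  "conformal_anti_invariant_submersion M N F J dil \<longleftrightarrow>
     submersion M N F \<and> horizontally_conformal M N F dil \<and>
     (\<forall>p. J p ` vertical M N F p \<subseteq> horizontal M N F p)"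

definition mu ::
  "('a::{t2_space,second_countable_topology}, 'e::euclidean_space) manifold \<Rightarrow>
   ('b::{t2_space,second_countable_topology}, 'f::euclidean_space) manifold \<Rightarrow> ('a \<Rightarrow> 'b) \<Rightarrow>
   ('a \<Rightarrow> 'a tangent \<Rightarrow> 'a tangent) \<Rightarrow> 'a \<Rightarrow> 'a tangent set" where
  "mu M N F J p = {w \<in> horizontal M N F p. \<forall>v\<in>vertical M N F p. metric M p w (J p v) = 0}"

text \<open>The components in \<open>JX = BX + CX\<close> for horizontal \<open>X\<close>.\<close>

definition B_part ::
  "('a::{t2_space,second_countable_topology}, 'e::euclidean_space) manifold \<Rightarrow>
   ('b::{t2_space,second_countable_topology}, 'f::euclidean_space) manifold \<Rightarrow> ('a \<Rightarrow> 'b) \<Rightarrow>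
   ('a \<Rightarrow> 'a tangent \<Rightarrow> 'a tangent) \<Rightarrow> 'a field \<Rightarrow> 'a field" where
  "B_part M N F J X = (\<lambda>p. THE b. b \<in> vertical M N F p \<and> (\<exists>c\<in>mu M N F J p. J p (X p) = b + c))"

definition C_part ::
  "('a::{t2_space,second_countable_topology}, 'e::euclidean_space) manifold \<Rightarrow>
   ('b::{t2_space,second_countable_topology}, 'f::euclidean_space) manifold \<Rightarrow> ('a \<Rightarrow> 'b) \<Rightarrow>
   ('a \<Rightarrow> 'a tangent \<Rightarrow> 'a tangent) \<Rightarrow> 'a field \<Rightarrow> 'a field" where
  "C_part M N F J X = (\<lambda>p. THE c. c \<in> mu M N F J p \<and> (\<exists>b\<in>vertical M N F p. J p (X p) = b + c))"

definition oneill_A ::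
  "('a::{t2_space,second_countable_topology}, 'e::euclidean_space) manifold \<Rightarrow>
   ('b::{t2_space,second_countable_topology}, 'f::euclidean_space) manifold \<Rightarrow> ('a \<Rightarrow> 'b) \<Rightarrow>
   ('a field \<Rightarrow> 'a field \<Rightarrow> 'a field) \<Rightarrow> 'a field \<Rightarrow> 'a field \<Rightarrow> 'a field" where
  "oneill_A M N F nabla E G =
     (let V = orth_proj M (vertical M N F); H = orth_proj M (horizontal M N F)
      in V (nabla (H E) (H G)) + H (nabla (H E) (V G)))"

end

theory Submission
  imports Defs
begin

text \<open>Let \<open>X\<close>, \<open>Y\<close> be horizontal and \<open>V\<close> vertical. The horizontal distribution is totally geodesic
  iff \<open>g(\<nabla>\<^sub>XY, V) = 0\<close> for all of them. As \<open>J\<close> is orthogonal and parallel,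
  \<open>g(\<nabla>\<^sub>XY, V) = g(\<nabla>\<^sub>XJY, JV) = g(\<nabla>\<^sub>XBY, JV) + g(\<nabla>\<^sub>XCY, JV)\<close>. The first summand is
  \<open>g(A\<^sub>XBY, JV)\<close>, because \<open>JV\<close> is horizontal. In the second one all three fields are horizontal, and
  for such fields a horizontally conformal map satisfies
  \<open>g'(\<nabla>\<^sup>F\<^sub>XF\<^sub>*Y, F\<^sub>*Z) = \<lambda>\<^sup>2 (g(\<nabla>\<^sub>XY, Z) + X(ln \<lambda>) g(Y, Z) + Y(ln \<lambda>) g(X, Z) - Z(ln \<lambda>) g(X, Y))\<close>
  (lemma \<open>nablaF_horizontal\<close>). For \<open>Y := CY\<close> and \<open>Z := JV\<close> the term with \<open>X(ln \<lambda>)\<close> vanishes, since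
  \<open>CY\<close> is orthogonal to \<open>JV\<close>. The result is a formula for \<open>g(\<nabla>\<^sub>XY, V)\<close> (lemma
  \<open>vertical_component_nabla\<close>) that vanishes exactly when the equation of the theorem holds.

  The conformal formula is a comparison of two Koszul formulas. It uses that the pullback
  connection is metric and that it is torsion-free in the sense
  \<open>\<nabla>\<^sup>F\<^sub>XF\<^sub>*Y - \<nabla>\<^sup>F\<^sub>YF\<^sub>*X = F\<^sub>*[X, Y]\<close>; both are verified in a coordinate frame of \<open>N\<close> (lemmas
  \<open>nablaF_metric\<close> and \<open>nablaF_torsion_free\<close>).

  Tangent vectors are derivations of the global smooth functions and all data are global fields.
  Local arguments therefore rest on bump functions, and local frames are made of global fields which
  form a frame near one point only. Hadamard's lemma provides coordinate frames
  (lemma \<open>coordinate_frame\<close>), and Gram--Schmidt turns them into smooth orthonormal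
  frames, from which gradients and the smoothness of the projections are derived.\<close>

section \<open>Calculus of smooth functions on open sets\<close>

text \<open>Derivatives at the points of an open set only see the values on that set.\<close>

lemma Ck_on_cong:
  assumes "open S" "\<And>x. x \<in> S \<Longrightarrow> f x = g x"
  shows "Ck_on k S f \<longleftrightarrow> Ck_on k S g"
  using assms(2)
proof (induction k arbitrary: f g)
  case 0
  then show ?case by (simp cong: continuous_on_cong)
next
  case (Suc k)
  have D: "(f has_derivative D) (at x) \<longleftrightarrow> (g has_derivative D) (at x)" if "x \<in> S" for D x
    using has_derivative_transform_within_open[OF _ \<open>open S\<close> that] Suc.prems by metis
  have F: "frechet_derivative f (at x) = frechet_derivative g (at x)" if "x \<in> S" for x
    using D[OF that] by (simp add: frechet_derivative_def)
  have "Ck_on k S (\<lambda>x. frechet_derivative f (at x) v)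
      \<longleftrightarrow> Ck_on k S (\<lambda>x. frechet_derivative g (at x) v)" for v
    by (rule Suc.IH) (simp add: F)
  moreover have "(\<forall>x\<in>S. f differentiable (at x)) \<longleftrightarrow> (\<forall>x\<in>S. g differentiable (at x))"
    using D by (auto simp: differentiable_def)
  ultimately show ?case by simp
qed

lemma Ck_on_subset: "Ck_on k S f \<Longrightarrow> T \<subseteq> S \<Longrightarrow> Ck_on k T f"
  by (induction k arbitrary: f) (auto intro: continuous_on_subset)

lemma Ck_on_local:
  assumes "\<And>x. x \<in> S \<Longrightarrow> \<exists>T. open T \<and> x \<in> T \<and> Ck_on k T f"
  shows "Ck_on k S f"
  using assms
proof (induction k arbitrary: f)
  case 0
  have "continuous (at x) f" if x: "x \<in> S" for x
    using 0[OF x] by (auto simp: continuous_on_eq_continuous_at)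
  then show ?case by (simp add: continuous_at_imp_continuous_on)
next
  case (Suc k)
  have "Ck_on k S (\<lambda>x. frechet_derivative f (at x) v)" for v
    by (rule Suc.IH) (use Suc.prems in fastforce)
  moreover have "f differentiable (at x)" if "x \<in> S" for x
    using Suc.prems[OF that] by auto
  ultimately show ?case by simp
qed

lemma Ck_on_SucI:
  assumes "open S" "\<And>x. x \<in> S \<Longrightarrow> (f has_derivative f' x) (at x)"
    "\<And>v. Ck_on k S (\<lambda>x. f' x v)"
  shows "Ck_on (Suc k) S f"
proof -
  have "Ck_on k S (\<lambda>x. frechet_derivative f (at x) v)" for v
    using Ck_on_cong[OF assms(1), of "\<lambda>x. f' x v" "\<lambda>x. frechet_derivative f (at x) v" k]
      assms(2,3) frechet_derivative_at by metis
  then show ?thesis using assms(2) by (auto simp: differentiable_def)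
qed

lemma Ck_on_Suc_has_derivative:
  assumes "Ck_on (Suc k) S f" "x \<in> S"
  shows "(f has_derivative frechet_derivative f (at x)) (at x)"
  using assms frechet_derivative_works by auto

lemma Ck_on_SucD: "Ck_on (Suc k) S f \<Longrightarrow> Ck_on k S f"
proof (induction k arbitrary: f)
  case 0
  then show ?case
    by (simp add: continuous_at_imp_continuous_on differentiable_imp_continuous_within)
next
  case (Suc k)
  then show ?case by auto
qed

lemma Ck_on_const: "Ck_on k S (\<lambda>x. c)"
proof (induction k arbitrary: c)
  case (Suc k)
  then show ?case by simp
qed simp

lemma Ck_on_bounded_linear:
  assumes "open S" "bounded_linear f"
  shows "Ck_on k S f"
proof (cases k)
  case 0
  then show ?thesis using assms(2) by (simp add: linear_continuous_on)
next
  case (Suc k')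
  show ?thesis unfolding Suc
    by (rule Ck_on_SucI[where f' = "\<lambda>x. f"])
      (auto simp: assms Ck_on_const bounded_linear_imp_has_derivative)
qed

lemma Ck_on_compose_linear:
  assumes "open S" "bounded_linear L" "Ck_on k S f"
  shows "Ck_on k S (\<lambda>x. L (f x))"
  using assms(3)
proof (induction k arbitrary: f)
  case 0
  then show ?case using assms(2) by (simp add: bounded_linear.continuous_on)
next
  case (Suc k)
  show ?case
    by (rule Ck_on_SucI[where f' = "\<lambda>x v. L (frechet_derivative f (at x) v)"])
      (use Suc Ck_on_Suc_has_derivative[OF Suc.prems] assms in
        \<open>auto intro: bounded_linear.has_derivative\<close>)
qed

lemma Ck_on_add:
  assumes "open S" "Ck_on k S f" "Ck_on k S g"
  shows "Ck_on k S (\<lambda>x. f x + g x)"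
  using assms(2,3)
proof (induction k arbitrary: f g)
  case 0
  then show ?case by (simp add: continuous_on_add)
next
  case (Suc k)
  note D = Suc.prems[THEN Ck_on_Suc_has_derivative]
  show ?case
    by (rule Ck_on_SucI[where f' = "\<lambda>x v. frechet_derivative f (at x) v + frechet_derivative g (at x) v"])
      (use Suc assms(1) in \<open>auto intro!: has_derivative_add D\<close>)
qed

lemma Ck_on_sum:
  assumes "open S" "\<And>i. i \<in> I \<Longrightarrow> Ck_on k S (f i)"
  shows "Ck_on k S (\<lambda>x. \<Sum>i\<in>I. f i x)"
  using assms(2)
  by (induction I rule: infinite_finite_induct) (auto intro: Ck_on_const Ck_on_add[OF assms(1)])

lemma Ck_on_mult:
  fixes f g :: "'a::real_normed_vector \<Rightarrow> real"
  assumes "open S" "Ck_on k S f" "Ck_on k S g"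
  shows "Ck_on k S (\<lambda>x. f x * g x)"
  using assms(2,3)
proof (induction k arbitrary: f g)
  case 0
  then show ?case by (simp add: continuous_on_mult)
next
  case (Suc k)
  note D = Suc.prems[THEN Ck_on_Suc_has_derivative]
  note C = Suc.prems[THEN Ck_on_SucD]
  show ?case
  proof (rule Ck_on_SucI[where f' = "\<lambda>x v. f x * frechet_derivative g (at x) v + frechet_derivative f (at x) v * g x"])
    show "Ck_on k S (\<lambda>x. f x * frechet_derivative g (at x) v + frechet_derivative f (at x) v * g x)" for v
      using Suc.prems by (intro Ck_on_add assms(1) Suc.IH C) auto
  qed (use D assms(1) in \<open>auto intro!: has_derivative_mult\<close>)
qed

text \<open>The derivative \<open>Df(g x)(Dg(x) v)\<close> depends on \<open>x\<close> also through the direction \<open>Dg(x) v\<close>. Expanding the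
  latter in an orthonormal basis gives products to which the induction hypothesis applies.\<close>

lemma Ck_on_compose:
  fixes g :: "'a::real_normed_vector \<Rightarrow> 'b::euclidean_space" and f :: "'b \<Rightarrow> real"
  assumes "open S" "open T" "Ck_on k T f" "Ck_on k S g" "g ` S \<subseteq> T"
  shows "Ck_on k S (\<lambda>x. f (g x))"
  using assms(3-5)
proof (induction k arbitrary: f)
  case 0
  then show ?case by (auto intro: continuous_on_compose2)
next
  case (Suc k)
  have gT: "g x \<in> T" if "x \<in> S" for x using Suc.prems(3) that by auto
  note Df = Ck_on_Suc_has_derivative[OF Suc.prems(1)]
  note Dg = Ck_on_Suc_has_derivative[OF Suc.prems(2)]
  show ?case
  proof (rule Ck_on_SucI[where f' = "\<lambda>x v. \<Sum>b\<in>Basis.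
      (frechet_derivative g (at x) v \<bullet> b) * frechet_derivative f (at (g x)) b"])
    fix x assume x: "x \<in> S"
    have comp: "((\<lambda>x. f (g x)) has_derivative (\<lambda>v. frechet_derivative f (at (g x)) (frechet_derivative g (at x) v))) (at x)"
      using has_derivative_compose[OF Dg[OF x] Df[OF gT[OF x]]] .
    have rep: "frechet_derivative f (at (g x)) w = (\<Sum>b\<in>Basis. (w \<bullet> b) * frechet_derivative f (at (g x)) b)" for w
    proof -
      have lin: "linear (frechet_derivative f (at (g x)))"
        using has_derivative_linear[OF Df[OF gT[OF x]]] .
      have "frechet_derivative f (at (g x)) w = frechet_derivative f (at (g x)) (\<Sum>b\<in>Basis. (w \<bullet> b) *\<^sub>R b)"
        by (simp add: euclidean_representation)
      also have "\<dots> = (\<Sum>b\<in>Basis. (w \<bullet> b) * frechet_derivative f (at (g x)) b)"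
        by (simp add: linear_sum[OF lin] linear_cmul[OF lin])
      finally show ?thesis .
    qed
    show "((\<lambda>x. f (g x)) has_derivative (\<lambda>v. \<Sum>b\<in>Basis.
      (frechet_derivative g (at x) v \<bullet> b) * frechet_derivative f (at (g x)) b)) (at x)"
      by (rule has_derivative_eq_rhs[OF comp]) (rule ext, rule rep)
  next
    fix v
    show "Ck_on k S (\<lambda>x. \<Sum>b\<in>Basis. (frechet_derivative g (at x) v \<bullet> b) * frechet_derivative f (at (g x)) b)"
    proof (intro Ck_on_sum Ck_on_mult assms(1))
      fix b :: 'b
      show "Ck_on k S (\<lambda>x. frechet_derivative g (at x) v \<bullet> b)"
        by (rule Ck_on_compose_linear[OF assms(1) bounded_linear_inner_left]) (use Suc.prems in auto)
      show "Ck_on k S (\<lambda>x. frechet_derivative f (at (g x)) b)"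
        by (rule Suc.IH[OF _ Ck_on_SucD[OF Suc.prems(2)] Suc.prems(3)]) (use Suc.prems(1) in auto)
    qed
  qed (rule assms(1))
qed

lemma smooth_on_cong: "open S \<Longrightarrow> (\<And>x. x \<in> S \<Longrightarrow> f x = g x) \<Longrightarrow> smooth_on S f \<longleftrightarrow> smooth_on S g"
  unfolding smooth_on_def using Ck_on_cong by blast

lemma smooth_on_subset: "smooth_on S f \<Longrightarrow> T \<subseteq> S \<Longrightarrow> smooth_on T f"
  unfolding smooth_on_def using Ck_on_subset by blast

lemma smooth_on_local:
  assumes "\<And>x. x \<in> S \<Longrightarrow> \<exists>T. open T \<and> x \<in> T \<and> smooth_on T f"
  shows "smooth_on S f"
  unfolding smooth_on_def by (intro allI Ck_on_local) (use assms smooth_on_def in metis)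

lemma smooth_on_const: "smooth_on S (\<lambda>x. c)"
  by (simp add: smooth_on_def Ck_on_const)

lemma smooth_on_bounded_linear: "open S \<Longrightarrow> bounded_linear f \<Longrightarrow> smooth_on S f"
  by (simp add: smooth_on_def Ck_on_bounded_linear)

lemma smooth_on_add:
  "open S \<Longrightarrow> smooth_on S f \<Longrightarrow> smooth_on S g \<Longrightarrow> smooth_on S (\<lambda>x. f x + g x)"
  by (simp add: smooth_on_def Ck_on_add)

lemma smooth_on_sum:
  "open S \<Longrightarrow> (\<And>i. i \<in> I \<Longrightarrow> smooth_on S (f i)) \<Longrightarrow> smooth_on S (\<lambda>x. \<Sum>i\<in>I. f i x)"
  by (simp add: smooth_on_def Ck_on_sum)

lemma smooth_on_mult:
  fixes f g :: "'a::real_normed_vector \<Rightarrow> real"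
  shows "open S \<Longrightarrow> smooth_on S f \<Longrightarrow> smooth_on S g \<Longrightarrow> smooth_on S (\<lambda>x. f x * g x)"
  by (simp add: smooth_on_def Ck_on_mult)

lemma smooth_on_compose:
  fixes g :: "'a::real_normed_vector \<Rightarrow> 'b::euclidean_space" and f :: "'b \<Rightarrow> real"
  shows "open S \<Longrightarrow> open T \<Longrightarrow> smooth_on T f \<Longrightarrow> smooth_on S g \<Longrightarrow> g ` S \<subseteq> T
    \<Longrightarrow> smooth_on S (\<lambda>x. f (g x))"
  using Ck_on_compose unfolding smooth_on_def by blast

lemma smooth_on_has_derivative:
  "smooth_on S f \<Longrightarrow> x \<in> S \<Longrightarrow> (f has_derivative frechet_derivative f (at x)) (at x)"
  unfolding smooth_on_def using Ck_on_Suc_has_derivative by blast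

lemma smooth_on_frechet_derivative:
  "smooth_on S f \<Longrightarrow> smooth_on S (\<lambda>x. frechet_derivative f (at x) v)"
  unfolding smooth_on_def using Ck_on.simps(2) by blast

lemma smooth_on_imp_continuous_on: "smooth_on S f \<Longrightarrow> continuous_on S f"
  unfolding smooth_on_def using Ck_on.simps(1) by blast

lemma smooth_on_inverse: "smooth_on {0<..} (inverse :: real \<Rightarrow> real)"
proof -
  have "Ck_on k {0<..} (inverse :: real \<Rightarrow> real)" for k
  proof (induction k)
    case 0
    then show ?case by (auto intro!: continuous_intros)
  next
    case (Suc k)
    show ?case
    proof (rule Ck_on_SucI[where f' = "\<lambda>x v. - 1 * (inverse x * v * inverse x)"])
      show "(inverse has_derivative (\<lambda>v. - 1 * (inverse x * v * inverse x))) (at x)"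
        if "x \<in> {0<..}" for x :: real
        using has_derivative_inverse'[of x] that by simp
      show "Ck_on k {0<..} (\<lambda>x. - 1 * (inverse x * v * inverse x))" for v :: real
        by (intro Ck_on_mult Ck_on_const Suc open_greaterThan)
    qed (rule open_greaterThan)
  qed
  then show ?thesis by (simp add: smooth_on_def)
qed

lemma smooth_on_ln: "smooth_on {0<..} (ln :: real \<Rightarrow> real)"
proof -
  have "Ck_on k {0<..} (ln :: real \<Rightarrow> real)" for k
  proof (cases k)
    case 0
    then show ?thesis by (auto intro!: continuous_intros)
  next
    case (Suc k')
    have "Ck_on k' {0<..} (inverse :: real \<Rightarrow> real)" using smooth_on_inverse by (simp add: smooth_on_def)
    then have "Ck_on k' {0<..} (\<lambda>x. v * inverse x)" for v :: real
      by (intro Ck_on_mult Ck_on_const open_greaterThan)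
    then show ?thesis unfolding Suc
      by (intro Ck_on_SucI[where f' = "\<lambda>x v. v * inverse x"])
        (auto intro!: derivative_eq_intros simp: field_simps)
  qed
  then show ?thesis by (simp add: smooth_on_def)
qed

lemma smooth_on_sqrt: "smooth_on {0<..} sqrt"
proof -
  have "Ck_on k {0<..} sqrt" for k
  proof (induction k)
    case 0
    then show ?case by (auto intro!: continuous_intros)
  next
    case (Suc k)
    have "Ck_on k {0<..} (inverse :: real \<Rightarrow> real)" using smooth_on_inverse by (simp add: smooth_on_def)
    then have "Ck_on k {0<..} (\<lambda>x. inverse (sqrt x))"
      by (rule Ck_on_compose[where T = "{0<..}", rotated 2]) (auto intro: Suc)
    then have "Ck_on k {0<..} (\<lambda>x. (v / 2) * inverse (sqrt x))" for v :: real
      by (intro Ck_on_mult Ck_on_const open_greaterThan)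
    then show ?case
      by (intro Ck_on_SucI[where f' = "\<lambda>x v. (v / 2) * inverse (sqrt x)"])
        (auto intro!: derivative_eq_intros simp: field_simps)
  qed
  then show ?thesis by (simp add: smooth_on_def)
qed

section \<open>Bump functions and Hadamard's lemma\<close>

text \<open>The family is closed under differentiation up to linear combinations, which yields the
  smoothness of all its members in one induction.\<close>

definition flat :: "nat \<Rightarrow> real \<Rightarrow> real" where
  "flat n t = (if t > 0 then exp (- inverse t) * inverse t ^ n else 0)"

lemma flat_tendsto_0: "(flat n \<longlongrightarrow> 0) (at 0)"
proof -
  have 1: "((\<lambda>y. y ^ n / exp y :: real) \<longlongrightarrow> 0) at_top"
    by (rule tendsto_power_div_exp_0)
  have 2: "((\<lambda>t. exp (- inverse t) * inverse t ^ n :: real) \<longlongrightarrow> 0) (at_right 0)"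
    using filterlim_compose[OF 1 filterlim_inverse_at_top_right]
    by (simp add: exp_minus field_simps)
  have "(flat n \<longlongrightarrow> 0) (at_right 0)"
    by (rule Lim_transform_eventually[OF 2])
      (use eventually_at_right_less[of "0::real"] in \<open>auto simp: flat_def elim: eventually_mono\<close>)
  moreover have "(flat n \<longlongrightarrow> 0) (at_left 0)"
    by (rule Lim_transform_eventually[OF tendsto_const], unfold eventually_at_filter)
      (auto simp: flat_def)
  ultimately show ?thesis by (rule filterlim_split_at[rotated])
qed

lemma flat_has_derivative:
  "(flat n has_field_derivative flat (n + 2) t - n * flat (n + 1) t) (at t)"
proof -
  consider "t > 0" | "t < 0" | "t = 0" by linarith
  then show ?thesis
  proof cases
    case 1
    let ?f = "\<lambda>t::real. exp (- inverse t) * inverse t ^ n"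
    let ?g = "\<lambda>t::real. exp (- inverse t) * (inverse t ^ (n + 2) - n * inverse t ^ (n + 1))"
    have "(?f has_field_derivative ?g t) (at t)"
    proof -
      have i: "(inverse has_field_derivative - (inverse t ^ Suc (Suc 0))) (at t)"
        by (rule DERIV_inverse) (use 1 in simp)
      have alg: "e * - (- (i ^ Suc (Suc 0))) * i ^ n + real n * (- (i ^ Suc (Suc 0)) * i ^ (n - Suc 0)) * e
          = e * (i ^ (n + 2) - n * i ^ (n + 1))" for e i :: real
        by (cases n) (simp_all add: algebra_simps)
      show ?thesis
        by (rule DERIV_cong[OF DERIV_mult[OF DERIV_fun_exp[OF DERIV_minus[OF i]] DERIV_power[OF i, of n]]])
          (rule alg)
    qed
    then have "(?f has_field_derivative flat (n + 2) t - n * flat (n + 1) t) (at t)"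
      using 1 by (simp add: flat_def algebra_simps)
    then show ?thesis
      by (rule DERIV_cong_ev[THEN iffD1, OF refl _ refl, rotated])
        (use 1 eventually_nhds_in_open[of "{0<..}" t] in \<open>auto simp: flat_def elim: eventually_mono\<close>)
  next
    case 2
    have "((\<lambda>t. 0) has_field_derivative flat (n + 2) t - n * flat (n + 1) t) (at t)"
      using 2 by (simp add: flat_def)
    then show ?thesis
      by (rule DERIV_cong_ev[THEN iffD1, OF refl _ refl, rotated])
        (use 2 eventually_nhds_in_open[of "{..<0}" t] in \<open>auto simp: flat_def elim: eventually_mono\<close>)
  next
    case 3
    have "(\<lambda>h. (flat n h - flat n 0) / (h - 0)) = flat (n + 1)"
      by (auto simp: flat_def fun_eq_iff field_simps)
    then show ?thesis using flat_tendsto_0[of "n + 1"] 3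
      by (simp add: has_field_derivative_iff flat_def)
  qed
qed

lemma smooth_on_flat: "smooth_on UNIV (flat n)"
proof -
  have "Ck_on k UNIV (flat n)" for k
  proof (induction k arbitrary: n)
    case 0
    then show ?case
      using DERIV_isCont[OF flat_has_derivative] by (auto intro: continuous_at_imp_continuous_on)
  next
    case (Suc k)
    have "Ck_on k UNIV (\<lambda>t. (flat (n + 2) t + - real n * flat (n + 1) t) * v)" for v
      by (intro Ck_on_mult Ck_on_add Ck_on_const Suc open_UNIV)
    then show ?case
      by (intro Ck_on_SucI[where f' = "\<lambda>t v. (flat (n + 2) t + - real n * flat (n + 1) t) * v"])
        (use flat_has_derivative[of n] in \<open>auto simp: has_field_derivative_def\<close>)
  qed
  then show ?thesis by (simp add: smooth_on_def)
qed

text \<open>The quotient of two flat functions of the squared distance; they have no common zero, so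
  the denominator is positive.\<close>

lemma smooth_bump:
  fixes a :: "'e::euclidean_space"
  assumes "r > 0"
  obtains h where "smooth_on UNIV h" "\<And>x. x \<in> ball a r \<Longrightarrow> h x = (1::real)"
    "\<And>x. x \<notin> ball a (2 * r) \<Longrightarrow> h x = 0" "\<And>x. 0 \<le> h x" "\<And>x. h x \<le> 1"
proof -
  let ?u = "\<lambda>x. (x - a) \<bullet> (x - a)"
  let ?s = "\<lambda>x. flat 0 (4 * r\<^sup>2 + - 1 * ?u x)"
  let ?t = "\<lambda>x. flat 0 (?u x + - (r\<^sup>2))"
  have "smooth_on UNIV (\<lambda>x::'e. x \<bullet> b + - (a \<bullet> b))" for b
    by (intro smooth_on_add smooth_on_bounded_linear smooth_on_const open_UNIV bounded_linear_inner_left)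
  then have "smooth_on UNIV (\<lambda>x::'e. \<Sum>b\<in>Basis. (x \<bullet> b + - (a \<bullet> b)) * (x \<bullet> b + - (a \<bullet> b)))"
    by (intro smooth_on_sum smooth_on_mult open_UNIV)
  moreover have "?u = (\<lambda>x. \<Sum>b\<in>Basis. (x \<bullet> b + - (a \<bullet> b)) * (x \<bullet> b + - (a \<bullet> b)))"
    by (rule ext, subst euclidean_inner) (simp add: inner_diff_left)
  ultimately have u: "smooth_on UNIV ?u"
    by simp
  have s: "smooth_on UNIV ?s"
    by (rule smooth_on_compose[OF open_UNIV open_UNIV smooth_on_flat],
        intro smooth_on_add smooth_on_mult smooth_on_const u open_UNIV, simp)
  have t: "smooth_on UNIV ?t"
    by (rule smooth_on_compose[OF open_UNIV open_UNIV smooth_on_flat],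
        intro smooth_on_add smooth_on_mult smooth_on_const u open_UNIV, simp)
  have r2: "r\<^sup>2 < 4 * r\<^sup>2" using assms by simp
  have pos: "?s x + ?t x > 0" for x
  proof (cases "?u x < 4 * r\<^sup>2")
    case True
    then show ?thesis by (auto simp: flat_def add_pos_nonneg)
  next
    case False
    then have "r\<^sup>2 < ?u x" using r2 by linarith
    then show ?thesis by (auto simp: flat_def add_nonneg_pos)
  qed
  have u2: "?u x = (dist a x)\<^sup>2" for x
    by (metis dist_commute dist_norm power2_norm_eq_inner)
  let ?h = "\<lambda>x. ?s x * inverse (?s x + ?t x)"
  show thesis
  proof
    show "smooth_on UNIV ?h"
      by (intro smooth_on_mult s smooth_on_compose[OF _ _ smooth_on_inverse] smooth_on_add t) (use pos in auto)
    show "?h x = 1" if "x \<in> ball a r" for x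
    proof -
      have "(dist a x)\<^sup>2 < r\<^sup>2" using that assms by (simp add: power_strict_mono)
      then have "?t x = 0" by (simp add: flat_def u2)
      then show ?thesis using pos[of x] by simp
    qed
    show "?h x = 0" if "x \<notin> ball a (2 * r)" for x
    proof -
      have "(2 * r)\<^sup>2 \<le> (dist a x)\<^sup>2" using that assms by (intro power_mono) auto
      then show ?thesis by (simp add: flat_def u2)
    qed
    have nonneg: "flat 0 y \<ge> 0" for y by (simp add: flat_def)
    show "0 \<le> ?h x" for x using nonneg pos[of x] by (intro mult_nonneg_nonneg) auto
    show "?h x \<le> 1" for x
      unfolding divide_inverse[symmetric] using nonneg pos[of x] by (subst divide_le_eq_1_pos) auto
  qed
qed

text \<open>The integrals that arise in Hadamard's lemma; differentiation under the integral sign leads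
  to the same type of integral with a higher power of \<open>t\<close>.\<close>

lemma Ck_on_ray_integral:
  fixes H :: "'e::euclidean_space \<Rightarrow> real"
  assumes "\<And>k. Ck_on k (ball a r) H"
  shows "Ck_on k (ball a r) (\<lambda>x. integral (cbox 0 1) (\<lambda>t. t ^ j * H (a + t *\<^sub>R (x - a))))"
  using assms
proof (induction k arbitrary: H j)
  case (0 H j)
  have cH: "continuous_on (ball a r) H" using "0.prems"[of 0] by simp
  have ray: "a + t *\<^sub>R (x - a) \<in> ball a r" if "x \<in> ball a r" "t \<in> cbox 0 1" for x and t :: real
    using that by (auto simp: dist_norm norm_minus_commute intro: mult_left_le_one_le[THEN le_less_trans])
  have "continuous_on (ball a r \<times> cbox 0 1) (\<lambda>z. snd z ^ j * H (a + snd z *\<^sub>R (fst z - a)))"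
    using ray by (intro continuous_intros continuous_on_compose2[OF cH]) auto
  then have "continuous_on (ball a r \<times> cbox 0 1) (\<lambda>(x, t). t ^ j * H (a + t *\<^sub>R (x - a)))"
    by (simp add: case_prod_unfold)
  then have "continuous_on (ball a r) (\<lambda>x. integral (cbox 0 1) (\<lambda>t. t ^ j * H (a + t *\<^sub>R (x - a))))"
    by (rule integral_continuous_on_param)
  then show ?case by simp
next
  case (Suc k H j)
  let ?B = "ball a r"
  have ray: "a + t *\<^sub>R (x - a) \<in> ?B" if "x \<in> ?B" "t \<in> cbox 0 1" for x and t :: real
    using that by (auto simp: dist_norm norm_minus_commute intro: mult_left_le_one_le[THEN le_less_trans])
  have cH: "continuous_on ?B H" using Suc.prems[of 0] by simp
  have DH: "(H has_derivative frechet_derivative H (at y)) (at y)" if "y \<in> ?B" for y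
    using Ck_on_Suc_has_derivative[OF Suc.prems that] .
  have cDH: "continuous_on ?B (\<lambda>y. frechet_derivative H (at y) v)" for v
    using Suc.prems[of "Suc 0"] by simp
  \<comment> \<open>the derivative of the integrand in \<open>x\<close>\<close>
  define fx where "fx x t = Blinfun (\<lambda>v. t ^ Suc j * frechet_derivative H (at (a + t *\<^sub>R (x - a))) v)"
    for x and t :: real
  have fx: "blinfun_apply (fx x t) = (\<lambda>v. t ^ Suc j * frechet_derivative H (at (a + t *\<^sub>R (x - a))) v)"
    if "x \<in> ?B" "t \<in> cbox 0 1" for x t
    unfolding fx_def
    by (rule bounded_linear_Blinfun_apply)
      (intro bounded_linear_const_mult has_derivative_bounded_linear[OF DH[OF ray[OF that]]])
  have D: "((\<lambda>x. integral (cbox 0 1) (\<lambda>t. t ^ j * H (a + t *\<^sub>R (x - a)))) has_derivative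
      integral (cbox 0 1) (fx x)) (at x within ?B)" if x: "x \<in> ?B" for x
  proof (rule leibniz_rule[OF _ _ _ x convex_ball])
    fix x t assume xt: "x \<in> ?B" "t \<in> cbox 0 (1::real)"
    have "((\<lambda>x. a + t *\<^sub>R (x - a)) has_derivative (\<lambda>v. t *\<^sub>R v)) (at x)"
      by (auto intro!: derivative_eq_intros)
    from has_derivative_compose[OF this DH[OF ray[OF xt]]]
    have "((\<lambda>x. H (a + t *\<^sub>R (x - a))) has_derivative
        (\<lambda>v. t * frechet_derivative H (at (a + t *\<^sub>R (x - a))) v)) (at x)"
      using linear_cmul[OF has_derivative_linear[OF DH[OF ray[OF xt]]]] by simp
    from has_derivative_mult_right[OF this, of "t ^ j"]
    show "((\<lambda>x. t ^ j * H (a + t *\<^sub>R (x - a))) has_derivative blinfun_apply (fx x t)) (at x within ?B)"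
      unfolding fx[OF xt] by (simp add: mult_ac has_derivative_at_withinI)
  next
    fix x assume x: "x \<in> ?B"
    show "(\<lambda>t. t ^ j * H (a + t *\<^sub>R (x - a))) integrable_on cbox 0 1"
      by (rule integrable_continuous)
        (use ray[OF x] in \<open>intro continuous_intros continuous_on_compose2[OF cH], auto\<close>)
  next
    show "continuous_on (?B \<times> cbox 0 1) (\<lambda>(x, t). fx x t)"
    proof (rule continuous_on_blinfun_componentwise)
      fix v :: 'e
      have "continuous_on (?B \<times> cbox 0 1) (\<lambda>z. snd z ^ Suc j *
          frechet_derivative H (at (a + snd z *\<^sub>R (fst z - a))) v)"
        using ray by (intro continuous_intros continuous_on_compose2[OF cDH[of v]]) auto
      then show "continuous_on (?B \<times> cbox 0 1) (\<lambda>z. blinfun_apply (case z of (x, t) \<Rightarrow> fx x t) v)"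
        by (rule continuous_on_eq) (auto simp: fx simp del: power_Suc)
    qed
  qed
  have int: "fx x integrable_on cbox 0 1" if x: "x \<in> ?B" for x
  proof (rule integrable_continuous[OF continuous_on_blinfun_componentwise])
    fix v :: 'e
    have "continuous_on (cbox 0 1) (\<lambda>t. t ^ Suc j *
          frechet_derivative H (at (a + t *\<^sub>R (x - a))) v)"
      using ray[OF x] by (intro continuous_intros continuous_on_compose2[OF cDH[of v]]) auto
    then show "continuous_on (cbox 0 1) (\<lambda>t. blinfun_apply (fx x t) v)"
      by (rule continuous_on_eq) (auto simp: fx[OF x] simp del: power_Suc)
  qed
  have eq: "blinfun_apply (integral (cbox 0 1) (fx x)) v = integral (cbox 0 1) (\<lambda>t. t ^ Suc j *
          frechet_derivative H (at (a + t *\<^sub>R (x - a))) v)" if x: "x \<in> ?B" for x v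
  proof -
    have "blinfun_apply (integral (cbox 0 1) (fx x)) v = integral (cbox 0 1) (\<lambda>t. blinfun_apply (fx x t) v)"
      using integral_linear[OF int[OF x] blinfun.bounded_linear_left[of v]] by (simp add: o_def)
    also have "\<dots> = integral (cbox 0 1) (\<lambda>t. t ^ Suc j *
          frechet_derivative H (at (a + t *\<^sub>R (x - a))) v)"
      by (rule integral_cong) (simp add: fx[OF x])
    finally show ?thesis .
  qed
  show ?case
  proof (rule Ck_on_SucI[where f' = "\<lambda>x. blinfun_apply (integral (cbox 0 1) (fx x))"])
    show "((\<lambda>x. integral (cbox 0 1) (\<lambda>t. t ^ j * H (a + t *\<^sub>R (x - a)))) has_derivative
      blinfun_apply (integral (cbox 0 1) (fx x))) (at x)" if "x \<in> ?B" for x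
      using D[OF that] that by (simp add: at_within_open[OF that])
    fix v
    have "Ck_on k ?B (\<lambda>x. integral (cbox 0 1) (\<lambda>t. t ^ Suc j *
          frechet_derivative H (at (a + t *\<^sub>R (x - a))) v))"
      by (rule Suc.IH) (use Suc.prems in \<open>metis Ck_on.simps(2)\<close>)
    then show "Ck_on k ?B (\<lambda>x. blinfun_apply (integral (cbox 0 1) (fx x)) v)"
      by (subst Ck_on_cong[OF open_ball]) (rule eq)
  qed simp
qed

text \<open>The fundamental theorem of calculus along the rays from \<open>a\<close>.\<close>

lemma Hadamard:
  fixes f :: "'e::euclidean_space \<Rightarrow> real"
  assumes "smooth_on (ball a r) f" "r > 0"
  obtains g where "\<And>b. smooth_on (ball a r) (g b)"
    "\<And>b. g b a = frechet_derivative f (at a) b"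
    "\<And>x. x \<in> ball a r \<Longrightarrow> f x = f a + (\<Sum>b\<in>Basis. ((x - a) \<bullet> b) * g b x)"
proof
  let ?g = "\<lambda>b x. integral (cbox 0 1) (\<lambda>t. t ^ 0 * frechet_derivative f (at (a + t *\<^sub>R (x - a))) b)"
  show "smooth_on (ball a r) (?g b)" for b
    using smooth_on_frechet_derivative[OF assms(1)] unfolding smooth_on_def
    by (intro allI Ck_on_ray_integral) blast
  show "?g b a = frechet_derivative f (at a) b" for b by simp
  fix x assume x: "x \<in> ball a r"
  have ray: "a + t *\<^sub>R (x - a) \<in> ball a r" if "t \<in> cbox 0 1" for t :: real
    using that x by (auto simp: dist_norm norm_minus_commute intro: mult_left_le_one_le[THEN le_less_trans])
  note Df = smooth_on_has_derivative[OF assms(1) ray]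
  have c: "continuous_on (ball a r) (\<lambda>y. frechet_derivative f (at y) b)" for b
    using smooth_on_imp_continuous_on[OF smooth_on_frechet_derivative[OF assms(1)]] .
  have "((\<lambda>t. frechet_derivative f (at (a + t *\<^sub>R (x - a))) (x - a)) has_integral
      (f (a + 1 *\<^sub>R (x - a)) - f (a + 0 *\<^sub>R (x - a)))) {0..1}"
  proof (rule fundamental_theorem_of_calculus)
    fix t assume "t \<in> {0..1::real}"
    then have t: "t \<in> cbox 0 1" by simp
    have "((\<lambda>t. a + t *\<^sub>R (x - a)) has_derivative (\<lambda>s. s *\<^sub>R (x - a))) (at t)"
      by (auto intro!: derivative_eq_intros)
    from has_derivative_compose[OF this Df[OF t]]
    show "((\<lambda>t. f (a + t *\<^sub>R (x - a))) has_vector_derivative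
        frechet_derivative f (at (a + t *\<^sub>R (x - a))) (x - a)) (at t within {0..1})"
      using linear_cmul[OF has_derivative_linear[OF Df[OF t]]]
      by (simp add: has_vector_derivative_def has_derivative_at_withinI)
  qed simp
  then have "f x - f a = integral (cbox 0 1) (\<lambda>t. frechet_derivative f (at (a + t *\<^sub>R (x - a))) (x - a))"
    by (simp add: integral_unique)
  also have "\<dots> = integral (cbox 0 1) (\<lambda>t. \<Sum>b\<in>Basis. ((x - a) \<bullet> b) * frechet_derivative f (at (a + t *\<^sub>R (x - a))) b)"
  proof (rule integral_cong)
    fix t assume t: "t \<in> cbox 0 (1::real)"
    have lin: "linear (frechet_derivative f (at (a + t *\<^sub>R (x - a))))"
      using has_derivative_linear[OF Df[OF t]] .
    have "frechet_derivative f (at (a + t *\<^sub>R (x - a))) (x - a) =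
        frechet_derivative f (at (a + t *\<^sub>R (x - a))) (\<Sum>b\<in>Basis. ((x - a) \<bullet> b) *\<^sub>R b)"
      by (simp add: euclidean_representation)
    then show "frechet_derivative f (at (a + t *\<^sub>R (x - a))) (x - a) =
        (\<Sum>b\<in>Basis. ((x - a) \<bullet> b) * frechet_derivative f (at (a + t *\<^sub>R (x - a))) b)"
      by (simp add: linear_sum[OF lin] linear_cmul[OF lin])
  qed
  also have "\<dots> = (\<Sum>b\<in>Basis. integral (cbox 0 1) (\<lambda>t. ((x - a) \<bullet> b) * frechet_derivative f (at (a + t *\<^sub>R (x - a))) b))"
  proof (rule integral_sum[OF finite_Basis])
    fix b :: 'e
    show "(\<lambda>t. ((x - a) \<bullet> b) * frechet_derivative f (at (a + t *\<^sub>R (x - a))) b) integrable_on cbox 0 1"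
      by (rule integrable_continuous)
        (use ray in \<open>intro continuous_intros continuous_on_compose2[OF c[of b]], auto\<close>)
  qed
  finally show "f x = f a + (\<Sum>b\<in>Basis. ((x - a) \<bullet> b) * ?g b x)" by simp
qed

section \<open>Functions and tangent vectors on a manifold\<close>

locale manifold_space =
  fixes M :: "('a::{t2_space,second_countable_topology}, 'e::euclidean_space) manifold"
  assumes smooth_manifold: "smooth_manifold M"
begin

lemma chart_at:
  obtains U \<phi> where "(U, \<phi>) \<in> atlas M" "p \<in> U"
proof -
  have "p \<in> (\<Union>(U, \<phi>)\<in>atlas M. U)"
    using smooth_manifold by (simp add: smooth_manifold_def)
  then show thesis using that by auto
qed

lemma
  assumes "(U, \<phi>) \<in> atlas M"
  shows chart_domain_open: "open U" and chart_image_open: "open (\<phi> ` U)"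
    and chart_inj: "inj_on \<phi> U" and chart_continuous: "continuous_on U \<phi>"
    and chart_inv_continuous: "continuous_on (\<phi> ` U) (inv_into U \<phi>)"
    and chart_open_map: "open W \<Longrightarrow> W \<subseteq> U \<Longrightarrow> open (\<phi> ` W)"
proof -
  have *: "open U \<and> open (\<phi> ` U) \<and> (\<exists>\<psi>. homeomorphism U (\<phi> ` U) \<phi> \<psi>)"
    using bspec[OF conjunct1[OF smooth_manifold[unfolded smooth_manifold_def]] assms] by simp
  then obtain \<psi> where h: "homeomorphism U (\<phi> ` U) \<phi> \<psi>" by blast
  show "open U" "open (\<phi> ` U)" using * by auto
  show i: "inj_on \<phi> U" using h by (metis homeomorphism_apply1 inj_onI)
  show "continuous_on U \<phi>" using h by (simp add: homeomorphism_def)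
  have "\<psi> x = inv_into U \<phi> x" if "x \<in> \<phi> ` U" for x
    using that h i by (auto simp: homeomorphism_def)
  then show "continuous_on (\<phi> ` U) (inv_into U \<phi>)"
    using homeomorphism_cont2[OF h] by (metis continuous_on_cong)
  show "open (\<phi> ` W)" if "open W" "W \<subseteq> U"
  proof -
    have "openin (top_of_set U) W" using that by (simp add: openin_open_eq \<open>open U\<close>)
    from homeomorphism_imp_open_map[OF h this] show ?thesis
      using \<open>open (\<phi> ` U)\<close> by (simp add: openin_open_eq)
  qed
qed

lemma chart_preimage_open:
  assumes "(U, \<phi>) \<in> atlas M" "open S"
  shows "open {q \<in> U. \<phi> q \<in> S}"
proof -
  have "{q \<in> U. \<phi> q \<in> S} = U \<inter> \<phi> -` S" by auto
  then show ?thesis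
    using continuous_open_preimage[OF chart_continuous chart_domain_open] assms by metis
qed

lemma transition_smooth:
  assumes "(U, \<phi>) \<in> atlas M" "(U', \<phi>') \<in> atlas M"
  shows "smooth_on (\<phi> ` (U \<inter> U')) (\<phi>' \<circ> inv_into U \<phi>)"
proof -
  have "\<forall>(U, \<phi>)\<in>atlas M. \<forall>(U', \<phi>')\<in>atlas M. smooth_on (\<phi> ` (U \<inter> U')) (\<phi>' \<circ> inv_into U \<phi>)"
    using smooth_manifold by (simp add: smooth_manifold_def)
  then show ?thesis using assms by fast
qed

lemma smooth_in_chart:
  assumes "f \<in> smooth_functions M" "(U, \<phi>) \<in> atlas M"
  shows "smooth_on (\<phi> ` U) (f \<circ> inv_into U \<phi>)"
  using assms by (auto simp: smooth_functions_def)

text \<open>The transition maps are smooth, so that one chart around each point decides about smoothness.\<close>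

lemma smooth_functions_chartwiseI:
  assumes "\<And>p. \<exists>U \<phi> W h. (U, \<phi>) \<in> atlas M \<and> open W \<and> p \<in> W \<and> W \<subseteq> U \<and>
    smooth_on (\<phi> ` W) h \<and> (\<forall>q\<in>W. f q = h (\<phi> q))"
  shows "f \<in> smooth_functions M"
  unfolding smooth_functions_def
proof (clarify, rule smooth_on_local)
  fix U' \<phi>' x assume c': "(U', \<phi>') \<in> atlas M" and "x \<in> \<phi>' ` U'"
  then obtain q where q: "q \<in> U'" "x = \<phi>' q" by blast
  obtain U \<phi> W h where *: "(U, \<phi>) \<in> atlas M" "open W" "q \<in> W" "W \<subseteq> U"
    "smooth_on (\<phi> ` W) h" "\<forall>q\<in>W. f q = h (\<phi> q)" using assms[of q] by metis
  let ?T = "\<phi>' ` (U' \<inter> W)"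
  have T: "open ?T" using chart_open_map[OF c'] chart_domain_open[OF c'] *(2) by auto
  have inv: "inv_into U' \<phi>' (\<phi>' r) = r" if "r \<in> U'" for r
    using chart_inj[OF c'] that by simp
  have "smooth_on ?T (\<phi> \<circ> inv_into U' \<phi>')"
    by (rule smooth_on_subset[OF transition_smooth[OF c' *(1)]]) (use *(4) in auto)
  then have "smooth_on ?T (\<lambda>y. h ((\<phi> \<circ> inv_into U' \<phi>') y))"
    by (intro smooth_on_compose[OF T chart_open_map[OF *(1,2,4)] *(5)]) (use inv in \<open>auto simp: o_def\<close>)
  then have "smooth_on ?T (f \<circ> inv_into U' \<phi>')"
    by (rule smooth_on_cong[THEN iffD1, OF T, rotated]) (use *(6) inv in auto)
  then show "\<exists>T. open T \<and> x \<in> T \<and> smooth_on T (f \<circ> inv_into U' \<phi>')"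
    using T q *(3) by blast
qed

lemma smooth_functions_localI:
  assumes "\<And>p. \<exists>W h. open W \<and> p \<in> W \<and> h \<in> smooth_functions M \<and> (\<forall>q\<in>W. f q = h q)"
  shows "f \<in> smooth_functions M"
proof (rule smooth_functions_chartwiseI)
  fix p
  obtain W h where *: "open W" "p \<in> W" "h \<in> smooth_functions M" "\<forall>q\<in>W. f q = h q"
    using assms by metis
  obtain U \<phi> where c: "(U, \<phi>) \<in> atlas M" "p \<in> U" by (rule chart_at)
  have "smooth_on (\<phi> ` (U \<inter> W)) (h \<circ> inv_into U \<phi>)"
    by (rule smooth_on_subset[OF smooth_in_chart[OF *(3) c(1)]]) auto
  then show "\<exists>U \<phi> W h. (U, \<phi>) \<in> atlas M \<and> open W \<and> p \<in> W \<and> W \<subseteq> U \<and>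
    smooth_on (\<phi> ` W) h \<and> (\<forall>q\<in>W. f q = h (\<phi> q))"
    using * c chart_domain_open[OF c(1)] chart_inj[OF c(1)]
    by (intro exI[of _ U] exI[of _ \<phi>] exI[of _ "U \<inter> W"] exI[of _ "h \<circ> inv_into U \<phi>"]) auto
qed

lemma smooth_const: "(\<lambda>_. c) \<in> smooth_functions M"
  by (auto simp: smooth_functions_def o_def smooth_on_const)

lemma smooth_add:
  "f \<in> smooth_functions M \<Longrightarrow> g \<in> smooth_functions M \<Longrightarrow> (\<lambda>p. f p + g p) \<in> smooth_functions M"
  unfolding smooth_functions_def by (auto simp: o_def intro!: smooth_on_add chart_image_open)

lemma smooth_mult:
  "f \<in> smooth_functions M \<Longrightarrow> g \<in> smooth_functions M \<Longrightarrow> (\<lambda>p. f p * g p) \<in> smooth_functions M"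
  unfolding smooth_functions_def by (auto simp: o_def intro!: smooth_on_mult chart_image_open)

lemma smooth_cmult: "f \<in> smooth_functions M \<Longrightarrow> (\<lambda>p. c * f p) \<in> smooth_functions M"
  by (rule smooth_mult[OF smooth_const])

lemma smooth_minus: "f \<in> smooth_functions M \<Longrightarrow> (\<lambda>p. - f p) \<in> smooth_functions M"
  using smooth_cmult[of f "-1"] by simp

lemma smooth_diff:
  "f \<in> smooth_functions M \<Longrightarrow> g \<in> smooth_functions M \<Longrightarrow> (\<lambda>p. f p - g p) \<in> smooth_functions M"
  using smooth_add[OF _ smooth_minus] by simp

lemma smooth_sum:
  "(\<And>i. i \<in> I \<Longrightarrow> f i \<in> smooth_functions M) \<Longrightarrow> (\<lambda>p. \<Sum>i\<in>I. f i p) \<in> smooth_functions M"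
  by (induction I rule: infinite_finite_induct) (auto intro: smooth_const smooth_add)

lemma smooth_post_compose:
  assumes "f \<in> smooth_functions M" "\<And>p. f p > 0" "smooth_on {0<..} g"
  shows "(\<lambda>p. g (f p)) \<in> smooth_functions M"
  using assms(1) unfolding smooth_functions_def
  by (auto simp: o_def intro!: smooth_on_compose[OF _ _ assms(3)] chart_image_open assms(2))

text \<open>Extension by zero: a function given in a chart whose support is compact in the image of
  the chart. The Hausdorff property makes the support closed in the whole manifold.\<close>

lemma chart_extend:
  assumes c: "(U, \<phi>) \<in> atlas M" and S: "open S" "S \<subseteq> \<phi> ` U" and h: "smooth_on S h"
    and K: "compact K" "K \<subseteq> S" "\<And>x. x \<in> S - K \<Longrightarrow> h x = 0"
  shows "(\<lambda>q. if q \<in> U \<and> \<phi> q \<in> S then h (\<phi> q) else 0) \<in> smooth_functions M"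
proof (rule smooth_functions_chartwiseI)
  fix p
  show "\<exists>U' \<phi>' W h'. (U', \<phi>') \<in> atlas M \<and> open W \<and> p \<in> W \<and> W \<subseteq> U' \<and> smooth_on (\<phi>' ` W) h' \<and>
    (\<forall>q\<in>W. (if q \<in> U \<and> \<phi> q \<in> S then h (\<phi> q) else 0) = h' (\<phi>' q))"
  proof (cases "p \<in> U \<and> \<phi> p \<in> S")
    case True
    have "smooth_on (\<phi> ` {q \<in> U. \<phi> q \<in> S}) h" by (rule smooth_on_subset[OF h]) auto
    then show ?thesis using True c chart_preimage_open[OF c S(1)]
      by (intro exI[of _ U] exI[of _ \<phi>] exI[of _ "{q \<in> U. \<phi> q \<in> S}"] exI[of _ h]) auto
  next
    case False
    let ?L = "inv_into U \<phi> ` K"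
    have KU: "K \<subseteq> \<phi> ` U" using K S by auto
    have "closed ?L"
      by (intro compact_imp_closed compact_continuous_image K(1)
          continuous_on_subset[OF chart_inv_continuous[OF c] KU])
    moreover have "p \<notin> ?L"
      using False KU K(2) by (auto simp: inv_into_into f_inv_into_f subset_iff)
    moreover obtain U' \<phi>' where "(U', \<phi>') \<in> atlas M" "p \<in> U'" by (rule chart_at)
    moreover have "h (\<phi> q) = 0" if "q \<in> U" "\<phi> q \<in> S" "q \<notin> ?L" for q
    proof -
      have "\<phi> q \<notin> K" using that chart_inj[OF c] by (metis imageI inv_into_f_f)
      then show ?thesis using K(3) that by blast
    qed
    ultimately show ?thesis using chart_domain_open
      by (intro exI[of _ U'] exI[of _ \<phi>'] exI[of _ "U' - ?L"] exI[of _ "\<lambda>_. 0"])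
        (auto simp: smooth_on_const open_Diff)
  qed
qed

text \<open>Transported from the image of a chart. The values in the unit interval permit convex combinations
  of functions.\<close>

lemma bump_function:
  assumes "open W" "p \<in> W"
  obtains \<beta> W' where "\<beta> \<in> smooth_functions M" "open W'" "p \<in> W'" "W' \<subseteq> W"
    "\<And>q. q \<in> W' \<Longrightarrow> \<beta> q = 1" "\<And>q. q \<notin> W \<Longrightarrow> \<beta> q = 0"
    "\<And>q. 0 \<le> \<beta> q" "\<And>q. \<beta> q \<le> 1"
proof -
  obtain U \<phi> where c: "(U, \<phi>) \<in> atlas M" "p \<in> U" by (rule chart_at)
  let ?S = "\<phi> ` (U \<inter> W)"
  have oS: "open ?S" using chart_open_map[OF c(1)] chart_domain_open[OF c(1)] assms by auto
  moreover have "\<phi> p \<in> ?S" using assms c by auto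
  ultimately obtain e where e: "e > 0" "cball (\<phi> p) e \<subseteq> ?S"
    using open_contains_cball by blast
  obtain h where h: "smooth_on UNIV h" "\<And>x. x \<in> ball (\<phi> p) (e / 2) \<Longrightarrow> h x = (1::real)"
    "\<And>x. x \<notin> ball (\<phi> p) e \<Longrightarrow> h x = 0" "\<And>x. 0 \<le> h x" "\<And>x. h x \<le> 1"
    using smooth_bump[of "e / 2" "\<phi> p"] e(1) by auto
  let ?\<beta> = "\<lambda>q. if q \<in> U \<and> \<phi> q \<in> ?S then h (\<phi> q) else 0"
  let ?W' = "{q \<in> U. \<phi> q \<in> ball (\<phi> p) (e / 2)}"
  have sub: "ball (\<phi> p) (e / 2) \<subseteq> ?S" using e by (force simp: subset_iff)
  have inW: "q \<in> W" if "q \<in> U" "\<phi> q \<in> ?S" for q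
    using that chart_inj[OF c(1)] by (auto dest: inj_onD)
  show thesis
  proof (rule that[of ?\<beta> ?W'])
    show "?\<beta> \<in> smooth_functions M"
    proof (rule chart_extend[OF c(1) oS])
      show "smooth_on ?S h" using h(1) smooth_on_subset by blast
      show "h x = 0" if "x \<in> ?S - cball (\<phi> p) e" for x
        using that h(3) by auto
    qed (use e in auto)
    show "open ?W'" by (rule chart_preimage_open[OF c(1) open_ball])
    show "?W' \<subseteq> W" using sub inW by auto
    show "?\<beta> q = 1" if "q \<in> ?W'" for q using that sub h(2) by auto
    show "p \<in> ?W'" using c e by simp
    show "?\<beta> q = 0" if "q \<notin> W" for q using that inW[of q] by presburger
    show "0 \<le> ?\<beta> q" "?\<beta> q \<le> 1" for q by (simp_all add: h(4,5))
  qed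
qed

text \<open>This makes local division and local square roots possible among globally defined smooth functions.
  The extension is the convex combination of \<open>f\<close> and the constant one by a bump function.\<close>

lemma positive_extension:
  assumes f: "f \<in> smooth_functions M" "f p > 0" "open W" "p \<in> W"
  obtains h W' where "h \<in> smooth_functions M" "\<And>q. h q > 0" "open W'" "p \<in> W'" "W' \<subseteq> W"
    "\<And>q. q \<in> W' \<Longrightarrow> h q = f q"
proof -
  have cont: "continuous_on UNIV f"
  proof (rule continuous_at_imp_continuous_on, rule ballI)
    fix q
    obtain U \<phi> where c: "(U, \<phi>) \<in> atlas M" "q \<in> U" by (rule chart_at)
    have "continuous_on U (\<lambda>q. (f \<circ> inv_into U \<phi>) (\<phi> q))"
      by (rule continuous_on_compose2[OF smooth_on_imp_continuous_on[OF smooth_in_chart[OF f(1) c(1)]]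
            chart_continuous[OF c(1)]]) auto
    then have "continuous_on U f"
      by (rule continuous_on_eq) (use chart_inj[OF c(1)] in auto)
    then show "isCont f q"
      using c chart_domain_open[OF c(1)] continuous_on_eq_continuous_at by blast
  qed
  have "open (f -` {0<..})" using open_vimage[OF open_greaterThan cont] .
  then have "open (W \<inter> f -` {0<..})" "p \<in> W \<inter> f -` {0<..}" using f by (auto intro: open_Int)
  then obtain \<beta> W' where chi: "\<beta> \<in> smooth_functions M" "open W'" "p \<in> W'" "W' \<subseteq> W \<inter> f -` {0<..}"
    "\<And>q. q \<in> W' \<Longrightarrow> \<beta> q = 1" "\<And>q. q \<notin> W \<inter> f -` {0<..} \<Longrightarrow> \<beta> q = 0"
    "\<And>q. 0 \<le> \<beta> q" "\<And>q. \<beta> q \<le> 1"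
    by (rule bump_function) blast
  show thesis
  proof (rule that[of "\<lambda>q. \<beta> q * f q + (1 - \<beta> q)" W'])
    show "(\<lambda>q. \<beta> q * f q + (1 - \<beta> q)) \<in> smooth_functions M"
      by (intro smooth_add smooth_mult smooth_diff smooth_const chi f)
    show "\<beta> q * f q + (1 - \<beta> q) > 0" for q
    proof (cases "\<beta> q = 0 \<or> \<beta> q = 1")
      case True
      then show ?thesis using chi(6)[of q] by force
    next
      case False
      then have "f q > 0" "\<beta> q > 0" "\<beta> q < 1"
        using chi(6)[of q] chi(7)[of q] chi(8)[of q] by force+
      then show ?thesis by (simp add: add_pos_pos)
    qed
  qed (use chi in auto)
qed

lemma tangent_space_nonsmooth: "v \<in> tangent_space M p \<Longrightarrow> f \<notin> smooth_functions M \<Longrightarrow> v f = 0"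
  by (simp add: tangent_space_def)

lemma tangent_add:
  "v \<in> tangent_space M p \<Longrightarrow> f \<in> smooth_functions M \<Longrightarrow> g \<in> smooth_functions M
    \<Longrightarrow> v (\<lambda>q. f q + g q) = v f + v g"
  by (simp add: tangent_space_def plus_fun_def)

lemma tangent_mult:
  "v \<in> tangent_space M p \<Longrightarrow> f \<in> smooth_functions M \<Longrightarrow> g \<in> smooth_functions M
    \<Longrightarrow> v (\<lambda>q. f q * g q) = v f * g p + f p * v g"
  by (simp add: tangent_space_def times_fun_def)

lemma tangent_cmult:
  "v \<in> tangent_space M p \<Longrightarrow> f \<in> smooth_functions M \<Longrightarrow> v (\<lambda>q. c * f q) = c * v f"
  by (simp add: tangent_space_def scaleR_fun_def)

lemma tangent_const:
  assumes "v \<in> tangent_space M p"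
  shows "v (\<lambda>_. c) = 0"
proof -
  have "v (\<lambda>_. 1) = 0"
    using tangent_mult[OF assms smooth_const smooth_const, of 1 1] by simp
  then show ?thesis using tangent_cmult[OF assms smooth_const, of c 1] by simp
qed

lemma tangent_sum:
  assumes "v \<in> tangent_space M p" "\<And>i. i \<in> I \<Longrightarrow> f i \<in> smooth_functions M"
  shows "v (\<lambda>q. \<Sum>i\<in>I. f i q) = (\<Sum>i\<in>I. v (f i))"
  using assms(2)
  by (induction I rule: infinite_finite_induct)
    (auto simp: tangent_const[OF assms(1)] tangent_add[OF assms(1)] smooth_sum)

lemma tangent_minus:
  "v \<in> tangent_space M p \<Longrightarrow> f \<in> smooth_functions M \<Longrightarrow> v (\<lambda>q. - f q) = - v f"
  using tangent_cmult[of v p f "-1"] by simp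

lemma tangent_diff:
  "v \<in> tangent_space M p \<Longrightarrow> f \<in> smooth_functions M \<Longrightarrow> g \<in> smooth_functions M
    \<Longrightarrow> v (\<lambda>q. f q - g q) = v f - v g"
  using tangent_add[of v p f "\<lambda>q. - g q"] tangent_minus[of v p g] smooth_minus[of g] by simp

text \<open>Multiplication of \<open>f - g\<close> with a bump function supported in \<open>W\<close> gives the zero function, and the
  Leibniz rule at \<open>p\<close> turns this into the claim.\<close>

lemma tangent_local:
  assumes v: "v \<in> tangent_space M p" and f: "f \<in> smooth_functions M" "g \<in> smooth_functions M"
    and W: "open W" "p \<in> W" "\<And>q. q \<in> W \<Longrightarrow> f q = g q"
  shows "v f = v g"
proof -
  obtain \<beta> W' where chi: "\<beta> \<in> smooth_functions M" "p \<in> W'"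
    "\<And>q. q \<in> W' \<Longrightarrow> \<beta> q = (1::real)" "\<And>q. q \<notin> W \<Longrightarrow> \<beta> q = 0"
    using bump_function[OF W(1,2)] by metis
  have "(\<lambda>q. \<beta> q * (f q - g q)) = (\<lambda>_. 0)" using chi(4) W(3) by fastforce
  then have "0 = v (\<lambda>q. \<beta> q * (f q - g q))" by (simp add: tangent_const[OF v])
  also have "\<dots> = v f - v g"
    using tangent_mult[OF v chi(1) smooth_diff[OF f]] tangent_diff[OF v f] chi(2,3) W(2,3) by simp
  finally show ?thesis by simp
qed

lemma tangent_eqI:
  assumes "v \<in> tangent_space M p" "w \<in> tangent_space M p'"
    "\<And>f. f \<in> smooth_functions M \<Longrightarrow> v f = w f"
  shows "v = w"
proof
  show "v f = w f" for f
    using assms tangent_space_nonsmooth[of v p f] tangent_space_nonsmooth[of w p' f] by metis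
qed

lemma subspace_tangent_space: "subspace (tangent_space M p)"
  unfolding subspace_def tangent_space_def by (auto simp: scaleR_fun_def algebra_simps)

end

section \<open>Coordinate representation of tangent vectors\<close>

context manifold_space
begin

text \<open>Chart coordinates, made global by a cut-off. The cut-off itself is part of the result, since the
  coordinate vector fields are to be cut off in the same way.\<close>

lemma coordinate_functions:
  assumes c: "(U, \<phi>) \<in> atlas M" and p: "p \<in> U"
  obtains x h W r where "r > 0" "W = {q \<in> U. \<phi> q \<in> ball (\<phi> p) r}" "cball (\<phi> p) (2 * r) \<subseteq> \<phi> ` U"
    "open W" "p \<in> W"
    "smooth_on UNIV h" "\<And>y. y \<in> ball (\<phi> p) r \<Longrightarrow> h y = (1::real)" "\<And>y. y \<notin> cball (\<phi> p) (2 * r) \<Longrightarrow> h y = 0"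
    "\<And>b. x b \<in> smooth_functions M" "\<And>b q. q \<in> W \<Longrightarrow> x b q = \<phi> q \<bullet> b"
proof -
  obtain e where e: "e > 0" "cball (\<phi> p) e \<subseteq> \<phi> ` U"
    using chart_image_open[OF c] p open_contains_cball by blast
  obtain h where h: "smooth_on UNIV h" "\<And>y. y \<in> ball (\<phi> p) (e / 2) \<Longrightarrow> h y = (1::real)"
    "\<And>y. y \<notin> ball (\<phi> p) e \<Longrightarrow> h y = 0" "\<And>y. 0 \<le> h y" "\<And>y. h y \<le> 1"
    using smooth_bump[of "e / 2" "\<phi> p"] e(1) by auto
  let ?x = "\<lambda>b q. if q \<in> U \<and> \<phi> q \<in> \<phi> ` U then h (\<phi> q) * (\<phi> q \<bullet> b) else 0"
  show thesis
  proof (rule that[of "e / 2" "{q \<in> U. \<phi> q \<in> ball (\<phi> p) (e / 2)}" h ?x])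
    show "?x b \<in> smooth_functions M" for b
    proof (rule chart_extend[OF c chart_image_open[OF c]])
      show "smooth_on (\<phi> ` U) (\<lambda>y. h y * (y \<bullet> b))"
        by (intro smooth_on_mult smooth_on_bounded_linear bounded_linear_inner_left
            chart_image_open[OF c] smooth_on_subset[OF h(1)]) auto
      show "h y * (y \<bullet> b) = 0" if "y \<in> \<phi> ` U - cball (\<phi> p) e" for y
        using that h(3)[of y] by auto
    qed (use e in auto)
    show "open {q \<in> U. \<phi> q \<in> ball (\<phi> p) (e / 2)}" by (rule chart_preimage_open[OF c open_ball])
    show "h y = 0" if "y \<notin> cball (\<phi> p) (2 * (e / 2))" for y using that h(3)[of y] by auto
    show "?x b q = \<phi> q \<bullet> b" if "q \<in> {q \<in> U. \<phi> q \<in> ball (\<phi> p) (e / 2)}" for b q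
      using that h(2) by auto
  qed (use e p h(1,2) in auto)
qed

text \<open>A derivation at \<open>q\<close> only sees the first-order Taylor polynomial in coordinates, by Hadamard's
  lemma. The coordinate functions \<open>x\<close> are given globally but need only be coordinates near \<open>q\<close>.\<close>

lemma tangent_vector_in_coordinates:
  assumes c: "(U, \<phi>) \<in> atlas M" and W: "open W" "q \<in> W" "W \<subseteq> U"
    and x: "\<And>b. x b \<in> smooth_functions M" "\<And>b q. q \<in> W \<Longrightarrow> x b q = \<phi> q \<bullet> b"
    and w: "w \<in> tangent_space M q" and f: "f \<in> smooth_functions M"
  shows "w f = (\<Sum>b\<in>Basis. w (x b) * frechet_derivative (f \<circ> inv_into U \<phi>) (at (\<phi> q)) b)"
proof -
  have qU: "q \<in> U" using W by auto
  let ?F = "f \<circ> inv_into U \<phi>"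
  have inv: "inv_into U \<phi> (\<phi> r) = r" if "r \<in> U" for r
    using chart_inj[OF c] that by simp
  have "open (\<phi> ` W)" "\<phi> q \<in> \<phi> ` W" using chart_open_map[OF c W(1,3)] W by auto
  then obtain e where e: "e > 0" "ball (\<phi> q) e \<subseteq> \<phi> ` W"
    using open_contains_ball by blast
  have eU: "ball (\<phi> q) e \<subseteq> \<phi> ` U" using e W by auto
  obtain g where g: "\<And>b. smooth_on (ball (\<phi> q) e) (g b)"
    "\<And>b. g b (\<phi> q) = frechet_derivative ?F (at (\<phi> q)) b"
    "\<And>y. y \<in> ball (\<phi> q) e \<Longrightarrow> ?F y = ?F (\<phi> q) + (\<Sum>b\<in>Basis. ((y - \<phi> q) \<bullet> b) * g b y)"
    by (rule Hadamard[OF smooth_on_subset[OF smooth_in_chart[OF f c] eU] e(1)]) blast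
  obtain h where h: "smooth_on UNIV h" "\<And>y. y \<in> ball (\<phi> q) (e / 3) \<Longrightarrow> h y = (1::real)"
    "\<And>y. y \<notin> ball (\<phi> q) (2 * (e / 3)) \<Longrightarrow> h y = 0" "\<And>y. 0 \<le> h y" "\<And>y. h y \<le> 1"
    using smooth_bump[of "e / 3" "\<phi> q"] e(1) by auto
  define G where "G b r = (if r \<in> U \<and> \<phi> r \<in> ball (\<phi> q) e then h (\<phi> r) * g b (\<phi> r) else 0)" for b r
  have G: "G b \<in> smooth_functions M" for b
    unfolding G_def
  proof (rule chart_extend[OF c open_ball eU, where K = "cball (\<phi> q) (2 * (e / 3))"])
    show "smooth_on (ball (\<phi> q) e) (\<lambda>y. h y * g b y)"
      by (intro smooth_on_mult smooth_on_subset[OF h(1)] g) auto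
    show "h y * g b y = 0" if "y \<in> ball (\<phi> q) e - cball (\<phi> q) (2 * (e / 3))" for y
      using that h(3)[of y] by auto
  qed (use e in auto)
  let ?W = "{r \<in> U. \<phi> r \<in> ball (\<phi> q) (e / 3)} \<inter> W"
  have oW: "open ?W" using chart_preimage_open[OF c open_ball] W(1) by blast
  let ?f = "\<lambda>r. f q + (\<Sum>b\<in>Basis. (x b r - x b q) * G b r)"
  have sm: "(\<lambda>r. (x b r - x b q) * G b r) \<in> smooth_functions M" for b
    by (intro smooth_mult smooth_diff smooth_const x G)
  have "w f = w ?f"
  proof (rule tangent_local[OF w f _ oW])
    show "?f \<in> smooth_functions M" by (intro smooth_add smooth_const smooth_sum sm)
    show "q \<in> ?W" using W e qU by auto
    fix r assume r: "r \<in> ?W"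
    then have "\<phi> r \<in> ball (\<phi> q) e" using e(1) by auto
    from g(3)[OF this] show "f r = ?f r"
      using r W(2) qU e(1) h(2)[of "\<phi> r"] x(2)
      by (auto simp: inv G_def inner_diff_left intro!: sum.cong)
  qed
  also have "\<dots> = w (\<lambda>_. f q) + w (\<lambda>r. \<Sum>b\<in>Basis. (x b r - x b q) * G b r)"
    by (rule tangent_add[OF w smooth_const smooth_sum[OF sm]])
  also have "\<dots> = (\<Sum>b\<in>Basis. w (\<lambda>r. (x b r - x b q) * G b r))"
    by (simp add: tangent_const[OF w] tangent_sum[OF w sm])
  also have "\<dots> = (\<Sum>b\<in>Basis. w (x b) * G b q)"
    using tangent_mult[OF w smooth_diff[OF x(1) smooth_const] G]
      tangent_diff[OF w x(1) smooth_const] tangent_const[OF w] by simp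
  also have "\<dots> = (\<Sum>b\<in>Basis. w (x b) * frechet_derivative ?F (at (\<phi> q)) b)"
    using qU e(1) h(2)[of "\<phi> q"] by (simp add: G_def g(2))
  finally show ?thesis .
qed

text \<open>The algebraic Leibniz rule only yields this for polynomials \<open>g\<close>; in general the representation by
  directional derivatives is used.\<close>

lemma tangent_chain_rule:
  assumes w: "w \<in> tangent_space M q" and f: "f \<in> smooth_functions M" "(\<lambda>r. g (f r)) \<in> smooth_functions M"
    and g: "(g has_field_derivative D) (at (f q))"
  shows "w (\<lambda>r. g (f r)) = D * w f"
proof -
  obtain U \<phi> where c: "(U, \<phi>) \<in> atlas M" "q \<in> U" by (rule chart_at)
  obtain x W where x: "open W" "q \<in> W" "W \<subseteq> U"
    "\<And>b. x b \<in> smooth_functions M" "\<And>b q. q \<in> W \<Longrightarrow> x b q = \<phi> q \<bullet> b"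
    by (rule coordinate_functions[OF c]) blast
  have rep: "w f = (\<Sum>b\<in>Basis. w (x b) * frechet_derivative (f \<circ> inv_into U \<phi>) (at (\<phi> q)) b)"
    if "f \<in> smooth_functions M" for f
    by (rule tangent_vector_in_coordinates[OF c(1) x(1-4) _ w that]) (rule x(5))
  let ?F = "f \<circ> inv_into U \<phi>"
  have inv: "inv_into U \<phi> (\<phi> q) = q" using chart_inj[OF c(1)] c(2) by simp
  have "(?F has_derivative frechet_derivative ?F (at (\<phi> q))) (at (\<phi> q))"
    by (rule smooth_on_has_derivative[OF smooth_in_chart[OF f(1) c(1)]]) (use c in auto)
  moreover have "(g has_derivative (*) D) (at (?F (\<phi> q)))"
    using g by (simp add: inv has_field_derivative_def)
  ultimately have "((\<lambda>y. g (?F y)) has_derivative (\<lambda>v. D * frechet_derivative ?F (at (\<phi> q)) v)) (at (\<phi> q))"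
    by (rule has_derivative_compose)
  from frechet_derivative_at[OF this]
  have "frechet_derivative ((\<lambda>r. g (f r)) \<circ> inv_into U \<phi>) (at (\<phi> q)) = (\<lambda>v. D * frechet_derivative ?F (at (\<phi> q)) v)"
    by (simp add: o_def)
  then show ?thesis
    unfolding rep[OF f(1)] rep[OF f(2)] by (simp add: sum_distrib_left mult_ac)
qed

end

section \<open>Vector fields and coordinate frames\<close>

context manifold_space
begin

lemma vector_field_tangent: "X \<in> vector_fields M \<Longrightarrow> X p \<in> tangent_space M p"
  by (simp add: vector_fields_def)

lemma vector_field_smooth:
  "X \<in> vector_fields M \<Longrightarrow> f \<in> smooth_functions M \<Longrightarrow> (\<lambda>p. X p f) \<in> smooth_functions M"
  by (simp add: vector_fields_def)

lemma vector_fields_zero: "(\<lambda>p. 0) \<in> vector_fields M"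
  using subspace_0[OF subspace_tangent_space] smooth_const[of 0] by (simp add: vector_fields_def)

lemma vector_fields_add:
  "X \<in> vector_fields M \<Longrightarrow> Y \<in> vector_fields M \<Longrightarrow> (\<lambda>p. X p + Y p) \<in> vector_fields M"
  using subspace_add[OF subspace_tangent_space] smooth_add by (simp add: vector_fields_def)

lemma vector_fields_scale:
  "f \<in> smooth_functions M \<Longrightarrow> X \<in> vector_fields M \<Longrightarrow> (\<lambda>p. f p *\<^sub>R X p) \<in> vector_fields M"
  using subspace_scale[OF subspace_tangent_space] smooth_mult
  by (simp add: vector_fields_def scaleR_fun_def)

lemma vector_fields_cscale: "X \<in> vector_fields M \<Longrightarrow> (\<lambda>p. c *\<^sub>R X p) \<in> vector_fields M"
  using vector_fields_scale[OF smooth_const] .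

lemma vector_fields_diff:
  "X \<in> vector_fields M \<Longrightarrow> Y \<in> vector_fields M \<Longrightarrow> (\<lambda>p. X p - Y p) \<in> vector_fields M"
  using vector_fields_add[OF _ vector_fields_cscale[of Y "-1"]] by simp

lemma vector_fields_sum:
  "(\<And>i. i \<in> I \<Longrightarrow> X i \<in> vector_fields M) \<Longrightarrow> (\<lambda>p. \<Sum>i\<in>I. X i p) \<in> vector_fields M"
  by (induction I rule: infinite_finite_induct) (auto intro: vector_fields_zero vector_fields_add)

lemma vector_fields_localI:
  assumes "\<And>p. X p \<in> tangent_space M p"
    "\<And>p. \<exists>W Y. open W \<and> p \<in> W \<and> Y \<in> vector_fields M \<and> (\<forall>q\<in>W. X q = Y q)"
  shows "X \<in> vector_fields M"
  unfolding vector_fields_def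
proof (intro CollectI conjI allI ballI)
  fix f assume f: "f \<in> smooth_functions M"
  show "(\<lambda>p. X p f) \<in> smooth_functions M"
  proof (rule smooth_functions_localI)
    fix p
    obtain W Y where "open W" "p \<in> W" "Y \<in> vector_fields M" "\<forall>q\<in>W. X q = Y q"
      using assms(2) by metis
    then show "\<exists>W h. open W \<and> p \<in> W \<and> h \<in> smooth_functions M \<and> (\<forall>q\<in>W. X q f = h q)"
      using vector_field_smooth[OF _ f] by (intro exI[of _ W] exI[of _ "\<lambda>q. Y q f"]) auto
  qed
qed (rule assms(1))

text \<open>Coordinate functions and coordinate vector fields near \<open>p\<close>, cut off outside so that they are
  globally defined. Evaluation on the coordinate functions gives the components of a tangent
  vector.\<close>

lemma coordinate_frame:
  obtains x :: "'e \<Rightarrow> 'a \<Rightarrow> real" and E :: "'e \<Rightarrow> 'a field" and W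
  where "open W" "p \<in> W" "\<And>b. x b \<in> smooth_functions M" "\<And>b. E b \<in> vector_fields M"
    "\<And>q b c. q \<in> W \<Longrightarrow> b \<in> Basis \<Longrightarrow> c \<in> Basis \<Longrightarrow> E b q (x c) = (if b = c then 1 else 0)"
    "\<And>q w. q \<in> W \<Longrightarrow> w \<in> tangent_space M q \<Longrightarrow> w = (\<Sum>b\<in>Basis. w (x b) *\<^sub>R E b q)"
proof -
  obtain U \<phi> where c: "(U, \<phi>) \<in> atlas M" "p \<in> U" by (rule chart_at)
  obtain x h W r where r: "r > 0" "W = {q \<in> U. \<phi> q \<in> ball (\<phi> p) r}" "cball (\<phi> p) (2 * r) \<subseteq> \<phi> ` U"
    and W: "open W" "p \<in> W"
    and h: "smooth_on UNIV h" "\<And>y. y \<in> ball (\<phi> p) r \<Longrightarrow> h y = (1::real)" "\<And>y. y \<notin> cball (\<phi> p) (2 * r) \<Longrightarrow> h y = 0"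
    and x: "\<And>b. x b \<in> smooth_functions M" "\<And>b q. q \<in> W \<Longrightarrow> x b q = \<phi> q \<bullet> b"
    by (rule coordinate_functions[OF c]) blast
  have inv: "inv_into U \<phi> (\<phi> r) = r" if "r \<in> U" for r
    using chart_inj[OF c(1)] that by simp
  let ?D = "\<lambda>f. frechet_derivative (f \<circ> inv_into U \<phi>)"
  define E where "E b q f = (if f \<in> smooth_functions M \<and> q \<in> U \<and> \<phi> q \<in> \<phi> ` U
    then h (\<phi> q) * ?D f (at (\<phi> q)) b else 0)" for b q f
  have D: "((f \<circ> inv_into U \<phi>) has_derivative ?D f (at (\<phi> q))) (at (\<phi> q))"
    if "f \<in> smooth_functions M" "q \<in> U" for f q
    by (rule smooth_on_has_derivative[OF smooth_in_chart[OF that(1) c(1)]]) (use that in auto)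
  have Esm: "E b q f = (if q \<in> U \<and> \<phi> q \<in> \<phi> ` U then h (\<phi> q) * ?D f (at (\<phi> q)) b else 0)"
    if "f \<in> smooth_functions M" for b q f using that by (simp add: E_def)
  have tangent: "E b q \<in> tangent_space M q" for b q
    unfolding tangent_space_def
  proof (intro CollectI conjI ballI allI impI)
    fix f g assume f: "f \<in> smooth_functions M" and g: "g \<in> smooth_functions M"
    have fg: "f + g \<in> smooth_functions M" "f * g \<in> smooth_functions M"
      using smooth_add[OF f g] smooth_mult[OF f g] by (simp_all add: plus_fun_def times_fun_def)
    have "?D (f + g) (at (\<phi> q)) = (\<lambda>v. ?D f (at (\<phi> q)) v + ?D g (at (\<phi> q)) v)" if "q \<in> U"
      using frechet_derivative_at[OF has_derivative_add[OF D[OF f that] D[OF g that]]]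
      by (simp add: o_def plus_fun_def)
    then show "E b q (f + g) = E b q f + E b q g"
      by (simp add: Esm[OF f] Esm[OF g] Esm[OF fg(1)] algebra_simps)
    have "?D (f * g) (at (\<phi> q)) = (\<lambda>v. f q * ?D g (at (\<phi> q)) v + ?D f (at (\<phi> q)) v * g q)" if "q \<in> U"
      using frechet_derivative_at[OF has_derivative_mult[OF D[OF f that] D[OF g that]]] inv[OF that]
      by (simp add: o_def times_fun_def)
    then show "E b q (f * g) = E b q f * g q + f q * E b q g"
      by (simp add: Esm[OF f] Esm[OF g] Esm[OF fg(2)] algebra_simps)
  next
    fix f c assume f: "f \<in> smooth_functions M"
    have cf: "c *\<^sub>R f \<in> smooth_functions M" using smooth_cmult[OF f] by (simp add: scaleR_fun_def)
    have "?D (c *\<^sub>R f) (at (\<phi> q)) = (\<lambda>v. c * ?D f (at (\<phi> q)) v)" if "q \<in> U"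
      using frechet_derivative_at[OF has_derivative_mult_right[OF D[OF f that]]]
      by (simp add: o_def scaleR_fun_def)
    then show "E b q (c *\<^sub>R f) = c * E b q f"
      by (simp add: Esm[OF f] Esm[OF cf])
  next
    show "E b q f = 0" if "f \<notin> smooth_functions M" for f using that by (simp add: E_def)
  qed
  have field: "E b \<in> vector_fields M" for b
    unfolding vector_fields_def
  proof (intro CollectI conjI ballI allI tangent)
    fix f assume f: "f \<in> smooth_functions M"
    show "(\<lambda>q. E b q f) \<in> smooth_functions M"
      unfolding Esm[OF f]
    proof (rule chart_extend[OF c(1) chart_image_open[OF c(1)] _ _ _ r(3)])
      show "smooth_on (\<phi> ` U) (\<lambda>y. h y * ?D f (at y) b)"
        by (intro smooth_on_mult chart_image_open[OF c(1)] smooth_on_subset[OF h(1)]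
            smooth_on_frechet_derivative smooth_in_chart[OF f c(1)]) auto
    qed (use h(3) in auto)
  qed
  have EW: "E b q f = ?D f (at (\<phi> q)) b" if "q \<in> W" "f \<in> smooth_functions M" for b q f
    using that h(2) r(2) by (simp add: Esm)
  show thesis
  proof (rule that[OF W x(1) field])
    fix b d :: 'e assume *: "b \<in> Basis" "d \<in> Basis"
    fix q assume q: "q \<in> W"
    have oW: "open (\<phi> ` W)" using chart_open_map[OF c(1) W(1)] r(2) by auto
    have "((\<lambda>y. y \<bullet> d) has_derivative (\<lambda>v. v \<bullet> d)) (at (\<phi> q))"
      by (auto intro!: derivative_eq_intros)
    then have "((x d \<circ> inv_into U \<phi>) has_derivative (\<lambda>v. v \<bullet> d)) (at (\<phi> q))"
      by (rule has_derivative_transform_within_open[OF _ oW]) (use q x(2) inv r(2) in auto)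
    from fun_cong[OF frechet_derivative_at[OF this], of b] show "E b q (x d) = (if b = d then 1 else 0)"
      using * by (simp add: EW[OF q x(1)] inner_Basis)
  next
    fix q w assume q: "q \<in> W" and w: "w \<in> tangent_space M q"
    have s: "(\<Sum>b\<in>Basis. w (x b) *\<^sub>R E b q) \<in> tangent_space M q"
      by (intro subspace_sum[OF subspace_tangent_space] subspace_scale[OF subspace_tangent_space] tangent)
    show "w = (\<Sum>b\<in>Basis. w (x b) *\<^sub>R E b q)"
    proof (rule tangent_eqI[OF w s])
      fix f assume f: "f \<in> smooth_functions M"
      have "(\<Sum>b\<in>B. w (x b) *\<^sub>R E b q) f = (\<Sum>b\<in>B. w (x b) * E b q f)" if "finite B" for B
        using that by (induction B rule: finite_induct) (auto simp: scaleR_fun_def)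
      then show "w f = (\<Sum>b\<in>Basis. w (x b) *\<^sub>R E b q) f"
        using tangent_vector_in_coordinates[OF c(1) W(1) q _ x w f] r(2) by (auto simp: EW[OF q f])
    qed
  qed
qed

lemma sum_tangent_apply: "(\<Sum>i\<in>I. c i *\<^sub>R (v i :: 'a tangent)) f = (\<Sum>i\<in>I. c i * v i f)"
  by (induction I rule: infinite_finite_induct) (auto simp: scaleR_fun_def)

end

section \<open>Orthonormal frames, gradients and orthogonal projections\<close>

locale riemannian_space =
  fixes M :: "('a::{t2_space,second_countable_topology}, 'e::euclidean_space) manifold"
  assumes riemannian_manifold: "riemannian_manifold M"

sublocale riemannian_space \<subseteq> manifold_space
  using riemannian_manifold by unfold_locales (simp add: riemannian_manifold_def)

context riemannian_space
begin

lemmas tangent_closed = subspace_0[OF subspace_tangent_space] subspace_add[OF subspace_tangent_space]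
  subspace_diff[OF subspace_tangent_space] subspace_scale[OF subspace_tangent_space]
  subspace_neg[OF subspace_tangent_space]

lemma tangent_space_sum:
  "(\<And>i. i \<in> I \<Longrightarrow> v i \<in> tangent_space M p) \<Longrightarrow> (\<Sum>i\<in>I. v i) \<in> tangent_space M p"
  by (rule subspace_sum[OF subspace_tangent_space])

lemma metric_sym:
  "u \<in> tangent_space M p \<Longrightarrow> v \<in> tangent_space M p \<Longrightarrow> metric M p u v = metric M p v u"
  using riemannian_manifold by (simp add: riemannian_manifold_def)

lemma metric_pos: "u \<in> tangent_space M p \<Longrightarrow> u \<noteq> 0 \<Longrightarrow> metric M p u u > 0"
  using riemannian_manifold by (simp add: riemannian_manifold_def)

lemma metric_add_left:
  "u \<in> tangent_space M p \<Longrightarrow> v \<in> tangent_space M p \<Longrightarrow> w \<in> tangent_space M p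
    \<Longrightarrow> metric M p (u + v) w = metric M p u w + metric M p v w"
  using riemannian_manifold by (simp add: riemannian_manifold_def)

lemma metric_scale_left:
  "u \<in> tangent_space M p \<Longrightarrow> v \<in> tangent_space M p \<Longrightarrow> metric M p (c *\<^sub>R u) v = c * metric M p u v"
  using riemannian_manifold by (simp add: riemannian_manifold_def)

lemma metric_add_right:
  "u \<in> tangent_space M p \<Longrightarrow> v \<in> tangent_space M p \<Longrightarrow> w \<in> tangent_space M p
    \<Longrightarrow> metric M p w (u + v) = metric M p w u + metric M p w v"
  by (simp add: metric_sym[of w] tangent_closed metric_add_left)

lemma metric_scale_right:
  "u \<in> tangent_space M p \<Longrightarrow> v \<in> tangent_space M p \<Longrightarrow> metric M p v (c *\<^sub>R u) = c * metric M p v u"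
  by (simp add: metric_sym[of v] tangent_closed metric_scale_left)

lemma metric_zero_left: "v \<in> tangent_space M p \<Longrightarrow> metric M p 0 v = 0"
  using metric_scale_left[of v p v 0] by simp

lemma metric_zero_right: "v \<in> tangent_space M p \<Longrightarrow> metric M p v 0 = 0"
  using metric_scale_right[of v p v 0] by simp

lemma metric_minus_left:
  "u \<in> tangent_space M p \<Longrightarrow> v \<in> tangent_space M p \<Longrightarrow> metric M p (- u) v = - metric M p u v"
  using metric_scale_left[of u p v "-1"] by simp

lemma metric_diff_left:
  "u \<in> tangent_space M p \<Longrightarrow> v \<in> tangent_space M p \<Longrightarrow> w \<in> tangent_space M p
    \<Longrightarrow> metric M p (u - v) w = metric M p u w - metric M p v w"
  using metric_add_left[of u p "- v" w] metric_minus_left[of v p w] by (simp add: tangent_closed)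

lemma metric_sum_left:
  assumes "\<And>i. i \<in> I \<Longrightarrow> v i \<in> tangent_space M p" "w \<in> tangent_space M p"
  shows "metric M p (\<Sum>i\<in>I. v i) w = (\<Sum>i\<in>I. metric M p (v i) w)"
  using assms(1)
  by (induction I rule: infinite_finite_induct)
    (auto simp: metric_zero_left assms(2) metric_add_left tangent_space_sum)

lemma metric_nondegenerate: "u \<in> tangent_space M p \<Longrightarrow> metric M p u u = 0 \<Longrightarrow> u = 0"
  using metric_pos by force

lemma metric_eqI:
  assumes "u \<in> tangent_space M p" "w \<in> tangent_space M p"
    "\<And>v. v \<in> tangent_space M p \<Longrightarrow> metric M p u v = metric M p w v"
  shows "u = w"
  using metric_nondegenerate[of "u - w" p] assms metric_diff_left[of u p w "u - w"]
  by (simp add: tangent_closed)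

lemma metric_smooth:
  "X \<in> vector_fields M \<Longrightarrow> Y \<in> vector_fields M \<Longrightarrow> (\<lambda>p. metric M p (X p) (Y p)) \<in> smooth_functions M"
  using riemannian_manifold by (simp add: riemannian_manifold_def)

text \<open>Gram--Schmidt, applied to a coordinate frame. The induction hypothesis records that the
  orthonormal fields constructed so far have no components along the coordinate fields that are
  still to be treated; this keeps the next field away from zero.\<close>

lemma gram_schmidt:
  assumes W: "open W" "p \<in> W" and x: "\<And>b. x b \<in> smooth_functions M"
    and E: "\<And>b. E b \<in> vector_fields M"
    and Ex: "\<forall>q\<in>W. \<forall>b\<in>Basis. \<forall>c\<in>Basis. E b q (x c) = (if b = c then 1 else 0)"
    and B: "finite B" "B \<subseteq> (Basis :: 'e set)"
  shows "\<exists>U W'. open W' \<and> p \<in> W' \<and> W' \<subseteq> W \<and> (\<forall>b\<in>B. U b \<in> vector_fields M) \<and>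
    (\<forall>q\<in>W'. (\<forall>b\<in>B. \<forall>c\<in>B. metric M q (U b q) (U c q) = (if b = c then 1 else 0)) \<and>
      (\<forall>c\<in>B. \<forall>d\<in>Basis - B. U c q (x d) = 0) \<and>
      (\<forall>c\<in>B. (\<Sum>d\<in>B. metric M q (E c q) (U d q) *\<^sub>R U d q) = E c q))"
  using B
proof (induction B rule: finite_induct)
  case empty
  then show ?case using W by auto
next
  case (insert b B)
  then have "B \<subseteq> Basis" by simp
  from insert.IH[OF this] obtain U W' where W': "open W'" "p \<in> W'" "W' \<subseteq> W"
    and U': "\<forall>b\<in>B. U b \<in> vector_fields M"
    and on': "\<forall>q\<in>W'. (\<forall>b\<in>B. \<forall>c\<in>B. metric M q (U b q) (U c q) = (if b = c then 1 else 0)) \<and>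
      (\<forall>c\<in>B. \<forall>d\<in>Basis - B. U c q (x d) = 0) \<and>
      (\<forall>c\<in>B. (\<Sum>d\<in>B. metric M q (E c q) (U d q) *\<^sub>R U d q) = E c q)"
    by (elim exE conjE) (rule that)
  note U = bspec[OF U']
  have on: "metric M q (U c q) (U d q) = (if c = d then 1 else 0)" if "q \<in> W'" "c \<in> B" "d \<in> B" for q c d
    using on' that by simp
  have Ux: "U c q (x d) = 0" if "q \<in> W'" "c \<in> B" "d \<in> Basis - B" for q c d
    using on' that by simp
  have EU: "(\<Sum>d\<in>B. metric M q (E c q) (U d q) *\<^sub>R U d q) = E c q" if "q \<in> W'" "c \<in> B" for q c
    using on' that by simp
  have b: "b \<in> Basis" "b \<notin> B" using insert by auto
  \<comment> \<open>\<open>R\<close> is nonzero at \<open>p\<close> as its component along \<open>E b\<close> is one; there and nearby it can be normalised\<close>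
  define S where "S q = (\<Sum>c\<in>B. metric M q (E b q) (U c q) *\<^sub>R U c q)" for q
  define R where "R q = E b q - S q" for q
  have Sf: "S \<in> vector_fields M"
    unfolding S_def by (intro vector_fields_sum vector_fields_scale metric_smooth E U)
  have Rf: "R \<in> vector_fields M"
    unfolding R_def by (intro vector_fields_diff E Sf)
  note tE = vector_field_tangent[OF E] and tU = vector_field_tangent[OF U]
    and tS = vector_field_tangent[OF Sf] and tR = vector_field_tangent[OF Rf]
  have Sx: "S q (x d) = 0" if "q \<in> W'" "d \<in> Basis - B" for q d
    unfolding S_def sum_tangent_apply using Ux that by simp
  have SU: "metric M q (S q) (U c q) = metric M q (E b q) (U c q)" if "q \<in> W'" "c \<in> B" for q c
    unfolding S_def using that insert.hyps(1)
    by (simp add: metric_sum_left tangent_closed tU metric_scale_left on if_distrib cong: if_cong)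
  have RU: "metric M q (R q) (U c q) = 0" if "q \<in> W'" "c \<in> B" for q c
    unfolding R_def using that by (simp add: metric_diff_left tE tU tS SU)
  have RS: "metric M q (v q) (R q) = 0"
    if "q \<in> W'" "v q = (\<Sum>c\<in>B. a c *\<^sub>R U c q)" for q v a
    unfolding that(2) using that(1)
    by (simp add: metric_sum_left tangent_closed tU tR metric_scale_left metric_sym[OF tU tR] RU)
  have "R p (x b) = 1"
    using Sx[OF W'(2), of b] Ex W'(2,3) b by (auto simp: R_def)
  then have "R p \<noteq> 0" by auto
  then have pos: "metric M p (R p) (R p) > 0" using metric_pos[OF tR] by simp
  obtain h W'' where h: "h \<in> smooth_functions M" "\<And>q. h q > 0"
    and W'': "open W''" "p \<in> W''" "W'' \<subseteq> W'" and hR: "\<And>q. q \<in> W'' \<Longrightarrow> h q = metric M q (R q) (R q)"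
    by (rule positive_extension[OF metric_smooth[OF Rf Rf] pos W'(1,2)]) blast
  define s where "s q = inverse (sqrt (h q))" for q
  have sh: "(\<lambda>q. sqrt (h q)) \<in> smooth_functions M"
    by (rule smooth_post_compose[OF h smooth_on_sqrt])
  have s: "s \<in> smooth_functions M"
    unfolding s_def using h(2) by (intro smooth_post_compose[OF sh _ smooth_on_inverse]) simp
  have ss: "s q * (s q * h q) = 1" for q
    using h(2)[of q] by (simp add: s_def field_simps)
  define U' where "U' = U(b := \<lambda>q. s q *\<^sub>R R q)"
  have U'b: "U' b = (\<lambda>q. s q *\<^sub>R R q)" and U'c: "\<And>c. c \<in> B \<Longrightarrow> U' c = U c"
    using b by (auto simp: U'_def)
  have EE: "E b q = R q + S q" for q by (simp add: R_def)
  have ER: "metric M q (E b q) (R q) = h q" if "q \<in> W''" for q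
  proof -
    have "metric M q (S q) (R q) = 0"
      by (rule RS[where a = "\<lambda>c. metric M q (E b q) (U c q)"]) (use that W'' in \<open>auto simp: S_def\<close>)
    then show ?thesis
      unfolding EE by (simp add: metric_add_left tR tS hR[OF that])
  qed
  show ?case
  proof (intro exI[of _ U'] exI[of _ W''] conjI ballI)
    show "W'' \<subseteq> W" using W'' W' by auto
    show "U' c \<in> vector_fields M" if "c \<in> insert b B" for c
      using that U U'b U'c vector_fields_scale[OF s Rf] by auto
    fix q assume q'': "q \<in> W''"
    then have q: "q \<in> W'" using W'' by auto
    show "metric M q (U' c q) (U' d q) = (if c = d then 1 else 0)" if "c \<in> insert b B" "d \<in> insert b B" for c d
    proof -
      have "metric M q (U' b q) (U' b q) = 1"
        by (simp add: U'b metric_scale_left metric_scale_right tR tangent_closed ss flip: hR[OF q''])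
      moreover have "metric M q (U' b q) (U' c q) = 0" "metric M q (U' c q) (U' b q) = 0" if "c \<in> B" for c
        using that RU[OF q that]
        by (simp_all add: U'b U'c metric_scale_left metric_scale_right tR tU tangent_closed metric_sym[OF tU tR])
      ultimately show ?thesis using that b on[OF q] U'c by auto
    qed
    show "U' c q (x d) = 0" if "c \<in> insert b B" "d \<in> Basis - insert b B" for c d
    proof (cases "c = b")
      case True
      have "R q (x d) = 0"
        using Sx[OF q, of d] Ex that b q W'(3) by (auto simp: R_def)
      then show ?thesis using True by (simp add: U'b scaleR_fun_def)
    next
      case False
      then show ?thesis using that Ux[OF q] U'c by auto
    qed
    show "(\<Sum>d\<in>insert b B. metric M q (E c q) (U' d q) *\<^sub>R U' d q) = E c q" if c: "c \<in> insert b B" for c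
    proof -
      have sum: "(\<Sum>d\<in>insert b B. metric M q (E c q) (U' d q) *\<^sub>R U' d q)
          = (s q * metric M q (E c q) (R q)) *\<^sub>R s q *\<^sub>R R q + (\<Sum>d\<in>B. metric M q (E c q) (U d q) *\<^sub>R U d q)"
        using insert.hyps U'c by (simp add: U'b metric_scale_right tE tR)
      show ?thesis
      proof (cases "c = b")
        case True
        have "(s q * metric M q (E b q) (R q)) *\<^sub>R s q *\<^sub>R R q = R q"
          using ss[of q] ER[OF q''] by (simp add: mult_ac)
        then show ?thesis
          unfolding sum unfolding True S_def[symmetric] by (simp only: EE[symmetric])
      next
        case False
        then have "c \<in> B" using c by simp
        then have "metric M q (E c q) (R q) = 0"
          using RS[of q "E c" "\<lambda>d. metric M q (E c q) (U d q)"] q EU[OF q, of c] by simp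
        then show ?thesis unfolding sum using EU[OF q \<open>c \<in> B\<close>] by simp
      qed
    qed
  qed (use W'' in auto)
qed

lemma orthonormal_frame:
  obtains U :: "'e \<Rightarrow> 'a field" and W where "open W" "p \<in> W" "\<And>b. b \<in> Basis \<Longrightarrow> U b \<in> vector_fields M"
    "\<And>q w. q \<in> W \<Longrightarrow> w \<in> tangent_space M q \<Longrightarrow> w = (\<Sum>b\<in>Basis. metric M q w (U b q) *\<^sub>R U b q)"
proof -
  obtain x :: "'e \<Rightarrow> 'a \<Rightarrow> real" and E :: "'e \<Rightarrow> 'a field" and W
  where W: "open W" "p \<in> W" and x: "\<And>b. x b \<in> smooth_functions M" and E: "\<And>b. E b \<in> vector_fields M"
    and Ex: "\<And>q b c. q \<in> W \<Longrightarrow> b \<in> Basis \<Longrightarrow> c \<in> Basis \<Longrightarrow> E b q (x c) = (if b = c then 1 else 0)"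
    and rep: "\<And>q w. q \<in> W \<Longrightarrow> w \<in> tangent_space M q \<Longrightarrow> w = (\<Sum>b\<in>Basis. w (x b) *\<^sub>R E b q)"
    by (rule coordinate_frame[of p]) blast
  have Ex': "\<forall>q\<in>W. \<forall>b\<in>Basis. \<forall>c\<in>Basis. E b q (x c) = (if b = c then 1 else 0)"
    using Ex by blast
  obtain U :: "'e \<Rightarrow> 'a field" and W' where W': "open W'" "p \<in> W'" "W' \<subseteq> W" and U: "\<forall>b\<in>Basis. U b \<in> vector_fields M"
    and EU: "\<forall>q\<in>W'. (\<forall>b\<in>Basis. \<forall>c\<in>Basis. metric M q (U b q) (U c q) = (if b = c then 1 else 0)) \<and>
      (\<forall>c\<in>Basis. \<forall>d\<in>Basis - Basis. U c q (x d) = 0) \<and>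
      (\<forall>c\<in>Basis. (\<Sum>d\<in>Basis. metric M q (E c q) (U d q) *\<^sub>R U d q) = E c q)"
    using gram_schmidt[OF W x E Ex' finite_Basis order_refl] by (elim exE conjE) (rule that)
  note U = bspec[OF U]
  have EU: "(\<Sum>d\<in>Basis. metric M q (E c q) (U d q) *\<^sub>R U d q) = E c q" if "q \<in> W'" "c \<in> Basis" for q c
    using EU that by simp
  show thesis
  proof (rule that[OF W'(1,2) U])
    fix q w assume q: "q \<in> W'" and w: "w \<in> tangent_space M q"
    have r: "w = (\<Sum>b\<in>Basis. w (x b) *\<^sub>R E b q)" using rep q W' w by blast
    have m: "metric M q w (U d q) = (\<Sum>b\<in>Basis. w (x b) * metric M q (E b q) (U d q))" if "d \<in> Basis" for d
      by (subst r) (simp add: metric_sum_left metric_scale_left tangent_closed vector_field_tangent E U that)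
    have "w = (\<Sum>b\<in>Basis. w (x b) *\<^sub>R (\<Sum>d\<in>Basis. metric M q (E b q) (U d q) *\<^sub>R U d q))"
      using r EU[OF q] by simp
    also have "\<dots> = (\<Sum>d\<in>Basis. \<Sum>b\<in>Basis. (w (x b) * metric M q (E b q) (U d q)) *\<^sub>R U d q)"
      unfolding scaleR_sum_right by (subst sum.swap) simp
    also have "\<dots> = (\<Sum>d\<in>Basis. metric M q w (U d q) *\<^sub>R U d q)"
      by (rule sum.cong) (simp_all add: m scaleR_sum_left)
    finally show "w = (\<Sum>b\<in>Basis. metric M q w (U b q) *\<^sub>R U b q)" .
  qed
qed

text \<open>The coefficients of a field in an orthonormal frame are its inner products with the frame.\<close>

lemma vector_fields_metricI:
  assumes X: "\<And>p. X p \<in> tangent_space M p"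
    "\<And>Y. Y \<in> vector_fields M \<Longrightarrow> (\<lambda>p. metric M p (X p) (Y p)) \<in> smooth_functions M"
  shows "X \<in> vector_fields M"
proof (rule vector_fields_localI[OF X(1)])
  fix p
  obtain U W where W: "open W" "p \<in> W" and U: "\<And>b. b \<in> Basis \<Longrightarrow> U b \<in> vector_fields M"
    and rep: "\<And>q w. q \<in> W \<Longrightarrow> w \<in> tangent_space M q \<Longrightarrow> w = (\<Sum>b\<in>(Basis::'e set). metric M q w (U b q) *\<^sub>R U b q)"
    by (rule orthonormal_frame[of p]) blast
  have "(\<lambda>q. \<Sum>b\<in>Basis. metric M q (X q) (U b q) *\<^sub>R U b q) \<in> vector_fields M"
    by (intro vector_fields_sum vector_fields_scale X(2) U)
  then show "\<exists>W Y. open W \<and> p \<in> W \<and> Y \<in> vector_fields M \<and> (\<forall>q\<in>W. X q = Y q)"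
    using W rep X(1) by blast
qed

text \<open>In an orthonormal frame the gradient is \<open>\<Sum>\<^sub>b U\<^sub>b(f) U\<^sub>b\<close>.\<close>

lemma
  assumes f: "f \<in> smooth_functions M"
  shows grad_tangent: "grad M f p \<in> tangent_space M p"
    and metric_grad: "v \<in> tangent_space M p \<Longrightarrow> metric M p (grad M f p) v = v f"
    and grad_vector_field: "grad M f \<in> vector_fields M"
proof -
  have *: "grad M f p \<in> tangent_space M p \<and> (\<forall>v\<in>tangent_space M p. metric M p (grad M f p) v = v f)" for p
  proof -
    obtain U W where W: "open W" "p \<in> W" and U: "\<And>b. b \<in> Basis \<Longrightarrow> U b \<in> vector_fields M"
      and rep: "\<And>q w. q \<in> W \<Longrightarrow> w \<in> tangent_space M q \<Longrightarrow> w = (\<Sum>b\<in>(Basis::'e set). metric M q w (U b q) *\<^sub>R U b q)"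
      by (rule orthonormal_frame[of p]) blast
    let ?w = "\<Sum>b\<in>Basis. U b p f *\<^sub>R U b p"
    note tU = vector_field_tangent[OF U]
    have w: "?w \<in> tangent_space M p" by (intro tangent_space_sum tangent_closed tU)
    have wv: "metric M p ?w v = v f" if v: "v \<in> tangent_space M p" for v
    proof -
      have "metric M p ?w v = (\<Sum>b\<in>Basis. metric M p v (U b p) * U b p f)"
        using v tU by (simp add: metric_sum_left metric_scale_left tangent_closed metric_sym[of v] mult.commute)
      also have "\<dots> = v f"
        by (subst (2) rep[OF W(2) v]) (simp add: sum_tangent_apply)
      finally show ?thesis .
    qed
    have "\<exists>!w. w \<in> tangent_space M p \<and> (\<forall>v\<in>tangent_space M p. metric M p w v = v f)"
    proof (rule ex1I[of _ ?w])
      show "?w \<in> tangent_space M p \<and> (\<forall>v\<in>tangent_space M p. metric M p ?w v = v f)" using w wv by blast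
      show "w' = ?w" if "w' \<in> tangent_space M p \<and> (\<forall>v\<in>tangent_space M p. metric M p w' v = v f)" for w'
        by (rule metric_eqI[OF _ w]) (use that wv in auto)
    qed
    from theI'[OF this] show ?thesis by (simp add: grad_def)
  qed
  show "grad M f p \<in> tangent_space M p" "v \<in> tangent_space M p \<Longrightarrow> metric M p (grad M f p) v = v f"
    using * by auto
  show "grad M f \<in> vector_fields M"
  proof (rule vector_fields_metricI)
    show "(\<lambda>p. metric M p (grad M f p) (Y p)) \<in> smooth_functions M" if "Y \<in> vector_fields M" for Y
      using * vector_field_tangent[OF that] vector_field_smooth[OF that f] by simp
  qed (use * in auto)
qed

text \<open>One more Gram--Schmidt step: the projection onto the span of \<open>B\<close> is corrected by the multiple of
  the new direction \<open>b - b'\<close> that is orthogonal to \<open>B\<close>. The coefficient is zero when this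
  direction vanishes.\<close>

lemma orthogonal_projection_span:
  assumes "finite B" "B \<subseteq> tangent_space M p" "v \<in> tangent_space M p"
  shows "\<exists>w\<in>span B. \<forall>u\<in>span B. metric M p (v - w) u = 0"
  using assms
proof (induction B arbitrary: v rule: finite_induct)
  case empty
  then show ?case using metric_zero_right[of v p] by (simp add: zero_fun_def)
next
  case (insert b B)
  have sT: "span (insert b B) \<subseteq> tangent_space M p" "span B \<subseteq> tangent_space M p"
    using insert.prems span_minimal[OF _ subspace_tangent_space] by auto
  have mono: "w \<in> span (insert b B)" if "w \<in> span B" for w
    using that span_mono[of B "insert b B"] by auto
  obtain b' where b': "b' \<in> span B" "\<forall>u\<in>span B. metric M p (b - b') u = 0"
    using insert.IH[of b] insert.prems by blast
  obtain w where w: "w \<in> span B" "\<forall>u\<in>span B. metric M p (v - w) u = 0"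
    using insert.IH[of v] insert.prems by blast
  let ?e = "b - b'"
  have e: "?e \<in> span (insert b B)" by (intro span_diff span_base mono b') simp
  have eT: "?e \<in> tangent_space M p" using e sT by auto
  have dec: "\<exists>k. \<exists>u'\<in>span B. u = k *\<^sub>R ?e + u'" if u: "u \<in> span (insert b B)" for u
  proof -
    obtain k where "u - k *\<^sub>R b \<in> span B" using u unfolding span_insert by auto
    then have "u - k *\<^sub>R b + k *\<^sub>R b' \<in> span B" by (intro span_add span_scale b')
    then show ?thesis
      by (intro exI[of _ k] bexI[of _ "u - k *\<^sub>R b + k *\<^sub>R b'"]) (simp_all add: scaleR_diff_right)
  qed
  define c where "c = metric M p (v - w) ?e / metric M p ?e ?e"
  have wT: "w \<in> tangent_space M p" using w sT by auto
  have vw: "v - w \<in> tangent_space M p" using insert.prems wT by (intro tangent_closed)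
  have "metric M p (v - w) ?e = c * metric M p ?e ?e"
  proof (cases "?e = 0")
    case True
    then show ?thesis using metric_zero_right[OF vw] metric_zero_right[OF tangent_closed(1)] by simp
  next
    case False
    then show ?thesis using metric_pos[OF eT] by (simp add: c_def)
  qed
  then have ce: "metric M p (v - w - c *\<^sub>R ?e) ?e = 0"
    using metric_diff_left[OF vw tangent_closed(4)[OF eT] eT] metric_scale_left[OF eT eT] by simp
  show ?case
  proof (intro bexI[of _ "w + c *\<^sub>R ?e"] ballI)
    show "w + c *\<^sub>R ?e \<in> span (insert b B)" by (intro span_add span_scale e mono w)
    fix u assume "u \<in> span (insert b B)"
    then obtain k u' where u: "u' \<in> span B" "u = k *\<^sub>R ?e + u'" using dec by blast
    have uT: "u' \<in> tangent_space M p" using u sT by auto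
    have r: "v - w - c *\<^sub>R ?e \<in> tangent_space M p" by (intro tangent_closed vw eT)
    have "metric M p (v - w - c *\<^sub>R ?e) u = metric M p (v - w - c *\<^sub>R ?e) u'"
      unfolding u(2) using ce
      by (simp add: metric_add_right metric_scale_right r uT eT tangent_closed(4)[OF eT])
    also have "\<dots> = 0"
      using w(2) b'(2) u(1) metric_diff_left[OF vw tangent_closed(4)[OF eT] uT] metric_scale_left[OF eT uT]
      by simp
    finally show "metric M p (v - (w + c *\<^sub>R ?e)) u = 0" by (simp add: diff_diff_eq)
  qed
qed

text \<open>Tangent spaces are finite-dimensional, so that orthogonal projections onto subspaces exist.\<close>

lemma orthogonal_projection_exists:
  assumes D: "subspace D" "D \<subseteq> tangent_space M p" and v: "v \<in> tangent_space M p"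
  shows "\<exists>w\<in>D. \<forall>u\<in>D. metric M p (v - w) u = 0"
proof -
  obtain x :: "'e \<Rightarrow> 'a \<Rightarrow> real" and E :: "'e \<Rightarrow> 'a field" and W
  where W: "p \<in> W"
    and rep: "\<And>q w. q \<in> W \<Longrightarrow> w \<in> tangent_space M q \<Longrightarrow> w = (\<Sum>b\<in>Basis. w (x b) *\<^sub>R E b q)"
    by (rule coordinate_frame[of p]) blast
  have T: "tangent_space M p \<subseteq> span ((\<lambda>b. E b p) ` Basis)"
  proof
    fix w assume "w \<in> tangent_space M p"
    then have "w = (\<Sum>b\<in>Basis. w (x b) *\<^sub>R E b p)" using rep W by blast
    moreover have "(\<Sum>b\<in>Basis. w (x b) *\<^sub>R E b p) \<in> span ((\<lambda>b. E b p) ` Basis)"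
      by (intro span_sum span_scale span_base) auto
    ultimately show "w \<in> span ((\<lambda>b. E b p) ` Basis)" by simp
  qed
  obtain B where B: "B \<subseteq> D" "independent B" "D \<subseteq> span B"
    using real_vector.maximal_independent_subset by blast
  have "finite B"
    using real_vector.independent_span_bound[OF _ B(2)] finite_imageI[OF finite_Basis] B(1) D(2) T by blast
  moreover have "span B = D" using B D span_minimal[of B D] by auto
  ultimately show ?thesis
    using orthogonal_projection_span[of B p v] B D v by auto
qed

lemma
  assumes D: "subspace (D p)" "D p \<subseteq> tangent_space M p" and v: "X p \<in> tangent_space M p"
  shows orth_proj_in: "orth_proj M D X p \<in> D p"
    and orth_proj_orthogonal: "u \<in> D p \<Longrightarrow> metric M p (X p - orth_proj M D X p) u = 0"
    and orth_proj_unique: "w \<in> D p \<Longrightarrow> (\<And>u. u \<in> D p \<Longrightarrow> metric M p (X p - w) u = 0)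
      \<Longrightarrow> orth_proj M D X p = w"
proof -
  have uniq: "w = w'" if w: "w \<in> D p" "\<forall>u\<in>D p. metric M p (X p - w) u = 0"
    and w': "w' \<in> D p" "\<forall>u\<in>D p. metric M p (X p - w') u = 0" for w w'
  proof -
    have T: "w \<in> tangent_space M p" "w' \<in> tangent_space M p" using w w' D by auto
    have d: "w - w' \<in> D p" using subspace_diff[OF D(1)] w w' by blast
    have "metric M p (w - w') (w - w') = metric M p ((X p - w') - (X p - w)) (w - w')" by simp
    also have "\<dots> = metric M p (X p - w') (w - w') - metric M p (X p - w) (w - w')"
      by (intro metric_diff_left tangent_closed v T)
    also have "\<dots> = 0" using w w' d by simp
    finally show ?thesis using metric_nondegenerate[of "w - w'" p] T by (simp add: tangent_closed)
  qed
  have "\<exists>!w. w \<in> D p \<and> (\<forall>u\<in>D p. metric M p (X p - w) u = 0)"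
    using orthogonal_projection_exists[OF D v] uniq by blast
  from theI'[OF this] have *: "orth_proj M D X p \<in> D p \<and> (\<forall>u\<in>D p. metric M p (X p - orth_proj M D X p) u = 0)"
    by (simp add: orth_proj_def)
  then show "orth_proj M D X p \<in> D p" "u \<in> D p \<Longrightarrow> metric M p (X p - orth_proj M D X p) u = 0" by auto
  show "orth_proj M D X p = w" if "w \<in> D p" "\<And>u. u \<in> D p \<Longrightarrow> metric M p (X p - w) u = 0"
    using uniq * that by blast
qed

end

section \<open>Connections\<close>

lemma (in manifold_space) tangent_vector_extends:
  assumes v: "v \<in> tangent_space M p"
  obtains X where "X \<in> vector_fields M" "X p = v"
proof -
  obtain x :: "'e \<Rightarrow> 'a \<Rightarrow> real" and E :: "'e \<Rightarrow> 'a field" and W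
  where W: "p \<in> W" and E: "\<And>b. E b \<in> vector_fields M"
    and rep: "\<And>q w. q \<in> W \<Longrightarrow> w \<in> tangent_space M q \<Longrightarrow> w = (\<Sum>b\<in>Basis. w (x b) *\<^sub>R E b q)"
    by (rule coordinate_frame[of p]) blast
  show thesis
  proof (rule that)
    show "(\<lambda>q. \<Sum>b\<in>Basis. v (x b) *\<^sub>R E b q) \<in> vector_fields M"
      by (intro vector_fields_sum vector_fields_cscale E)
    show "(\<Sum>b\<in>Basis. v (x b) *\<^sub>R E b p) = v" using rep[OF W v] by simp
  qed
qed

text \<open>The Levi-Civita connection and the pullback connection act on different modules of sections; the
  consequences of the axioms that both share are drawn here once. The closure properties of \<open>S\<close> are
  those of a module over the smooth functions.\<close>

locale module_connection = manifold_space M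
  for M :: "('a::{t2_space,second_countable_topology}, 'e::euclidean_space) manifold" +
  fixes S :: "('a \<Rightarrow> 'v::real_vector) set" and D :: "'a field \<Rightarrow> ('a \<Rightarrow> 'v) \<Rightarrow> ('a \<Rightarrow> 'v)"
  assumes connection: "connection M S D"
    and zero_in: "(\<lambda>p. 0) \<in> S"
    and add_in: "s \<in> S \<Longrightarrow> t \<in> S \<Longrightarrow> (\<lambda>p. s p + t p) \<in> S"
    and scale_in: "f \<in> smooth_functions M \<Longrightarrow> s \<in> S \<Longrightarrow> (\<lambda>p. f p *\<^sub>R s p) \<in> S"
begin

lemma cscale_in: "s \<in> S \<Longrightarrow> (\<lambda>p. c *\<^sub>R s p) \<in> S"
  by (rule scale_in[OF smooth_const])

lemma diff_in: "s \<in> S \<Longrightarrow> t \<in> S \<Longrightarrow> (\<lambda>p. s p - t p) \<in> S"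
  using add_in[OF _ cscale_in[of t "-1"]] by simp

lemma sum_in: "(\<And>i. i \<in> I \<Longrightarrow> s i \<in> S) \<Longrightarrow> (\<lambda>p. \<Sum>i\<in>I. s i p) \<in> S"
  by (induction I rule: infinite_finite_induct) (auto intro: zero_in add_in)

lemma D_in: "X \<in> vector_fields M \<Longrightarrow> s \<in> S \<Longrightarrow> D X s \<in> S"
  using connection by (simp add: connection_def)

lemma D_add:
  assumes "X \<in> vector_fields M" "s \<in> S" "t \<in> S"
  shows "D X (\<lambda>p. s p + t p) p = D X s p + D X t p"
proof -
  have "D X (s + t) = D X s + D X t" using connection assms by (simp add: connection_def)
  then show ?thesis by (simp add: plus_fun_def)
qed

lemma D_scale:
  "X \<in> vector_fields M \<Longrightarrow> f \<in> smooth_functions M \<Longrightarrow> s \<in> S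
    \<Longrightarrow> D X (\<lambda>p. f p *\<^sub>R s p) p = X p f *\<^sub>R s p + f p *\<^sub>R D X s p"
  using connection by (simp add: connection_def)

lemma D_cscale:
  "X \<in> vector_fields M \<Longrightarrow> s \<in> S \<Longrightarrow> D X (\<lambda>p. c *\<^sub>R s p) p = c *\<^sub>R D X s p"
  using D_scale[OF _ smooth_const, of X s c p] tangent_const[OF vector_field_tangent] by simp

lemma D_zero: "X \<in> vector_fields M \<Longrightarrow> D X (\<lambda>p. 0) p = 0"
  using D_cscale[OF _ zero_in, of X 0 p] by simp

lemma D_diff:
  "X \<in> vector_fields M \<Longrightarrow> s \<in> S \<Longrightarrow> t \<in> S \<Longrightarrow> D X (\<lambda>p. s p - t p) p = D X s p - D X t p"
  using D_add[OF _ _ cscale_in[of t "-1"], of X s p] D_cscale[of X t "-1" p] by simp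

lemma D_sum:
  assumes "X \<in> vector_fields M" "\<And>i. i \<in> I \<Longrightarrow> s i \<in> S"
  shows "D X (\<lambda>p. \<Sum>i\<in>I. s i p) p = (\<Sum>i\<in>I. D X (s i) p)"
  using assms(2)
  by (induction I rule: infinite_finite_induct) (auto simp: D_zero D_add assms(1) sum_in)

text \<open>As for derivations: the section \<open>s - t\<close> is annihilated by a bump function.\<close>

lemma D_local:
  assumes X: "X \<in> vector_fields M" and st: "s \<in> S" "t \<in> S"
    and W: "open W" "p \<in> W" "\<And>q. q \<in> W \<Longrightarrow> s q = t q"
  shows "D X s p = D X t p"
proof -
  obtain \<beta> W' where beta: "\<beta> \<in> smooth_functions M" "p \<in> W'"
    "\<And>q. q \<in> W' \<Longrightarrow> \<beta> q = (1::real)" "\<And>q. q \<notin> W \<Longrightarrow> \<beta> q = 0"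
    using bump_function[OF W(1,2)] by metis
  have "(\<lambda>q. \<beta> q *\<^sub>R (s q - t q)) = (\<lambda>_. 0)" using beta(4) W(3) by fastforce
  then have "0 = D X (\<lambda>q. \<beta> q *\<^sub>R (s q - t q)) p" by (simp add: D_zero X)
  also have "\<dots> = D X s p - D X t p"
    using beta(2,3) W(2,3) by (simp add: D_scale[OF X beta(1) diff_in[OF st]] D_diff[OF X st])
  finally show ?thesis by simp
qed

end

locale levi_civita_space = riemannian_space M
  for M :: "('a::{t2_space,second_countable_topology}, 'e::euclidean_space) manifold" +
  fixes nabla :: "'a field \<Rightarrow> 'a field \<Rightarrow> 'a field"
  assumes levi_civita: "levi_civita M nabla"

sublocale levi_civita_space \<subseteq> nabla: module_connection M "vector_fields M" nabla
  using levi_civita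
  by unfold_locales
    (auto simp: levi_civita_def intro: vector_fields_zero vector_fields_add vector_fields_scale)

context levi_civita_space
begin

lemma nabla_tangent:
  "X \<in> vector_fields M \<Longrightarrow> Y \<in> vector_fields M \<Longrightarrow> nabla X Y p \<in> tangent_space M p"
  by (rule vector_field_tangent[OF nabla.D_in])

lemma nabla_torsion_free:
  assumes "X \<in> vector_fields M" "Y \<in> vector_fields M"
  shows "nabla X Y p - nabla Y X p = lie_bracket M X Y p"
proof -
  have "nabla X Y - nabla Y X = lie_bracket M X Y"
    using levi_civita assms by (simp add: levi_civita_def)
  from fun_cong[OF this, of p] show ?thesis by simp
qed

lemma lie_bracket_tangent:
  "X \<in> vector_fields M \<Longrightarrow> Y \<in> vector_fields M \<Longrightarrow> lie_bracket M X Y p \<in> tangent_space M p"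
  using subspace_diff[OF subspace_tangent_space nabla_tangent[of X Y p] nabla_tangent[of Y X p]]
    nabla_torsion_free[of X Y p] by simp

lemma nabla_metric:
  "X \<in> vector_fields M \<Longrightarrow> Y \<in> vector_fields M \<Longrightarrow> Z \<in> vector_fields M \<Longrightarrow>
    X p (\<lambda>q. metric M q (Y q) (Z q)) = metric M p (nabla X Y p) (Z p) + metric M p (Y p) (nabla X Z p)"
  using levi_civita by (simp add: levi_civita_def)

end

section \<open>Differentials and the pullback connection\<close>

locale smooth_map_between = M: manifold_space M + N: manifold_space N
  for M :: "('a::{t2_space,second_countable_topology}, 'e::euclidean_space) manifold"
    and N :: "('b::{t2_space,second_countable_topology}, 'f::euclidean_space) manifold" +
  fixes F :: "'a \<Rightarrow> 'b"
  assumes smooth_map: "smooth_map M N F"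
begin

abbreviation dF :: "'a \<Rightarrow> 'a tangent \<Rightarrow> 'b tangent" where
  "dF \<equiv> differential M N F"

lemma map_preimage_open: "open W \<Longrightarrow> open (F -` W)"
  using smooth_map open_vimage unfolding smooth_map_def by blast

lemma smooth_pullback:
  assumes h: "h \<in> smooth_functions N"
  shows "(\<lambda>q. h (F q)) \<in> smooth_functions M"
proof (rule M.smooth_functions_chartwiseI)
  fix p
  obtain U \<phi> where c: "(U, \<phi>) \<in> atlas M" "p \<in> U" by (rule M.chart_at)
  obtain V \<psi> where d: "(V, \<psi>) \<in> atlas N" "F p \<in> V" by (rule N.chart_at)
  let ?W = "U \<inter> F -` V"
  have oW: "open ?W"
    using M.chart_domain_open[OF c(1)] map_preimage_open[OF N.chart_domain_open[OF d(1)]] by blast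
  have oI: "open (\<phi> ` ?W)" by (rule M.chart_open_map[OF c(1) oW]) auto
  have invM: "inv_into U \<phi> (\<phi> q) = q" if "q \<in> U" for q
    using M.chart_inj[OF c(1)] that by simp
  have invN: "inv_into V \<psi> (\<psi> q) = q" if "q \<in> V" for q
    using N.chart_inj[OF d(1)] that by simp
  have "\<forall>(U, \<phi>)\<in>atlas M. \<forall>(W, \<psi>)\<in>atlas N. smooth_on (\<phi> ` (U \<inter> F -` W)) (\<psi> \<circ> F \<circ> inv_into U \<phi>)"
    using smooth_map by (simp add: smooth_map_def)
  then have "smooth_on (\<phi> ` ?W) (\<psi> \<circ> F \<circ> inv_into U \<phi>)" using c(1) d(1) by fast
  then have "smooth_on (\<phi> ` ?W) (\<lambda>y. (h \<circ> inv_into V \<psi>) ((\<psi> \<circ> F \<circ> inv_into U \<phi>) y))"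
    by (rule smooth_on_compose[OF oI N.chart_image_open[OF d(1)] N.smooth_in_chart[OF h d(1)]])
      (auto simp: invM)
  then show "\<exists>U \<phi> W k. (U, \<phi>) \<in> atlas M \<and> open W \<and> p \<in> W \<and> W \<subseteq> U \<and>
    smooth_on (\<phi> ` W) k \<and> (\<forall>q\<in>W. h (F q) = k (\<phi> q))"
    using c d oW
    by (intro exI[of _ U] exI[of _ \<phi>] exI[of _ ?W]
        exI[of _ "\<lambda>y. (h \<circ> inv_into V \<psi>) ((\<psi> \<circ> F \<circ> inv_into U \<phi>) y)"])
      (auto simp: invM invN)
qed

lemma dF_apply: "h \<in> smooth_functions N \<Longrightarrow> dF p v h = v (\<lambda>q. h (F q))"
  by (simp add: differential_def o_def)

lemma dF_tangent:
  assumes v: "v \<in> tangent_space M p"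
  shows "dF p v \<in> tangent_space N (F p)"
  unfolding tangent_space_def
proof (intro CollectI conjI ballI allI impI)
  fix f g assume f: "f \<in> smooth_functions N" and g: "g \<in> smooth_functions N"
  have fg: "f + g \<in> smooth_functions N" "f * g \<in> smooth_functions N"
    using N.smooth_add[OF f g] N.smooth_mult[OF f g] by (simp_all add: plus_fun_def times_fun_def)
  show "dF p v (f + g) = dF p v f + dF p v g"
    using M.tangent_add[OF v smooth_pullback[OF f] smooth_pullback[OF g]] by (simp add: dF_apply f g fg)
  show "dF p v (f * g) = dF p v f * g (F p) + f (F p) * dF p v g"
    using M.tangent_mult[OF v smooth_pullback[OF f] smooth_pullback[OF g]] by (simp add: dF_apply f g fg)
next
  fix f c assume f: "f \<in> smooth_functions N"
  have cf: "c *\<^sub>R f \<in> smooth_functions N" using N.smooth_cmult[OF f] by (simp add: scaleR_fun_def)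
  show "dF p v (c *\<^sub>R f) = c * dF p v f"
    unfolding dF_apply[OF cf] dF_apply[OF f]
    using M.tangent_cmult[OF v smooth_pullback[OF f]] by (simp add: scaleR_fun_def)
qed (simp add: differential_def)

lemma dF_add: "dF p (u + v) = dF p u + dF p v"
  by (auto simp: differential_def fun_eq_iff)

lemma dF_scale: "dF p (c *\<^sub>R v) = c *\<^sub>R dF p v"
  by (auto simp: differential_def fun_eq_iff scaleR_fun_def)

lemma fields_along_tangent: "s \<in> fields_along M N F \<Longrightarrow> s p \<in> tangent_space N (F p)"
  by (simp add: fields_along_def)

lemma fields_along_smooth:
  "s \<in> fields_along M N F \<Longrightarrow> h \<in> smooth_functions N \<Longrightarrow> (\<lambda>p. s p h) \<in> smooth_functions M"
  by (simp add: fields_along_def)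

lemma fields_along_zero: "(\<lambda>p. 0) \<in> fields_along M N F"
  using subspace_0[OF N.subspace_tangent_space] M.smooth_const[of 0] by (simp add: fields_along_def)

lemma fields_along_add:
  "s \<in> fields_along M N F \<Longrightarrow> t \<in> fields_along M N F \<Longrightarrow> (\<lambda>p. s p + t p) \<in> fields_along M N F"
  using subspace_add[OF N.subspace_tangent_space] M.smooth_add by (simp add: fields_along_def)

lemma fields_along_scale:
  "f \<in> smooth_functions M \<Longrightarrow> s \<in> fields_along M N F \<Longrightarrow> (\<lambda>p. f p *\<^sub>R s p) \<in> fields_along M N F"
  using subspace_scale[OF N.subspace_tangent_space] M.smooth_mult
  by (simp add: fields_along_def scaleR_fun_def)

lemma fields_along_pullback: "Z \<in> vector_fields N \<Longrightarrow> Z \<circ> F \<in> fields_along M N F"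
  using smooth_pullback N.vector_field_smooth N.vector_field_tangent by (auto simp: fields_along_def)

lemma fields_along_dF: "X \<in> vector_fields M \<Longrightarrow> (\<lambda>p. dF p (X p)) \<in> fields_along M N F"
  using dF_tangent M.vector_field_tangent M.vector_field_smooth smooth_pullback
  by (auto simp: fields_along_def dF_apply)

end

locale pullback_connection_space = smooth_map_between M N F + M: levi_civita_space M nabla +
    N: levi_civita_space N nablaN
  for M :: "('a::{t2_space,second_countable_topology}, 'e::euclidean_space) manifold"
    and N :: "('b::{t2_space,second_countable_topology}, 'f::euclidean_space) manifold"
    and F nabla nablaN +
  fixes nablaF :: "'a field \<Rightarrow> ('a \<Rightarrow> 'b tangent) \<Rightarrow> ('a \<Rightarrow> 'b tangent)"
  assumes pullback_connection: "pullback_connection M N F nablaN nablaF"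

sublocale pullback_connection_space \<subseteq> nablaF: module_connection M "fields_along M N F" nablaF
  using pullback_connection
  by unfold_locales
    (auto simp: pullback_connection_def intro: fields_along_zero fields_along_add fields_along_scale)

context pullback_connection_space
begin

lemma nablaF_pullback:
  "X \<in> vector_fields M \<Longrightarrow> Z \<in> vector_fields N \<Longrightarrow> W \<in> vector_fields N \<Longrightarrow> W (F p) = dF p (X p)
    \<Longrightarrow> nablaF X (Z \<circ> F) p = nablaN W Z (F p)"
  using pullback_connection unfolding pullback_connection_def by blast

text \<open>The compatibility with the metric for one pair of sections, together with the smoothness of their
  product that gives the left-hand side a meaning. Both are propagated from sections of the form
  \<open>Z \<circ> F\<close>, for which they hold by the defining property of the pullback connection.\<close>

definition metric_compatible :: "('a \<Rightarrow> 'b tangent) \<Rightarrow> ('a \<Rightarrow> 'b tangent) \<Rightarrow> bool" where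
  "metric_compatible s t \<longleftrightarrow> s \<in> fields_along M N F \<and> t \<in> fields_along M N F \<and>
    (\<lambda>q. metric N (F q) (s q) (t q)) \<in> smooth_functions M \<and>
    (\<forall>X\<in>vector_fields M. \<forall>p. X p (\<lambda>q. metric N (F q) (s q) (t q)) =
      metric N (F p) (nablaF X s p) (t p) + metric N (F p) (s p) (nablaF X t p))"

lemma nablaF_tangent:
  "X \<in> vector_fields M \<Longrightarrow> s \<in> fields_along M N F \<Longrightarrow> nablaF X s p \<in> tangent_space N (F p)"
  by (rule fields_along_tangent[OF nablaF.D_in])

lemma metric_compatible_pullback:
  assumes Z: "Z \<in> vector_fields N" and Y: "Y \<in> vector_fields N"
  shows "metric_compatible (Z \<circ> F) (Y \<circ> F)"
  unfolding metric_compatible_def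
proof (intro conjI ballI allI fields_along_pullback Z Y)
  let ?g = "\<lambda>y. metric N y (Z y) (Y y)"
  have g: "?g \<in> smooth_functions N" by (rule N.metric_smooth[OF Z Y])
  show "(\<lambda>q. metric N (F q) ((Z \<circ> F) q) ((Y \<circ> F) q)) \<in> smooth_functions M"
    using smooth_pullback[OF g] by simp
  fix X p assume X: "X \<in> vector_fields M"
  obtain W where W: "W \<in> vector_fields N" "W (F p) = dF p (X p)"
    by (rule N.tangent_vector_extends[OF dF_tangent[OF M.vector_field_tangent[OF X]]])
  have "X p (\<lambda>q. ?g (F q)) = W (F p) ?g" by (simp add: W(2) dF_apply g)
  then show "X p (\<lambda>q. metric N (F q) ((Z \<circ> F) q) ((Y \<circ> F) q)) =
      metric N (F p) (nablaF X (Z \<circ> F) p) ((Y \<circ> F) p) + metric N (F p) ((Z \<circ> F) p) (nablaF X (Y \<circ> F) p)"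
    by (simp add: nablaF_pullback[OF X Z W] nablaF_pullback[OF X Y W] N.nabla_metric[OF W(1) Z Y])
qed

lemma metric_compatible_sym: "metric_compatible s t \<Longrightarrow> metric_compatible t s"
  unfolding metric_compatible_def
  by (auto simp: N.metric_sym[of "t _"] fields_along_tangent nablaF_tangent
      N.metric_sym[of "nablaF _ t _"] add.commute)

lemma metric_compatible_zero: "t \<in> fields_along M N F \<Longrightarrow> metric_compatible (\<lambda>p. 0) t"
  unfolding metric_compatible_def
  by (auto simp: fields_along_zero N.metric_zero_left fields_along_tangent nablaF_tangent
      M.smooth_const nablaF.D_zero M.tangent_const[OF M.vector_field_tangent])

lemma metric_compatible_add:
  assumes c: "metric_compatible s t" "metric_compatible s' t"
  shows "metric_compatible (\<lambda>p. s p + s' p) t"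
proof -
  have f: "s \<in> fields_along M N F" "s' \<in> fields_along M N F" "t \<in> fields_along M N F"
    using c by (auto simp: metric_compatible_def)
  have sm: "(\<lambda>q. metric N (F q) (s q) (t q)) \<in> smooth_functions M"
    "(\<lambda>q. metric N (F q) (s' q) (t q)) \<in> smooth_functions M"
    using c by (auto simp: metric_compatible_def)
  have eq: "metric N (F q) (s q + s' q) (t q) = metric N (F q) (s q) (t q) + metric N (F q) (s' q) (t q)" for q
    using f by (simp add: N.metric_add_left fields_along_tangent)
  show ?thesis
    unfolding metric_compatible_def eq
  proof (intro conjI ballI allI fields_along_add f M.smooth_add sm)
    fix X p assume X: "X \<in> vector_fields M"
    have "X p (\<lambda>q. metric N (F q) (s q) (t q) + metric N (F q) (s' q) (t q)) =
      (metric N (F p) (nablaF X s p) (t p) + metric N (F p) (s p) (nablaF X t p)) +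
      (metric N (F p) (nablaF X s' p) (t p) + metric N (F p) (s' p) (nablaF X t p))"
      using M.tangent_add[OF M.vector_field_tangent[OF X] sm] c X by (simp add: metric_compatible_def)
    then show "X p (\<lambda>q. metric N (F q) (s q) (t q) + metric N (F q) (s' q) (t q)) =
      metric N (F p) (nablaF X (\<lambda>p. s p + s' p) p) (t p) + metric N (F p) (s p + s' p) (nablaF X t p)"
      using X f by (simp add: nablaF.D_add N.metric_add_left fields_along_tangent nablaF_tangent)
  qed
qed

lemma metric_compatible_scale:
  assumes c: "metric_compatible s t" and h: "h \<in> smooth_functions M"
  shows "metric_compatible (\<lambda>p. h p *\<^sub>R s p) t"
proof -
  have f: "s \<in> fields_along M N F" "t \<in> fields_along M N F"
    and sm: "(\<lambda>q. metric N (F q) (s q) (t q)) \<in> smooth_functions M"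
    using c by (auto simp: metric_compatible_def)
  have eq: "metric N (F q) (h q *\<^sub>R s q) v = h q * metric N (F q) (s q) v"
    if "v \<in> tangent_space N (F q)" for q v
    using f that by (simp add: N.metric_scale_left fields_along_tangent)
  have eqt: "(\<lambda>q. metric N (F q) (h q *\<^sub>R s q) (t q)) = (\<lambda>q. h q * metric N (F q) (s q) (t q))"
    using f by (simp add: eq fields_along_tangent)
  show ?thesis
    unfolding metric_compatible_def eqt
  proof (intro conjI ballI allI fields_along_scale f h M.smooth_mult sm)
    fix X p assume X: "X \<in> vector_fields M"
    have "X p (\<lambda>q. h q * metric N (F q) (s q) (t q)) = X p h * metric N (F p) (s p) (t p) +
      h p * (metric N (F p) (nablaF X s p) (t p) + metric N (F p) (s p) (nablaF X t p))"
      using M.tangent_mult[OF M.vector_field_tangent[OF X] h sm] c X by (simp add: metric_compatible_def)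
    then show "X p (\<lambda>q. h q * metric N (F q) (s q) (t q)) =
      metric N (F p) (nablaF X (\<lambda>p. h p *\<^sub>R s p) p) (t p) + metric N (F p) (h p *\<^sub>R s p) (nablaF X t p)"
      using X f h by (simp add: nablaF.D_scale N.metric_add_left N.metric_scale_left
          fields_along_tangent nablaF_tangent N.tangent_closed algebra_simps)
  qed
qed

lemma metric_compatible_sum:
  assumes "\<And>i. i \<in> I \<Longrightarrow> metric_compatible (s i) t" "t \<in> fields_along M N F"
  shows "metric_compatible (\<lambda>p. \<Sum>i\<in>I. s i p) t"
  using assms(1)
  by (induction I rule: infinite_finite_induct)
    (auto intro: metric_compatible_zero assms(2) metric_compatible_add)

text \<open>A local frame of \<open>N\<close> near \<open>F p\<close> reduces statements about sections of the pullback bundle to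
  sections of the form \<open>Z \<circ> F\<close>.\<close>

lemma fields_along_frame:
  obtains x :: "'f \<Rightarrow> 'b \<Rightarrow> real" and Z :: "'f \<Rightarrow> 'b field" and W V
  where "open V" "F p \<in> V" "W = F -` V" "open W" "p \<in> W" "\<And>b. x b \<in> smooth_functions N" "\<And>b. Z b \<in> vector_fields N"
    "\<And>q b c. q \<in> V \<Longrightarrow> b \<in> Basis \<Longrightarrow> c \<in> Basis \<Longrightarrow> Z b q (x c) = (if b = c then 1 else 0)"
    "\<And>q w. q \<in> V \<Longrightarrow> w \<in> tangent_space N q \<Longrightarrow> w = (\<Sum>b\<in>Basis. w (x b) *\<^sub>R Z b q)"
    "\<And>s. s \<in> fields_along M N F \<Longrightarrow> (\<lambda>q. \<Sum>b\<in>Basis. s q (x b) *\<^sub>R (Z b \<circ> F) q) \<in> fields_along M N F"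
    "\<And>s q. s \<in> fields_along M N F \<Longrightarrow> q \<in> W \<Longrightarrow> s q = (\<Sum>b\<in>Basis. s q (x b) *\<^sub>R (Z b \<circ> F) q)"
proof -
  obtain x :: "'f \<Rightarrow> 'b \<Rightarrow> real" and Z :: "'f \<Rightarrow> 'b field" and V
  where V: "open V" "F p \<in> V" and x: "\<And>b. x b \<in> smooth_functions N" and Z: "\<And>b. Z b \<in> vector_fields N"
    and Zx: "\<And>q b c. q \<in> V \<Longrightarrow> b \<in> Basis \<Longrightarrow> c \<in> Basis \<Longrightarrow> Z b q (x c) = (if b = c then 1 else 0)"
    and rep: "\<And>q w. q \<in> V \<Longrightarrow> w \<in> tangent_space N q \<Longrightarrow> w = (\<Sum>b\<in>Basis. w (x b) *\<^sub>R Z b q)"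
    by (rule N.coordinate_frame[of "F p"]) blast
  show thesis
  proof (rule that[OF V refl map_preimage_open[OF V(1)] _ x Z Zx rep])
    show "p \<in> F -` V" using V by simp
    show "(\<lambda>q. \<Sum>b\<in>Basis. s q (x b) *\<^sub>R (Z b \<circ> F) q) \<in> fields_along M N F"
      if "s \<in> fields_along M N F" for s
      by (intro nablaF.sum_in fields_along_scale fields_along_smooth that x fields_along_pullback Z)
    show "s q = (\<Sum>b\<in>Basis. s q (x b) *\<^sub>R (Z b \<circ> F) q)"
      if "s \<in> fields_along M N F" "q \<in> F -` V" for s q
      unfolding o_apply by (rule rep) (use that fields_along_tangent in auto)
  qed
qed

lemma fields_along_metric_compatible:
  assumes s: "s \<in> fields_along M N F" and t: "t \<in> fields_along M N F"
  shows "metric_compatible s t"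
proof -
  have loc: "\<exists>W s' t'. open W \<and> p \<in> W \<and> metric_compatible s' t' \<and> (\<forall>q\<in>W. s q = s' q \<and> t q = t' q)" for p
  proof -
    obtain x :: "'f \<Rightarrow> 'b \<Rightarrow> real" and Z :: "'f \<Rightarrow> 'b field" and W
    where W: "open W" "p \<in> W" and x: "\<And>b. x b \<in> smooth_functions N" and Z: "\<And>b. Z b \<in> vector_fields N"
      and inn: "\<And>s. s \<in> fields_along M N F \<Longrightarrow> (\<lambda>q. \<Sum>b\<in>Basis. s q (x b) *\<^sub>R (Z b \<circ> F) q) \<in> fields_along M N F"
      and rep: "\<And>s q. s \<in> fields_along M N F \<Longrightarrow> q \<in> W \<Longrightarrow> s q = (\<Sum>b\<in>Basis. s q (x b) *\<^sub>R (Z b \<circ> F) q)"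
      by (rule fields_along_frame[of p]) blast
    let ?r = "\<lambda>s q. \<Sum>b\<in>Basis. s q (x b) *\<^sub>R (Z b \<circ> F) q"
    have "metric_compatible (Z b \<circ> F) (?r s)" if "s \<in> fields_along M N F" for s b
      by (intro metric_compatible_sym[of "?r s"] metric_compatible_sum metric_compatible_scale
          metric_compatible_pullback fields_along_smooth x Z that fields_along_pullback)
    note mc = this[OF t]
    have "metric_compatible (?r s) (?r t)"
      by (intro metric_compatible_sum metric_compatible_scale fields_along_smooth s t x inn mc)
    then show ?thesis using W rep[OF s] rep[OF t] by blast
  qed
  show ?thesis
    unfolding metric_compatible_def
  proof (intro conjI s t ballI allI)
    show sm: "(\<lambda>q. metric N (F q) (s q) (t q)) \<in> smooth_functions M"
    proof (rule M.smooth_functions_localI)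
      fix p
      obtain W s' t' where "open W" "p \<in> W" "metric_compatible s' t'" "\<forall>q\<in>W. s q = s' q \<and> t q = t' q"
        using loc by metis
      then show "\<exists>W h. open W \<and> p \<in> W \<and> h \<in> smooth_functions M \<and> (\<forall>q\<in>W. metric N (F q) (s q) (t q) = h q)"
        unfolding metric_compatible_def
        by (intro exI[of _ W] exI[of _ "\<lambda>q. metric N (F q) (s' q) (t' q)"]) auto
    qed
    fix X p assume X: "X \<in> vector_fields M"
    obtain W s' t' where W: "open W" "p \<in> W" and c: "metric_compatible s' t'" and eq: "\<forall>q\<in>W. s q = s' q \<and> t q = t' q"
      using loc by metis
    have f: "s' \<in> fields_along M N F" "t' \<in> fields_along M N F"
      and sm': "(\<lambda>q. metric N (F q) (s' q) (t' q)) \<in> smooth_functions M"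
      using c by (auto simp: metric_compatible_def)
    have "X p (\<lambda>q. metric N (F q) (s q) (t q)) = X p (\<lambda>q. metric N (F q) (s' q) (t' q))"
      by (rule M.tangent_local[OF M.vector_field_tangent[OF X] sm sm' W]) (use eq in auto)
    also have "\<dots> = metric N (F p) (nablaF X s' p) (t' p) + metric N (F p) (s' p) (nablaF X t' p)"
      using c X by (simp add: metric_compatible_def)
    also have "nablaF X s' p = nablaF X s p"
      by (rule nablaF.D_local[OF X f(1) s W]) (use eq in auto)
    also have "nablaF X t' p = nablaF X t p"
      by (rule nablaF.D_local[OF X f(2) t W]) (use eq in auto)
    finally show "X p (\<lambda>q. metric N (F q) (s q) (t q)) =
      metric N (F p) (nablaF X s p) (t p) + metric N (F p) (s p) (nablaF X t p)"
      using eq W by simp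
  qed
qed

lemma metric_along_smooth:
  "s \<in> fields_along M N F \<Longrightarrow> t \<in> fields_along M N F
    \<Longrightarrow> (\<lambda>q. metric N (F q) (s q) (t q)) \<in> smooth_functions M"
  using fields_along_metric_compatible by (simp add: metric_compatible_def)

lemma nablaF_metric:
  "X \<in> vector_fields M \<Longrightarrow> s \<in> fields_along M N F \<Longrightarrow> t \<in> fields_along M N F \<Longrightarrow>
    X p (\<lambda>q. metric N (F q) (s q) (t q)) =
      metric N (F p) (nablaF X s p) (t p) + metric N (F p) (s p) (nablaF X t p)"
  using fields_along_metric_compatible by (simp add: metric_compatible_def)

text \<open>The second derivatives of \<open>F\<close> are symmetric. In a coordinate frame of \<open>N\<close> the constant
  extensions of \<open>F\<^sub>*X\<close> and \<open>F\<^sub>*Y\<close> commute, so that only the bracket of \<open>X\<close> and \<open>Y\<close> remains.\<close>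

lemma nablaF_torsion_free:
  assumes X: "X \<in> vector_fields M" and Y: "Y \<in> vector_fields M"
  shows "nablaF X (\<lambda>q. dF q (Y q)) p - nablaF Y (\<lambda>q. dF q (X q)) p = dF p (lie_bracket M X Y p)"
proof -
  obtain x :: "'f \<Rightarrow> 'b \<Rightarrow> real" and Z :: "'f \<Rightarrow> 'b field" and W V
  where V: "open V" "F p \<in> V" and W: "open W" "p \<in> W"
    and x: "\<And>b. x b \<in> smooth_functions N" and Z: "\<And>b. Z b \<in> vector_fields N"
    and Zx: "\<And>q b c. q \<in> V \<Longrightarrow> b \<in> Basis \<Longrightarrow> c \<in> Basis \<Longrightarrow> Z b q (x c) = (if b = c then 1 else 0)"
    and repV: "\<And>q w. q \<in> V \<Longrightarrow> w \<in> tangent_space N q \<Longrightarrow> w = (\<Sum>b\<in>Basis. w (x b) *\<^sub>R Z b q)"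
    and inn: "\<And>s. s \<in> fields_along M N F \<Longrightarrow> (\<lambda>q. \<Sum>b\<in>Basis. s q (x b) *\<^sub>R (Z b \<circ> F) q) \<in> fields_along M N F"
    and rep: "\<And>s q. s \<in> fields_along M N F \<Longrightarrow> q \<in> W \<Longrightarrow> s q = (\<Sum>b\<in>Basis. s q (x b) *\<^sub>R (Z b \<circ> F) q)"
    by (rule fields_along_frame[of p]) blast
  define y where "y b = (\<lambda>q. x b (F q))" for b
  have y: "y b \<in> smooth_functions M" for b unfolding y_def by (rule smooth_pullback[OF x])
  \<comment> \<open>the extension of \<open>F\<^sub>*X\<close> at \<open>F p\<close> with constant coefficients\<close>
  define ext where "ext X = (\<lambda>r. \<Sum>b\<in>Basis. X p (y b) *\<^sub>R Z b r)" for X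
  have ext: "ext X \<in> vector_fields N" for X
    unfolding ext_def by (intro N.vector_fields_sum N.vector_fields_cscale Z)
  have extF: "ext X (F p) = dF p (X p)" if X: "X \<in> vector_fields M" for X
    using repV[OF V(2) dF_tangent[OF M.vector_field_tangent[OF X]]] by (simp add: ext_def dF_apply x y_def)
  have main: "nablaF X (\<lambda>q. dF q (Y q)) p =
      (\<Sum>b\<in>Basis. X p (\<lambda>q. Y q (y b)) *\<^sub>R Z b (F p)) + nablaN (ext X) (ext Y) (F p)"
    if X: "X \<in> vector_fields M" and Y: "Y \<in> vector_fields M" for X Y
  proof -
    let ?s = "\<lambda>q. dF q (Y q)"
    have s: "?s \<in> fields_along M N F" by (rule fields_along_dF[OF Y])
    have Yy: "(\<lambda>q. Y q (y b)) \<in> smooth_functions M" for b by (rule M.vector_field_smooth[OF Y y])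
    have sx: "?s q (x b) = Y q (y b)" for q b by (simp add: dF_apply x y_def)
    have "nablaF X ?s p = nablaF X (\<lambda>q. \<Sum>b\<in>Basis. ?s q (x b) *\<^sub>R (Z b \<circ> F) q) p"
      by (rule nablaF.D_local[OF X s inn[OF s] W]) (rule rep[OF s])
    also have "\<dots> = (\<Sum>b\<in>Basis. nablaF X (\<lambda>q. Y q (y b) *\<^sub>R (Z b \<circ> F) q) p)"
      unfolding sx by (rule nablaF.D_sum[OF X]) (intro fields_along_scale Yy fields_along_pullback Z)
    also have "\<dots> = (\<Sum>b\<in>Basis. X p (\<lambda>q. Y q (y b)) *\<^sub>R (Z b \<circ> F) p + Y p (y b) *\<^sub>R nablaF X (Z b \<circ> F) p)"
      by (rule sum.cong[OF refl]) (rule nablaF.D_scale[OF X Yy fields_along_pullback[OF Z]])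
    also have "\<dots> = (\<Sum>b\<in>Basis. X p (\<lambda>q. Y q (y b)) *\<^sub>R Z b (F p))
        + (\<Sum>b\<in>Basis. Y p (y b) *\<^sub>R nablaN (ext X) (Z b) (F p))"
      by (simp add: sum.distrib nablaF_pullback[OF X Z ext extF[OF X]])
    also have "(\<Sum>b\<in>Basis. Y p (y b) *\<^sub>R nablaN (ext X) (Z b) (F p)) = nablaN (ext X) (ext Y) (F p)"
      unfolding ext_def[of Y]
      by (simp add: N.nabla.D_sum N.nabla.D_cscale ext N.vector_fields_cscale Z)
    finally show ?thesis .
  qed
  have commute: "lie_bracket N (ext X) (ext Y) (F p) = 0"
  proof -
    have c: "ext X (F p) (\<lambda>r. ext Y r (x b)) = 0" if "b \<in> Basis" for X Y b
    proof -
      have "ext X (F p) (\<lambda>r. ext Y r (x b)) = ext X (F p) (\<lambda>_. Y p (y b))"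
      proof (rule N.tangent_local[OF N.vector_field_tangent[OF ext] N.vector_field_smooth[OF ext x] N.smooth_const V])
        fix r assume "r \<in> V"
        then show "ext Y r (x b) = Y p (y b)"
          unfolding ext_def N.sum_tangent_apply
          using that by (simp add: Zx if_distrib[of "(*) _"] cong: sum.cong if_cong)
      qed
      then show ?thesis by (simp add: N.tangent_const[OF N.vector_field_tangent[OF ext]])
    qed
    have "lie_bracket N (ext X) (ext Y) (F p) (x b) = 0" if "b \<in> Basis" for b
      using c[OF that, of X Y] c[OF that, of Y X] x[of b] by (simp add: lie_bracket_def)
    then show ?thesis
      using repV[OF V(2) N.lie_bracket_tangent[OF ext ext, of X Y]] by simp
  qed
  have "dF p (lie_bracket M X Y p) = (\<Sum>b\<in>Basis. lie_bracket M X Y p (y b) *\<^sub>R Z b (F p))"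
    using repV[OF V(2) dF_tangent[OF M.lie_bracket_tangent[OF X Y]]] by (simp add: dF_apply x y_def)
  also have "\<dots> = (\<Sum>b\<in>Basis. X p (\<lambda>q. Y q (y b)) *\<^sub>R Z b (F p)) - (\<Sum>b\<in>Basis. Y p (\<lambda>q. X q (y b)) *\<^sub>R Z b (F p))"
    by (simp add: lie_bracket_def y scaleR_diff_left sum_subtractf)
  finally show ?thesis
    using main[OF X Y] main[OF Y X] N.nabla_torsion_free[OF ext ext, of X Y "F p"] commute by simp
qed

end

section \<open>Horizontally conformal submersions\<close>

locale conformal_submersion = pullback_connection_space M N F nabla nablaN nablaF
  for M :: "('a::{t2_space,second_countable_topology}, 'e::euclidean_space) manifold"
    and N :: "('b::{t2_space,second_countable_topology}, 'f::euclidean_space) manifold"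
    and F nabla nablaN nablaF +
  fixes dil :: "'a \<Rightarrow> real"
  assumes horizontally_conformal: "horizontally_conformal M N F dil"
begin

abbreviation V :: "'a \<Rightarrow> 'a tangent set" where "V \<equiv> vertical M N F"
abbreviation H :: "'a \<Rightarrow> 'a tangent set" where "H \<equiv> horizontal M N F"

lemma dil_smooth: "dil \<in> smooth_functions M" and dil_pos: "dil p > 0"
  using horizontally_conformal by (auto simp: horizontally_conformal_def)

lemma ln_dil_smooth: "(\<lambda>q. ln (dil q)) \<in> smooth_functions M"
  by (rule M.smooth_post_compose[OF dil_smooth dil_pos smooth_on_ln])

lemma vertical_tangent: "v \<in> V p \<Longrightarrow> v \<in> tangent_space M p"
  by (simp add: vertical_def)

lemma horizontal_tangent: "v \<in> H p \<Longrightarrow> v \<in> tangent_space M p"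
  by (simp add: horizontal_def)

lemma dF_vertical: "v \<in> V p \<Longrightarrow> dF p v = 0"
  by (simp add: vertical_def)

lemma horizontal_orthogonal: "h \<in> H p \<Longrightarrow> v \<in> V p \<Longrightarrow> metric M p h v = 0"
  by (simp add: horizontal_def)

lemma vertical_orthogonal: "h \<in> H p \<Longrightarrow> v \<in> V p \<Longrightarrow> metric M p v h = 0"
  by (metis M.metric_sym horizontal_orthogonal horizontal_tangent vertical_tangent)

lemma subspace_vertical: "subspace (V p)"
proof -
  have "dF p 0 = 0" using dF_scale[of p 0 0] by simp
  then show ?thesis
    by (auto simp: subspace_def vertical_def dF_add dF_scale M.tangent_closed)
qed

lemma subspace_horizontal: "subspace (H p)"
  using M.metric_zero_left M.metric_add_left M.metric_scale_left
  by (auto simp: subspace_def horizontal_def M.tangent_closed vertical_tangent)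

lemma vertical_horizontal_zero: "v \<in> V p \<Longrightarrow> v \<in> H p \<Longrightarrow> v = 0"
  using M.metric_nondegenerate horizontal_orthogonal vertical_tangent by blast

lemma vertical_horizontal_unique:
  assumes "v \<in> V p" "h \<in> H p" "v' \<in> V p" "h' \<in> H p" "v + h = v' + h'"
  shows "v = v'" "h = h'"
proof -
  have e: "v - v' = h' - h" using assms(5) by (simp add: algebra_simps)
  have "v - v' \<in> V p" using subspace_diff[OF subspace_vertical] assms by blast
  moreover have "v - v' \<in> H p" unfolding e using subspace_diff[OF subspace_horizontal] assms by blast
  ultimately have "v - v' = 0" by (rule vertical_horizontal_zero)
  then show "v = v'" by (rule eq_iff_diff_eq_0[THEN iffD2])
  then show "h = h'" using assms(5) by (metis add_left_cancel)
qed

abbreviation PV :: "'a field \<Rightarrow> 'a field" where "PV \<equiv> orth_proj M V"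
abbreviation PH :: "'a field \<Rightarrow> 'a field" where "PH \<equiv> orth_proj M H"

lemma
  assumes X: "X p \<in> tangent_space M p"
  shows PV_vertical: "PV X p \<in> V p" and PH_horizontal: "PH X p \<in> H p"
    and PV_plus_PH: "PV X p + PH X p = X p"
proof -
  have sub: "V p \<subseteq> tangent_space M p" "H p \<subseteq> tangent_space M p"
    using vertical_tangent horizontal_tangent by auto
  show v: "PV X p \<in> V p" by (rule M.orth_proj_in[where D = V and X = X, OF subspace_vertical sub(1) X])
  have "X p - PV X p \<in> H p"
    using M.orth_proj_orthogonal[where D = V and X = X, OF subspace_vertical sub(1) X] M.tangent_closed(3)[OF X vertical_tangent[OF v]]
    by (simp add: horizontal_def)
  then have "PH X p = X p - PV X p"
    by (rule M.orth_proj_unique[where D = H and X = X, OF subspace_horizontal sub(2) X]) (simp add: vertical_orthogonal v)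
  with \<open>X p - PV X p \<in> H p\<close> show "PH X p \<in> H p" "PV X p + PH X p = X p" by simp_all
qed

lemma PV_PH_eqI:
  assumes "v \<in> V p" "h \<in> H p" "X p = v + h"
  shows "PV X p = v" "PH X p = h"
proof -
  have X: "X p \<in> tangent_space M p"
    using assms M.tangent_closed(2)[OF vertical_tangent horizontal_tangent] by simp
  show "PV X p = v" "PH X p = h"
    using vertical_horizontal_unique[OF PV_vertical[of X, OF X] PH_horizontal[of X, OF X] assms(1,2)]
      PV_plus_PH[of X, OF X] assms(3) by auto
qed

lemma PH_of_horizontal: "X p \<in> H p \<Longrightarrow> PH X p = X p" and PV_of_horizontal: "X p \<in> H p \<Longrightarrow> PV X p = 0"
  using PV_PH_eqI[OF subspace_0[OF subspace_vertical], of "X p" p X] by simp_all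

lemma PH_of_vertical: "X p \<in> V p \<Longrightarrow> PH X p = 0" and PV_of_vertical: "X p \<in> V p \<Longrightarrow> PV X p = X p"
  using PV_PH_eqI[OF _ subspace_0[OF subspace_horizontal], of "X p" p X] by simp_all

lemma metric_PH:
  assumes X: "X p \<in> tangent_space M p" and h: "h \<in> H p"
  shows "metric M p (PH X p) h = metric M p (X p) h"
proof -
  have "metric M p (X p) h = metric M p (PV X p) h + metric M p (PH X p) h"
    using M.metric_add_left[OF vertical_tangent[OF PV_vertical[of X, OF X]] horizontal_tangent[OF PH_horizontal[of X, OF X]]
        horizontal_tangent[OF h]] PV_plus_PH[of X, OF X] by simp
  then show ?thesis using vertical_orthogonal[OF h PV_vertical[of X, OF X]] by simp
qed

lemma sectionsD:
  assumes "X \<in> sections M D"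
  shows "X \<in> vector_fields M" "X p \<in> D p"
  using assms by (auto simp: sections_def)

text \<open>The gradients of functions pulled back from \<open>N\<close> fill out the horizontal spaces: what is
  orthogonal to all of them is killed by \<open>F\<^sub>*\<close>. Hence a horizontal vector extends to a smooth
  horizontal field, although smoothness of the horizontal projection is not known at this point.\<close>

lemma grad_pullback_section:
  assumes h: "h \<in> smooth_functions N"
  shows "grad M (\<lambda>q. h (F q)) \<in> sections M H"
proof -
  note hF = smooth_pullback[OF h]
  have "grad M (\<lambda>q. h (F q)) p \<in> H p" for p
    unfolding horizontal_def
  proof (intro CollectI conjI ballI M.grad_tangent[OF hF])
    fix v assume v: "v \<in> V p"
    have "metric M p (grad M (\<lambda>q. h (F q)) p) v = dF p v h"
      by (simp add: M.metric_grad[OF hF vertical_tangent[OF v]] dF_apply[OF h])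
    then show "metric M p (grad M (\<lambda>q. h (F q)) p) v = 0" by (simp add: dF_vertical[OF v])
  qed
  then show ?thesis using M.grad_vector_field[OF hF] by (simp add: sections_def)
qed

lemma horizontal_vector_extends:
  assumes w: "w \<in> H p"
  obtains X where "X \<in> sections M H" "X p = w"
proof -
  \<comment> \<open>a subspace of the horizontal space at \<open>p\<close> with trivial orthogonal complement therein\<close>
  define G where "G = {grad M (\<lambda>q. h (F q)) p | h. h \<in> smooth_functions N}"
  have wT: "w \<in> tangent_space M p" by (rule horizontal_tangent[OF w])
  have GH: "G \<subseteq> H p" using sectionsD(2)[OF grad_pullback_section] by (auto simp: G_def)
  then have GT: "G \<subseteq> tangent_space M p" using horizontal_tangent by auto
  have gradI: "u \<in> G" if "u \<in> tangent_space M p" "h \<in> smooth_functions N"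
    "\<And>v. v \<in> tangent_space M p \<Longrightarrow> metric M p u v = v (\<lambda>q. h (F q))" for u h
  proof -
    have "u = grad M (\<lambda>q. h (F q)) p"
      by (rule M.metric_eqI[OF that(1) M.grad_tangent[OF smooth_pullback[OF that(2)]]])
        (simp add: that(3) M.metric_grad[OF smooth_pullback[OF that(2)]])
    then show ?thesis using that(2) by (auto simp: G_def)
  qed
  have gradD: "\<exists>h\<in>smooth_functions N. \<forall>v\<in>tangent_space M p. metric M p u v = v (\<lambda>q. h (F q))" if "u \<in> G" for u
    using that M.metric_grad[OF smooth_pullback] by (auto simp: G_def)
  have "subspace G"
    unfolding subspace_def
  proof (intro conjI ballI allI)
    show "0 \<in> G"
      by (rule gradI[OF _ N.smooth_const[of 0]])
        (simp_all add: M.tangent_closed M.metric_zero_left M.tangent_const)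
    fix u assume u: "u \<in> G"
    then obtain h where h: "h \<in> smooth_functions N" "\<forall>v\<in>tangent_space M p. metric M p u v = v (\<lambda>q. h (F q))"
      using gradD by blast
    have uT: "u \<in> tangent_space M p" using u GT by auto
    show "c *\<^sub>R u \<in> G" for c
      by (rule gradI[OF M.tangent_closed(4)[OF uT] N.smooth_cmult[OF h(1), of c]])
        (simp add: M.metric_scale_left[OF uT] h M.tangent_cmult[OF _ smooth_pullback[OF h(1)]])
    fix u' assume u': "u' \<in> G"
    then obtain h' where h': "h' \<in> smooth_functions N" "\<forall>v\<in>tangent_space M p. metric M p u' v = v (\<lambda>q. h' (F q))"
      using gradD by blast
    have uT': "u' \<in> tangent_space M p" using u' GT by auto
    show "u + u' \<in> G"
      by (rule gradI[OF M.tangent_closed(2)[OF uT uT'] N.smooth_add[OF h(1) h'(1)]])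
        (simp add: M.metric_add_left[OF uT uT'] h h' M.tangent_add[OF _ smooth_pullback[OF h(1)] smooth_pullback[OF h'(1)]])
  qed
  then obtain u where u: "u \<in> G" "\<And>y. y \<in> G \<Longrightarrow> metric M p (w - u) y = 0"
    using M.orthogonal_projection_exists[OF _ GT wT] by blast
  have uT: "u \<in> tangent_space M p" using u GT by auto
  have dT: "w - u \<in> tangent_space M p" by (rule M.tangent_closed(3)[OF wT uT])
  have "dF p (w - u) = 0"
  proof (rule N.tangent_eqI[OF dF_tangent[OF dT] N.tangent_closed(1)])
    fix h assume h: "h \<in> smooth_functions N"
    have "dF p (w - u) h = metric M p (grad M (\<lambda>q. h (F q)) p) (w - u)"
      unfolding dF_apply[OF h] by (rule M.metric_grad[OF smooth_pullback[OF h] dT, symmetric])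
    also have "\<dots> = metric M p (w - u) (grad M (\<lambda>q. h (F q)) p)"
      by (rule M.metric_sym[OF M.grad_tangent[OF smooth_pullback[OF h]] dT])
    also have "\<dots> = 0" using u(2) h by (auto simp: G_def)
    finally show "dF p (w - u) h = 0 h" by simp
  qed
  then have "w - u \<in> V p" using dT by (simp add: vertical_def)
  moreover have "w - u \<in> H p" using subspace_diff[OF subspace_horizontal w] u(1) GH by blast
  ultimately have "w - u = 0" by (rule vertical_horizontal_zero)
  then have "w = u" by (rule eq_iff_diff_eq_0[THEN iffD2])
  moreover obtain h where "h \<in> smooth_functions N" "u = grad M (\<lambda>q. h (F q)) p"
    using u(1) by (auto simp: G_def)
  ultimately show thesis using that[OF grad_pullback_section] by simp
qed

text \<open>Conformality is given for pairs of horizontal fields. It extends to pairs of vectors by extension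
  to fields, and only one of them has to be horizontal, since both sides vanish for vertical \<open>w\<close>.\<close>

lemma conformal:
  assumes w: "w \<in> tangent_space M p" and h: "h \<in> H p"
  shows "metric N (F p) (dF p w) (dF p h) = (dil p)\<^sup>2 * metric M p w h"
proof -
  have "dF p w = dF p (PH (\<lambda>_. w) p)"
    using dF_add[of p "PV (\<lambda>_. w) p" "PH (\<lambda>_. w) p"] PV_plus_PH[of "\<lambda>_. w" p] w
      dF_vertical[OF PV_vertical[of "\<lambda>_. w" p]] by simp
  moreover obtain X where X: "X \<in> sections M H" "X p = PH (\<lambda>_. w) p"
    by (rule horizontal_vector_extends[OF PH_horizontal[of "\<lambda>_. w" p]]) (use w in auto)
  moreover obtain Y where Y: "Y \<in> sections M H" "Y p = h"
    by (rule horizontal_vector_extends[OF h])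
  moreover have "metric N (F p) (dF p (X p)) (dF p (Y p)) = (dil p)\<^sup>2 * metric M p (X p) (Y p)"
    using horizontally_conformal X(1) Y(1) by (simp add: horizontally_conformal_def)
  ultimately show ?thesis using metric_PH[of "\<lambda>_. w" p h] w h by simp
qed

text \<open>By conformality, \<open>g(\<H>X, Y) = \<lambda>\<^sup>-\<^sup>2 g'(F\<^sub>*X, F\<^sub>*Y)\<close>, and the right-hand side is smooth.\<close>

lemma PH_vector_field:
  assumes X: "X \<in> vector_fields M"
  shows "PH X \<in> vector_fields M"
proof (rule M.vector_fields_metricI)
  fix p
  note XT = M.vector_field_tangent[OF X]
  show "PH X p \<in> tangent_space M p" by (rule horizontal_tangent[OF PH_horizontal[of X p, OF XT]])
next
  fix Y assume Y: "Y \<in> vector_fields M"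
  have eq: "metric M p (PH X p) (Y p) = inverse (dil p * dil p) * metric N (F p) (dF p (X p)) (dF p (Y p))" for p
  proof -
    note XT = M.vector_field_tangent[OF X, of p] and YT = M.vector_field_tangent[OF Y, of p]
    note h = PH_horizontal[of X p, OF XT]
    have "dF p (X p) = dF p (PH X p)"
      using dF_add[of p "PV X p" "PH X p"] PV_plus_PH[of X p, OF XT] dF_vertical[OF PV_vertical[of X p, OF XT]]
      by simp
    then have "metric N (F p) (dF p (X p)) (dF p (Y p)) = (dil p)\<^sup>2 * metric M p (PH X p) (Y p)"
      using conformal[OF YT h]
      by (simp add: M.metric_sym[OF horizontal_tangent[OF h] YT]
          N.metric_sym[OF dF_tangent[OF horizontal_tangent[OF h]] dF_tangent[OF YT]])
    then show ?thesis using dil_pos[of p] by (simp add: power2_eq_square field_simps)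
  qed
  have "(\<lambda>q. inverse (dil q * dil q)) \<in> smooth_functions M"
    by (rule M.smooth_post_compose[OF M.smooth_mult[OF dil_smooth dil_smooth] _ smooth_on_inverse])
      (simp add: dil_pos)
  then show "(\<lambda>p. metric M p (PH X p) (Y p)) \<in> smooth_functions M"
    unfolding eq by (intro M.smooth_mult metric_along_smooth fields_along_dF X Y)
qed

lemma PV_vector_field:
  assumes X: "X \<in> vector_fields M"
  shows "PV X \<in> vector_fields M"
proof -
  have "PV X = (\<lambda>p. X p - PH X p)"
  proof
    show "PV X p = X p - PH X p" for p
      using PV_plus_PH[of X p, OF M.vector_field_tangent[OF X]] by (simp add: eq_diff_eq)
  qed
  then show ?thesis using M.vector_fields_diff[OF X PH_vector_field[OF X]] by simp
qed

lemma vertical_vector_extends: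
  assumes v: "v \<in> V p"
  obtains X where "X \<in> sections M V" "X p = v"
proof -
  obtain X where X: "X \<in> vector_fields M" "X p = v"
    by (rule M.tangent_vector_extends[OF vertical_tangent[OF v]])
  show thesis
  proof (rule that)
    show "PV X \<in> sections M V"
      using PV_vector_field[OF X(1)] PV_vertical M.vector_field_tangent[OF X(1)] by (simp add: sections_def)
    show "PV X p = v" using PV_of_vertical[of X p] X(2) v by simp
  qed
qed

text \<open>The second fundamental form of a horizontally conformal map. The difference of the two sides
  of the Koszul formulas for \<open>\<nabla>\<close> and for \<open>\<nabla>\<^sup>F\<close> consists of the derivatives of the
  conformal factor.\<close>

lemma nablaF_horizontal:
  assumes X: "X \<in> sections M H" and Y: "Y \<in> sections M H" and Z: "Z \<in> sections M H"
  shows "metric N (F p) (nablaF X (\<lambda>q. dF q (Y q)) p) (dF p (Z p)) = (dil p)\<^sup>2 *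
    (metric M p (nabla X Y p) (Z p)
      + X p (\<lambda>q. ln (dil q)) * metric M p (Y p) (Z p)
      + Y p (\<lambda>q. ln (dil q)) * metric M p (X p) (Z p)
      - Z p (\<lambda>q. ln (dil q)) * metric M p (X p) (Y p))"
proof -
  define L where "L A B C = metric N (F p) (nablaF A (\<lambda>q. dF q (B q)) p) (dF p (C p))
    - (dil p)\<^sup>2 * metric M p (nabla A B p) (C p)" for A B C
  \<comment> \<open>symmetric since both connections are torsion-free, and skew up to the derivative of \<open>\<lambda>\<^sup>2\<close> since
    both are metric\<close>
  have sym: "L A B C = L B A C" if A: "A \<in> sections M H" and B: "B \<in> sections M H" and C: "C \<in> sections M H" for A B C
  proof -
    note Af = sectionsD[OF A] and Bf = sectionsD[OF B] and Cf = sectionsD[OF C]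
    have "metric N (F p) (nablaF A (\<lambda>q. dF q (B q)) p) (dF p (C p)) - metric N (F p) (nablaF B (\<lambda>q. dF q (A q)) p) (dF p (C p))
      = metric N (F p) (dF p (lie_bracket M A B p)) (dF p (C p))"
      unfolding nablaF_torsion_free[OF Af(1) Bf(1), symmetric]
      by (rule N.metric_diff_left[symmetric])
        (intro nablaF_tangent Af Bf fields_along_dF dF_tangent horizontal_tangent Cf)+
    also have "\<dots> = (dil p)\<^sup>2 * metric M p (lie_bracket M A B p) (C p)"
      by (rule conformal[OF M.lie_bracket_tangent[OF Af(1) Bf(1)] Cf(2)])
    also have "metric M p (lie_bracket M A B p) (C p) = metric M p (nabla A B p) (C p) - metric M p (nabla B A p) (C p)"
      unfolding M.nabla_torsion_free[OF Af(1) Bf(1), symmetric]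
      by (rule M.metric_diff_left) (intro M.nabla_tangent Af Bf horizontal_tangent Cf)+
    finally show ?thesis by (simp add: L_def algebra_simps)
  qed
  have skew: "L A B C + L A C B = 2 * ((dil p)\<^sup>2 * (A p (\<lambda>q. ln (dil q)) * metric M p (B p) (C p)))"
    if A: "A \<in> sections M H" and B: "B \<in> sections M H" and C: "C \<in> sections M H" for A B C
  proof -
    note Af = sectionsD[OF A] and Bf = sectionsD[OF B] and Cf = sectionsD[OF C]
    note AT = M.vector_field_tangent[OF Af(1)]
    let ?g = "\<lambda>q. metric M q (B q) (C q)"
    have g: "?g \<in> smooth_functions M" by (rule M.metric_smooth[OF Bf(1) Cf(1)])
    have "(\<lambda>q. metric N (F q) (dF q (B q)) (dF q (C q))) = (\<lambda>q. (dil q * dil q) * ?g q)"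
      using conformal[OF horizontal_tangent[OF Bf(2)] Cf(2)] by (simp add: power2_eq_square)
    then have "A p (\<lambda>q. (dil q * dil q) * ?g q) =
      metric N (F p) (nablaF A (\<lambda>q. dF q (B q)) p) (dF p (C p)) + metric N (F p) (dF p (B p)) (nablaF A (\<lambda>q. dF q (C q)) p)"
      using nablaF_metric[OF Af(1) fields_along_dF[OF Bf(1)] fields_along_dF[OF Cf(1)], of p] by simp
    moreover have "metric N (F p) (dF p (B p)) (nablaF A (\<lambda>q. dF q (C q)) p) = metric N (F p) (nablaF A (\<lambda>q. dF q (C q)) p) (dF p (B p))"
      by (rule N.metric_sym) (intro nablaF_tangent Af Bf Cf fields_along_dF dF_tangent horizontal_tangent)+
    moreover have "A p (\<lambda>q. (dil q * dil q) * ?g q) = 2 * (dil p * A p dil * ?g p)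
        + (dil p)\<^sup>2 * (metric M p (nabla A B p) (C p) + metric M p (B p) (nabla A C p))"
      unfolding M.tangent_mult[OF AT M.smooth_mult[OF dil_smooth dil_smooth] g] M.tangent_mult[OF AT dil_smooth dil_smooth]
        M.nabla_metric[OF Af(1) Bf(1) Cf(1)] by (simp add: power2_eq_square algebra_simps)
    moreover have "metric M p (B p) (nabla A C p) = metric M p (nabla A C p) (B p)"
      by (rule M.metric_sym) (intro M.nabla_tangent horizontal_tangent Af Bf Cf)+
    moreover have "dil p * A p dil = (dil p)\<^sup>2 * A p (\<lambda>q. ln (dil q))"
      using M.tangent_chain_rule[OF AT dil_smooth ln_dil_smooth DERIV_ln[OF dil_pos]] dil_pos[of p]
      by (simp add: power2_eq_square)
    ultimately show ?thesis by (simp add: L_def algebra_simps)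
  qed
  have "metric M p (X p) (Z p) = metric M p (Z p) (X p)" "metric M p (Y p) (X p) = metric M p (X p) (Y p)"
    "metric M p (Y p) (Z p) = metric M p (Z p) (Y p)"
    by (intro M.metric_sym horizontal_tangent sectionsD(2)[OF X] sectionsD(2)[OF Y] sectionsD(2)[OF Z])+
  then have "L X Y Z = (dil p)\<^sup>2 * (X p (\<lambda>q. ln (dil q)) * metric M p (Y p) (Z p))
    + (dil p)\<^sup>2 * (Y p (\<lambda>q. ln (dil q)) * metric M p (X p) (Z p))
    - (dil p)\<^sup>2 * (Z p (\<lambda>q. ln (dil q)) * metric M p (X p) (Y p))"
    using skew[OF X Y Z] skew[OF Y X Z] skew[OF Z X Y] sym[OF X Y Z] sym[OF X Z Y] sym[OF Y Z X] by linarith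
  then show ?thesis by (simp add: L_def algebra_simps)
qed

end

section \<open>Conformal anti-invariant submersions from Kaehler manifolds\<close>

locale anti_invariant_submersion = conformal_submersion M N F nabla nablaN nablaF dil
  for M :: "('a::{t2_space,second_countable_topology}, 'e::euclidean_space) manifold"
    and N :: "('b::{t2_space,second_countable_topology}, 'f::euclidean_space) manifold"
    and F nabla nablaN nablaF dil +
  fixes J :: "'a \<Rightarrow> 'a tangent \<Rightarrow> 'a tangent"
  assumes kaehler: "kaehler_manifold M J nabla"
    and J_vertical: "v \<in> vertical M N F p \<Longrightarrow> J p v \<in> horizontal M N F p"
begin

lemma J_vector_field: "X \<in> vector_fields M \<Longrightarrow> (\<lambda>q. J q (X q)) \<in> vector_fields M"
  using kaehler by (simp add: kaehler_manifold_def tensor_field_1_1_def)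

lemma metric_J:
  "u \<in> tangent_space M p \<Longrightarrow> v \<in> tangent_space M p \<Longrightarrow> metric M p (J p u) (J p v) = metric M p u v"
  using kaehler by (simp add: kaehler_manifold_def)

lemma nabla_J:
  assumes "X \<in> vector_fields M" "Y \<in> vector_fields M"
  shows "nabla X (\<lambda>q. J q (Y q)) p = J p (nabla X Y p)"
proof -
  have "nabla X (\<lambda>q. J q (Y q)) p - J p (nabla X Y p) = 0"
    using kaehler assms by (simp add: kaehler_manifold_def)
  then show ?thesis by (rule eq_iff_diff_eq_0[THEN iffD2])
qed

text \<open>The horizontal part of \<open>JY\<close> lies in \<open>\<mu>\<close> already: \<open>g(JY, JV) = g(Y, V) = 0\<close>, and the vertical part is
  orthogonal to the horizontal vector \<open>JV\<close>.\<close>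

lemma
  assumes Y: "Y \<in> sections M H"
  shows B_part_eq: "B_part M N F J Y = PV (\<lambda>q. J q (Y q))"
    and C_part_eq: "C_part M N F J Y = PH (\<lambda>q. J q (Y q))"
    and C_part_mu: "C_part M N F J Y p \<in> mu M N F J p"
proof -
  let ?Z = "\<lambda>q. J q (Y q)"
  have ZT: "?Z p \<in> tangent_space M p" for p
    by (rule M.vector_field_tangent[OF J_vector_field[OF sectionsD(1)[OF Y]]])
  note v = PV_vertical[of ?Z, OF ZT] and h = PH_horizontal[of ?Z, OF ZT] and vh = PV_plus_PH[of ?Z, OF ZT]
  have mu: "PH ?Z p \<in> mu M N F J p" for p
    unfolding mu_def
  proof (intro CollectI conjI ballI h)
    fix u assume u: "u \<in> V p"
    have "metric M p (PH ?Z p) (J p u) = metric M p (J p (Y p)) (J p u)"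
      by (rule metric_PH[of ?Z p, OF ZT J_vertical[OF u]])
    also have "\<dots> = metric M p (Y p) u"
      by (rule metric_J) (intro horizontal_tangent vertical_tangent sectionsD(2)[OF Y] u)+
    finally show "metric M p (PH ?Z p) (J p u) = 0"
      using horizontal_orthogonal[OF sectionsD(2)[OF Y] u] by simp
  qed
  have uniq: "b = PV ?Z p" "c = PH ?Z p"
    if "b \<in> V p" "c \<in> mu M N F J p" "J p (Y p) = b + c" for b c p
    using PV_PH_eqI[of b p c ?Z] that by (auto simp: mu_def)
  show "B_part M N F J Y = PV ?Z"
  proof
    show "B_part M N F J Y p = PV ?Z p" for p
      unfolding B_part_def
    proof (rule the_equality)
      show "PV ?Z p \<in> V p \<and> (\<exists>c\<in>mu M N F J p. J p (Y p) = PV ?Z p + c)"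
        using v mu vh[symmetric] by blast
    qed (use uniq in blast)
  qed
  show C: "C_part M N F J Y = PH ?Z"
  proof
    show "C_part M N F J Y p = PH ?Z p" for p
      unfolding C_part_def
    proof (rule the_equality)
      show "PH ?Z p \<in> mu M N F J p \<and> (\<exists>b\<in>V p. J p (Y p) = b + PH ?Z p)"
        using v mu vh[symmetric] by blast
    qed (use uniq in blast)
  qed
  show "C_part M N F J Y p \<in> mu M N F J p" unfolding C by (rule mu)
qed

text \<open>The other summand of \<open>A\<close> is the derivative of \<open>\<H>W = 0\<close>.\<close>

lemma oneill_A_vertical:
  assumes X: "X \<in> sections M H" and W: "W \<in> sections M V"
  shows "oneill_A M N F nabla X W p = PH (nabla X W) p"
proof -
  note Xf = sectionsD[OF X] and Wf = sectionsD[OF W]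
  have 1: "PH X = X" "PH W = (\<lambda>_. 0)" "PV W = W"
    using PH_of_horizontal[of X] PH_of_vertical[of W] PV_of_vertical[of W] Xf(2) Wf(2) by blast+
  have "nabla X (\<lambda>_. 0) p = 0" by (rule M.nabla.D_zero[OF Xf(1)])
  then have "PV (nabla X (\<lambda>_. 0)) p = 0"
    using PV_of_horizontal[of "nabla X (\<lambda>_. 0)" p] subspace_0[OF subspace_horizontal] by simp
  then show ?thesis by (simp add: oneill_A_def 1)
qed

text \<open>Since \<open>J\<close> is parallel and orthogonal, \<open>g(\<nabla>\<^sub>XY, V) = g(\<nabla>\<^sub>XBY, JV) + g(\<nabla>\<^sub>XCY, JV)\<close>. The first
  summand is given by O'Neill's tensor, the second one involves horizontal fields only and
  is transported to \<open>N\<close>. One derivative of the dilation drops out as \<open>CY\<close> is orthogonal to \<open>JV\<close>.\<close>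

lemma vertical_component_nabla:
  assumes X: "X \<in> sections M H" and Y: "Y \<in> sections M H" and W: "W \<in> sections M V"
  shows "metric M p (nabla X Y p) (W p) =
    1 / (dil p)\<^sup>2 * metric N (F p) (nablaF X (\<lambda>q. dF q (C_part M N F J Y q)) p) (dF p (J p (W p)))
    + metric M p (oneill_A M N F nabla X (B_part M N F J Y) p) (J p (W p))
    - metric M p (PH (grad M (\<lambda>q. ln (dil q))) p) (C_part M N F J Y p) * metric M p (X p) (J p (W p))
    + metric M p (PH (grad M (\<lambda>q. ln (dil q))) p) (J p (W p)) * metric M p (X p) (C_part M N F J Y p)"
proof -
  note Xf = sectionsD[OF X] and Yf = sectionsD[OF Y] and Wf = sectionsD[OF W]
  let ?Z = "\<lambda>q. J q (Y q)" and ?K = "\<lambda>q. J q (W q)"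
  let ?B = "B_part M N F J Y" and ?C = "C_part M N F J Y"
  have Z: "?Z \<in> vector_fields M" by (rule J_vector_field[OF Yf(1)])
  note ZT = M.vector_field_tangent[OF Z]
  have K: "?K \<in> sections M H"
    using J_vector_field[OF Wf(1)] J_vertical[OF Wf(2)] by (simp add: sections_def)
  have B: "?B \<in> sections M V"
    using PV_vector_field[OF Z] PV_vertical[of ?Z, OF ZT] by (simp add: B_part_eq[OF Y] sections_def)
  have C: "?C \<in> sections M H"
    using PH_vector_field[OF Z] PH_horizontal[of ?Z, OF ZT] by (simp add: C_part_eq[OF Y] sections_def)
  note Kf = sectionsD[OF K] and Bf = sectionsD[OF B] and Cf = sectionsD[OF C]
  note KT = horizontal_tangent[OF Kf(2)]
  have split: "?Z = (\<lambda>q. ?B q + ?C q)"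
    using PV_plus_PH[of ?Z, OF ZT] by (simp add: B_part_eq[OF Y] C_part_eq[OF Y])
  have "metric M p (nabla X Y p) (W p) = metric M p (J p (nabla X Y p)) (?K p)"
    by (rule metric_J[symmetric]) (intro M.nabla_tangent Xf Yf vertical_tangent Wf)+
  also have "J p (nabla X Y p) = nabla X (\<lambda>q. ?B q + ?C q) p"
    unfolding split[symmetric] by (rule nabla_J[OF Xf(1) Yf(1), symmetric])
  also have "\<dots> = nabla X ?B p + nabla X ?C p" by (rule M.nabla.D_add[OF Xf(1) Bf(1) Cf(1)])
  also have "metric M p \<dots> (?K p) = metric M p (nabla X ?B p) (?K p) + metric M p (nabla X ?C p) (?K p)"
    by (rule M.metric_add_left) (intro M.nabla_tangent Xf Bf Cf KT)+
  finally have main: "metric M p (nabla X Y p) (W p) =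
    metric M p (nabla X ?B p) (?K p) + metric M p (nabla X ?C p) (?K p)" .
  have A: "metric M p (oneill_A M N F nabla X ?B p) (?K p) = metric M p (nabla X ?B p) (?K p)"
    unfolding oneill_A_vertical[OF X B] by (rule metric_PH[of "nabla X ?B", OF M.nabla_tangent[OF Xf(1) Bf(1)] Kf(2)])
  have CK: "metric M p (?C p) (?K p) = 0"
    using C_part_mu[OF Y, of p] Wf(2)[of p] by (simp add: mu_def)
  have grad: "metric M p (PH (grad M (\<lambda>q. ln (dil q))) p) h = h (\<lambda>q. ln (dil q))" if "h \<in> H p" for h
    using metric_PH[of "grad M (\<lambda>q. ln (dil q))", OF M.grad_tangent[OF ln_dil_smooth] that]
      M.metric_grad[OF ln_dil_smooth horizontal_tangent[OF that]] by simp
  have "1 / (dil p)\<^sup>2 * metric N (F p) (nablaF X (\<lambda>q. dF q (?C q)) p) (dF p (?K p)) =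
    metric M p (nabla X ?C p) (?K p) + ?C p (\<lambda>q. ln (dil q)) * metric M p (X p) (?K p)
      - ?K p (\<lambda>q. ln (dil q)) * metric M p (X p) (?C p)"
    unfolding nablaF_horizontal[OF X C K] CK using dil_pos[of p] by simp
  then show ?thesis
    unfolding main A grad[OF Cf(2)] grad[OF Kf(2)] by simp
qed

text \<open>A vector is horizontal if it is orthogonal to all smooth vertical fields at its base point, as
  these attain every vertical value there.\<close>

lemma totally_geodesic_iff:
  "totally_geodesic_foliation M nabla H \<longleftrightarrow>
    (\<forall>X\<in>sections M H. \<forall>Y\<in>sections M H. \<forall>W\<in>sections M V. \<forall>p. metric M p (nabla X Y p) (W p) = 0)"
proof
  assume "totally_geodesic_foliation M nabla H"
  then show "\<forall>X\<in>sections M H. \<forall>Y\<in>sections M H. \<forall>W\<in>sections M V. \<forall>p. metric M p (nabla X Y p) (W p) = 0"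
    unfolding totally_geodesic_foliation_def using horizontal_orthogonal sectionsD(2) by metis
next
  assume *: "\<forall>X\<in>sections M H. \<forall>Y\<in>sections M H. \<forall>W\<in>sections M V. \<forall>p. metric M p (nabla X Y p) (W p) = 0"
  show "totally_geodesic_foliation M nabla H"
    unfolding totally_geodesic_foliation_def
  proof (intro ballI)
    fix X Y assume X: "X \<in> sections M H" and Y: "Y \<in> sections M H"
    have "metric M p (nabla X Y p) v = 0" if "v \<in> V p" for p v
      using vertical_vector_extends[OF that] * X Y by metis
    then show "nabla X Y \<in> sections M H"
      using M.nabla_tangent M.nabla.D_in sectionsD(1)[OF X] sectionsD(1)[OF Y]
      by (simp add: sections_def horizontal_def)
  qed
qed

end

theorem theorem3p8:
  fixes M :: "('a::{t2_space,second_countable_topology}, 'e::euclidean_space) manifold"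
    and N :: "('b::{t2_space,second_countable_topology}, 'f::euclidean_space) manifold"
    and F :: "'a \<Rightarrow> 'b"
    and J :: "'a \<Rightarrow> 'a tangent \<Rightarrow> 'a tangent"
    and dil :: "'a \<Rightarrow> real"
    and nabla :: "'a field \<Rightarrow> 'a field \<Rightarrow> 'a field"
    and nablaN :: "'b field \<Rightarrow> 'b field \<Rightarrow> 'b field"
    and nablaF :: "'a field \<Rightarrow> ('a \<Rightarrow> 'b tangent) \<Rightarrow> ('a \<Rightarrow> 'b tangent)"
  assumes "kaehler_manifold M J nabla"
    and "riemannian_manifold N"
    and "levi_civita N nablaN"
    and "conformal_anti_invariant_submersion M N F J dil"
    and "pullback_connection M N F nablaN nablaF"
  shows "totally_geodesic_foliation M nabla (horizontal M N F) \<longleftrightarrow>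
    (\<forall>X\<in>sections M (horizontal M N F). \<forall>Y\<in>sections M (horizontal M N F).
      \<forall>V\<in>sections M (vertical M N F). \<forall>p.
        1 / (dil p)\<^sup>2 *
          metric N (F p) (nablaF X (\<lambda>q. differential M N F q (C_part M N F J Y q)) p)
            (differential M N F p (J p (V p))) =
        - metric M p (oneill_A M N F nabla X (B_part M N F J Y) p) (J p (V p))
        + metric M p (orth_proj M (horizontal M N F) (grad M (\<lambda>q. ln (dil q))) p)
            (C_part M N F J Y p) * metric M p (X p) (J p (V p))
        - metric M p (orth_proj M (horizontal M N F) (grad M (\<lambda>q. ln (dil q))) p)
            (J p (V p)) * metric M p (X p) (C_part M N F J Y p))"
proof -
  have "riemannian_manifold M" "levi_civita M nabla"
    using assms(1) by (simp_all add: kaehler_manifold_def)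
  moreover have "smooth_map M N F" "horizontally_conformal M N F dil"
    using assms(4) by (auto simp: conformal_anti_invariant_submersion_def submersion_def)
  moreover have "J p v \<in> horizontal M N F p" if "v \<in> vertical M N F p" for v p
    using assms(4) that unfolding conformal_anti_invariant_submersion_def by blast
  ultimately interpret anti_invariant_submersion M N F nabla nablaN nablaF dil J
    using assms by unfold_locales (simp_all add: riemannian_manifold_def)
  show ?thesis
    unfolding totally_geodesic_iff
    by (intro ball_cong refl iff_allI) (auto simp: vertical_component_nabla)
qed

end
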